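(* Working in $\mathsf{ZF}$ (without the axiom of choice): for every infinite set $M$, there is no surjection from $\omega\times M$ onto $\mathcal{P}_{\infty}(M)$, the set of all infinite subsets of $M$.
   Context: For a set $A$, $\mathcal{P}_{\infty}(A)$ denotes the set of all infinite subsets of $A$; $\omega$ is the set of natural numbers. The ambient theory is $\mathsf{ZF}$, without any form of the axiom of choice. *)

theory Defs
  imports Main
begin

text \<open>
  HOL has a choice operator, so a theorem of ZF without choice cannot be rendered as a statement
  about HOL's own sets. It is rendered here as a semantic consequence of first-order ZF: a claim
  about every structure \<open>('a, mem)\<close> satisfying the ZF axioms, with all set-theoretic notions
  interpreted inside that structure. Separation and Replacement are schemata over first-order
  formulas (with parameters). Ranging over arbitrary HOL predicates instead would give second-order
  ZF, whose models inherit choice from HOL. Taking the domain to be a whole type loses nothing: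
  by completeness and Loewenheim-Skolem the instance \<open>'a = nat\<close> already amounts to provability in ZF
  (no ZF model is finite).
\<close>

datatype fm =
    Mem nat nat
  | Eq nat nat
  | Neg fm
  | Conj fm fm
  | All nat fm

primrec sat :: "('a \<Rightarrow> 'a \<Rightarrow> bool) \<Rightarrow> (nat \<Rightarrow> 'a) \<Rightarrow> fm \<Rightarrow> bool" where
  "sat mem e (Mem i j) \<longleftrightarrow> mem (e i) (e j)"
| "sat mem e (Eq i j) \<longleftrightarrow> e i = e j"
| "sat mem e (Neg p) \<longleftrightarrow> \<not> sat mem e p"
| "sat mem e (Conj p q) \<longleftrightarrow> sat mem e p \<and> sat mem e q"
| "sat mem e (All i p) \<longleftrightarrow> (\<forall>a. sat mem (e(i := a)) p)"

locale set_structure =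
  fixes mem :: "'a \<Rightarrow> 'a \<Rightarrow> bool"  (infix "\<epsilon>" 50)
begin

definition subset_of :: "'a \<Rightarrow> 'a \<Rightarrow> bool" where
  "subset_of x y \<longleftrightarrow> (\<forall>z. z \<epsilon> x \<longrightarrow> z \<epsilon> y)"

definition is_empty :: "'a \<Rightarrow> bool" where
  "is_empty x \<longleftrightarrow> (\<forall>z. \<not> z \<epsilon> x)"

definition is_upair :: "'a \<Rightarrow> 'a \<Rightarrow> 'a \<Rightarrow> bool" where
  "is_upair x y u \<longleftrightarrow> (\<forall>z. z \<epsilon> u \<longleftrightarrow> z = x \<or> z = y)"

text \<open>Kuratowski pairs: \<open>p = {{x}, {x, y}}\<close>.\<close>

definition is_pair :: "'a \<Rightarrow> 'a \<Rightarrow> 'a \<Rightarrow> bool" where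
  "is_pair x y p \<longleftrightarrow> (\<exists>s t. is_upair x x s \<and> is_upair x y t \<and> is_upair s t p)"

definition is_succ :: "'a \<Rightarrow> 'a \<Rightarrow> bool" where
  "is_succ x y \<longleftrightarrow> (\<forall>z. z \<epsilon> y \<longleftrightarrow> z \<epsilon> x \<or> z = x)"

definition is_inductive :: "'a \<Rightarrow> bool" where
  "is_inductive w \<longleftrightarrow>
     (\<exists>z. is_empty z \<and> z \<epsilon> w) \<and> (\<forall>x. x \<epsilon> w \<longrightarrow> (\<exists>y. is_succ x y \<and> y \<epsilon> w))"

definition is_omega :: "'a \<Rightarrow> bool" where
  "is_omega w \<longleftrightarrow> is_inductive w \<and> (\<forall>v. is_inductive v \<longrightarrow> subset_of w v)"

definition is_product :: "'a \<Rightarrow> 'a \<Rightarrow> 'a \<Rightarrow> bool" where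
  "is_product x y c \<longleftrightarrow> (\<forall>p. p \<epsilon> c \<longleftrightarrow> (\<exists>a b. a \<epsilon> x \<and> b \<epsilon> y \<and> is_pair a b p))"

definition maps_to :: "'a \<Rightarrow> 'a \<Rightarrow> 'a \<Rightarrow> bool" where
  "maps_to f a b \<longleftrightarrow> (\<exists>p. is_pair a b p \<and> p \<epsilon> f)"

definition is_function :: "'a \<Rightarrow> 'a \<Rightarrow> 'a \<Rightarrow> bool" where
  "is_function f x y \<longleftrightarrow>
     (\<forall>p. p \<epsilon> f \<longrightarrow> (\<exists>a b. a \<epsilon> x \<and> b \<epsilon> y \<and> is_pair a b p)) \<and>
     (\<forall>a. a \<epsilon> x \<longrightarrow> (\<exists>!b. maps_to f a b))"

definition is_surjection :: "'a \<Rightarrow> 'a \<Rightarrow> 'a \<Rightarrow> bool" where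
  "is_surjection f x y \<longleftrightarrow>
     is_function f x y \<and> (\<forall>b. b \<epsilon> y \<longrightarrow> (\<exists>a. a \<epsilon> x \<and> maps_to f a b))"

definition is_injection :: "'a \<Rightarrow> 'a \<Rightarrow> 'a \<Rightarrow> bool" where
  "is_injection f x y \<longleftrightarrow>
     is_function f x y \<and> (\<forall>a a' b. maps_to f a b \<and> maps_to f a' b \<longrightarrow> a = a')"

definition finite_set :: "'a \<Rightarrow> bool" where
  "finite_set x \<longleftrightarrow>
     (\<exists>w n f. is_omega w \<and> n \<epsilon> w \<and> is_injection f n x \<and> is_surjection f n x)"

definition infinite_set :: "'a \<Rightarrow> bool" where
  "infinite_set x \<longleftrightarrow> \<not> finite_set x"

definition is_infinite_powerset :: "'a \<Rightarrow> 'a \<Rightarrow> bool" where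
  "is_infinite_powerset m q \<longleftrightarrow> (\<forall>x. x \<epsilon> q \<longleftrightarrow> subset_of x m \<and> infinite_set x)"

end

text \<open>
  In the two schemata the formula's variables \<open>0\<close> (and \<open>1\<close>) are the displayed arguments; all other
  variables are parameters, whose values are given by the assignment \<open>e\<close>.
\<close>

locale ZF_model = set_structure mem
  for mem :: "'a \<Rightarrow> 'a \<Rightarrow> bool"  (infix "\<epsilon>" 50) +
  assumes extensionality: "\<And>x y. (\<forall>z. z \<epsilon> x \<longleftrightarrow> z \<epsilon> y) \<Longrightarrow> x = y"
    and foundation: "\<And>x. (\<exists>y. y \<epsilon> x) \<Longrightarrow> \<exists>y. y \<epsilon> x \<and> (\<forall>z. \<not> (z \<epsilon> x \<and> z \<epsilon> y))"
    and pairing: "\<And>x y. \<exists>u. is_upair x y u"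
    and union: "\<And>x. \<exists>u. \<forall>z. z \<epsilon> u \<longleftrightarrow> (\<exists>y. y \<epsilon> x \<and> z \<epsilon> y)"
    and powerset: "\<And>x. \<exists>u. \<forall>z. z \<epsilon> u \<longleftrightarrow> subset_of z x"
    and infinity: "\<exists>w. is_inductive w"
    and separation: "\<And>\<phi> e x. \<exists>u. \<forall>z. z \<epsilon> u \<longleftrightarrow> z \<epsilon> x \<and> sat mem (e(0 := z)) \<phi>"
    and replacement: "\<And>\<phi> e x.
      (\<forall>a b c. a \<epsilon> x \<and> sat mem (e(0 := a, 1 := b)) \<phi> \<and> sat mem (e(0 := a, 1 := c)) \<phi> \<longrightarrow> b = c)
      \<Longrightarrow> \<exists>u. \<forall>b. b \<epsilon> u \<longleftrightarrow> (\<exists>a. a \<epsilon> x \<and> sat mem (e(0 := a, 1 := b)) \<phi>)"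

end

theory Submission
  imports Defs
begin

text \<open>
  Suppose \<open>F\<close> maps \<open>\<omega> \<times> M\<close> onto the infinite subsets of \<open>M\<close>. By transfinite recursion one defines an
  injection of all ordinals into the power set of \<open>M\<close>, which contradicts Replacement. What is needed
  is a definable way of passing from an injection \<open>g\<close> of an infinite ordinal \<open>a\<close> into the infinite
  subsets of \<open>M\<close> to an infinite subset outside the range of \<open>g\<close>; Cantor's diagonal set does this once
  a definable map of \<open>M\<close> onto two disjoint copies of \<open>a\<close> is available.

  To begin with, \<open>M\<close> can be mapped onto \<open>\<omega>\<close>: otherwise, for each \<open>x\<close> the finite complements among the
  sets \<open>M - F n x\<close> have a finite union, the sizes of these unions are bounded, and yet every finite
  subset of \<open>M\<close> lies in one of them. Now let \<open>k\<close> be the cardinal of \<open>a\<close>. Through \<open>g\<close>, \<open>F\<close> gives maps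
  \<open>p\<^sub>n\<close> from \<open>M\<close> to \<open>k\<close> whose ranges cover \<open>k\<close>. If no range has order type \<open>k\<close>, call \<open>X \<subseteq> M\<close> big when the
  order types of the sets \<open>p\<^sub>n[X]\<close> are unbounded in \<open>k\<close>, and follow the least big fibres of
  \<open>p\<^sub>0, p\<^sub>1, \<dots>\<close>. Either this chain gets stuck and the fibres at that level have unbounded extents, or the
  pieces split off along the chain do. In both cases a disjoint family of pieces yields a definable
  map of \<open>M\<close> onto \<open>k\<close>. With \<open>k \<times> k \<approx> k\<close>, subsets of \<open>M\<close> can then code an enumeration of \<open>a\<close> of length
  \<open>k\<close> along with an \<open>\<omega>\<close>-sequence in \<open>k\<close>, and a Koenig-type diagonalization against \<open>F\<close> shows that some
  \<open>F n\<close> decodes to the required map on \<open>M\<close>.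
\<close>

subsection \<open>Definable predicates and terms\<close>

lemma nat_mod2_cases:
  fixes n :: nat
  obtains i where "n = 2 * i" | i where "n = Suc (2 * i)"
  by (metis evenE oddE Suc_eq_plus1)

primrec rename_fm :: "(nat \<Rightarrow> nat) \<Rightarrow> fm \<Rightarrow> fm" where
  "rename_fm r (Mem i j) = Mem (r i) (r j)"
| "rename_fm r (Eq i j) = Eq (r i) (r j)"
| "rename_fm r (Neg p) = Neg (rename_fm r p)"
| "rename_fm r (Conj p q) = Conj (rename_fm r p) (rename_fm r q)"
| "rename_fm r (All i p) = All (r i) (rename_fm r p)"

text \<open>Bound variables are renamed as well; injectivity of \<open>r\<close> keeps an update at
  \<open>r i\<close> from disturbing the values of the other variables.\<close>

lemma sat_rename_fm:
  assumes "inj r"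
  shows "sat mem e (rename_fm r p) \<longleftrightarrow> sat mem (\<lambda>n. e (r n)) p"
proof (induction p arbitrary: e)
  case (All i p)
  have "(\<lambda>n. (e(r i := a)) (r n)) = (\<lambda>n. e (r n))(i := a)" for a
    using assms by (auto simp: fun_eq_iff inj_eq)
  then show ?case by (simp add: All)
qed auto

text \<open>
  Variables are kept at even and parameters at odd indices.
\<close>

definition interleave :: "(nat \<Rightarrow> 'b) \<Rightarrow> (nat \<Rightarrow> 'b) \<Rightarrow> nat \<Rightarrow> 'b" where
  "interleave e c n = (if even n then e (n div 2) else c (n div 2))"

lemma interleave_simps [simp]:
  "interleave e c (2 * n) = e n" "interleave e c (Suc (2 * n)) = c n"
  "interleave e c 0 = e 0" "interleave e c (Suc 0) = c 0" "interleave e c 3 = c 1"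
  by (simp_all add: interleave_def)

lemma interleave_upd0 [simp]: "(interleave e c)(0 := z) = interleave (e(0 := z)) c"
proof
  fix n show "((interleave e c)(0 := z)) n = interleave (e(0 := z)) c n"
    by (cases n rule: nat_mod2_cases) auto
qed

lemma inj_interleave:
  assumes "inj f" "inj g" "\<And>m n. f m \<noteq> g n"
  shows "inj (interleave f g)"
proof (rule injI)
  fix m n assume "interleave f g m = interleave f g n"
  then show "m = n"
    using assms assms(3)[symmetric]
    by (cases m rule: nat_mod2_cases; cases n rule: nat_mod2_cases) (simp_all add: inj_eq)
qed

context set_structure
begin

primrec val :: "nat + 'a \<Rightarrow> (nat \<Rightarrow> 'a) \<Rightarrow> 'a" where
  "val (Inl i) e = e i"
| "val (Inr c) e = c"

text \<open>
  Formulas with parameters, up to logical equivalence: \<open>P\<close> is the set of assignments satisfying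
  the formula, and a quantifier binds index \<open>0\<close> while shifting the other variables.
\<close>

inductive dfn :: "((nat \<Rightarrow> 'a) \<Rightarrow> bool) \<Rightarrow> bool" where
  dfn_mem_val: "dfn (\<lambda>e. val s e \<epsilon> val t e)"
| dfn_eq_val: "dfn (\<lambda>e. val s e = val t e)"
| dfn_neg: "dfn P \<Longrightarrow> dfn (\<lambda>e. \<not> P e)"
| dfn_conj: "dfn P \<Longrightarrow> dfn Q \<Longrightarrow> dfn (\<lambda>e. P e \<and> Q e)"
| dfn_all_case: "dfn P \<Longrightarrow> dfn (\<lambda>e. \<forall>a. P (case_nat a e))"

text \<open>Quantifiers bind index \<open>0\<close> and shift the rest, so \<open>r\<close> can be
  arbitrary here: under a quantifier it is lifted to a map that fixes \<open>0\<close>.\<close>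

lemma dfn_rename: "dfn P \<Longrightarrow> dfn (\<lambda>e. P (\<lambda>n. e (r n)))"
proof (induction arbitrary: r rule: dfn.induct)
  case (dfn_mem_val s t)
  have "val s (\<lambda>n. e (r n)) = val (map_sum r id s) e" for s e by (cases s) auto
  then show ?case by (simp add: dfn.dfn_mem_val)
next
  case (dfn_eq_val s t)
  have "val s (\<lambda>n. e (r n)) = val (map_sum r id s) e" for s e by (cases s) auto
  then show ?case by (simp add: dfn.dfn_eq_val)
next
  case (dfn_all_case P)
  have "case_nat a (\<lambda>n. e (r n)) = (\<lambda>n. (case_nat a e) (case_nat 0 (\<lambda>n. Suc (r n)) n))" for a and e :: "nat \<Rightarrow> 'a"
    by (auto simp: fun_eq_iff split: nat.split)
  then show ?case
    using dfn.dfn_all_case[OF dfn_all_case.IH[of "case_nat 0 (\<lambda>n. Suc (r n))"]] by simp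
qed (auto intro: dfn.intros)

text \<open>The link back to the formulas of the two schemata. The parameters occurring in
  \<open>P\<close> are gathered in the assignment \<open>c\<close>.\<close>

lemma dfn_formula: "dfn P \<Longrightarrow> \<exists>\<phi> c. \<forall>e. sat mem (interleave e c) \<phi> \<longleftrightarrow> P e"
proof (induction rule: dfn.induct)
  case (dfn_mem_val s t)
  let ?c = "case_nat (case s of Inl i \<Rightarrow> undefined | Inr a \<Rightarrow> a) (\<lambda>_. case t of Inl i \<Rightarrow> undefined | Inr a \<Rightarrow> a)"
  let ?i = "case s of Inl i \<Rightarrow> 2 * i | Inr a \<Rightarrow> Suc (2 * 0)"
  let ?j = "case t of Inl i \<Rightarrow> 2 * i | Inr a \<Rightarrow> Suc (2 * 1)"
  have "interleave e ?c ?i = val s e" "interleave e ?c ?j = val t e" for e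
    by (simp_all split: sum.split)
  then have "sat mem (interleave e ?c) (Mem ?i ?j) \<longleftrightarrow> val s e \<epsilon> val t e" for e by simp
  then show ?case by blast
next
  case (dfn_eq_val s t)
  let ?c = "case_nat (case s of Inl i \<Rightarrow> undefined | Inr a \<Rightarrow> a) (\<lambda>_. case t of Inl i \<Rightarrow> undefined | Inr a \<Rightarrow> a)"
  let ?i = "case s of Inl i \<Rightarrow> 2 * i | Inr a \<Rightarrow> Suc (2 * 0)"
  let ?j = "case t of Inl i \<Rightarrow> 2 * i | Inr a \<Rightarrow> Suc (2 * 1)"
  have "interleave e ?c ?i = val s e" "interleave e ?c ?j = val t e" for e
    by (simp_all split: sum.split)
  then have "sat mem (interleave e ?c) (Eq ?i ?j) \<longleftrightarrow> val s e = val t e" for e by simp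
  then show ?case by blast
next
  case (dfn_neg P)
  then obtain \<phi> c where "\<forall>e. sat mem (interleave e c) \<phi> \<longleftrightarrow> P e" by blast
  then have "\<forall>e. sat mem (interleave e c) (Neg \<phi>) \<longleftrightarrow> \<not> P e" by simp
  then show ?case by blast
next
  case (dfn_conj P Q)
  then obtain \<phi> c \<psi> d where 1: "\<And>e. sat mem (interleave e c) \<phi> \<longleftrightarrow> P e"
    and 2: "\<And>e. sat mem (interleave e d) \<psi> \<longleftrightarrow> Q e" by blast
  \<comment> \<open>The two formulas share their variables but not their parameters: slot
    \<open>n\<close> of \<open>c\<close> moves to slot \<open>2 * n\<close> of
    \<open>interleave c d\<close>, slot \<open>n\<close> of \<open>d\<close> to slot
    \<open>Suc (2 * n)\<close>.\<close>
  let ?r = "interleave (\<lambda>n. 2 * n) (\<lambda>n. Suc (2 * (2 * n)))"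
  let ?s = "interleave (\<lambda>n. 2 * n) (\<lambda>n. Suc (2 * Suc (2 * n)))"
  have inj: "inj ?r" "inj ?s"
    by (rule inj_interleave; simp add: inj_on_def; presburger)+
  have "(\<lambda>n. interleave e (interleave c d) (?r n)) = interleave e c"
    "(\<lambda>n. interleave e (interleave c d) (?s n)) = interleave e d" for e
  proof -
    show "(\<lambda>n. interleave e (interleave c d) (?r n)) = interleave e c"
    proof
      fix n show "interleave e (interleave c d) (?r n) = interleave e c n"
        by (cases n rule: nat_mod2_cases) (simp_all add: interleave_def)
    qed
    show "(\<lambda>n. interleave e (interleave c d) (?s n)) = interleave e d"
    proof
      fix n show "interleave e (interleave c d) (?s n) = interleave e d n"
        by (cases n rule: nat_mod2_cases) (simp_all add: interleave_def)
    qed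
  qed
  then have "sat mem (interleave e (interleave c d)) (Conj (rename_fm ?r \<phi>) (rename_fm ?s \<psi>)) \<longleftrightarrow> P e \<and> Q e" for e
    by (simp only: sat.simps sat_rename_fm[OF inj(1)] sat_rename_fm[OF inj(2)] 1 2)
  then show ?case by blast
next
  case (dfn_all_case P)
  then obtain \<phi> c where 1: "\<And>e. sat mem (interleave e c) \<phi> \<longleftrightarrow> P e" by blast
  \<comment> \<open>Parameters move up by one slot. This frees index \<open>Suc 0\<close> for the
    bound variable, so the quantifier overwrites \<open>undefined\<close>.\<close>
  let ?c = "case_nat undefined c"
  let ?r = "interleave (case_nat (Suc 0) (\<lambda>n. 2 * n)) (\<lambda>n. Suc (2 * Suc n))"
  have inj: "inj ?r"
  proof (rule inj_interleave)
    show "case_nat (Suc 0) (\<lambda>n. 2 * n) m \<noteq> Suc (2 * Suc n)" for m n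
      by (cases m) (simp, simp, presburger)
  qed (auto simp: inj_def split: nat.splits)
  have "(\<lambda>n. ((interleave e ?c)(Suc 0 := a)) (?r n)) = interleave (case_nat a e) c" for a e
  proof
    fix n
    show "((interleave e ?c)(Suc 0 := a)) (?r n) = interleave (case_nat a e) c n"
      by (cases n rule: nat_mod2_cases) (auto simp: interleave_def split: nat.splits)
  qed
  then have "sat mem (interleave e ?c) (All (Suc 0) (rename_fm ?r \<phi>)) \<longleftrightarrow> (\<forall>a. P (case_nat a e))" for e
    by (simp only: sat.simps sat_rename_fm[OF inj] 1)
  then show ?case by blast
qed

definition tdfn :: "((nat \<Rightarrow> 'a) \<Rightarrow> 'a) \<Rightarrow> bool" where
  "tdfn t \<longleftrightarrow> dfn (\<lambda>e. e 0 = t (\<lambda>n. e (Suc n)))"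

text \<open>Definability is proved by \<open>intro dfn\<close>, following the shape of an
  expression. Each notion introduced later adds a rule in which its arguments are arbitrary
  definable terms.\<close>

named_theorems dfn

lemma dfn_bool [dfn]: "dfn (\<lambda>e. b)"
  using dfn_eq_val[of "Inr c" "Inr c" for c] dfn_neg[OF dfn_eq_val[of "Inr c" "Inr c" for c]]
  by (cases b) auto

lemmas [dfn] = dfn_neg dfn_conj

lemma dfn_disj [dfn]: "dfn P \<Longrightarrow> dfn Q \<Longrightarrow> dfn (\<lambda>e. P e \<or> Q e)"
  using dfn_neg[OF dfn_conj[OF dfn_neg dfn_neg], of P Q] by simp

lemma dfn_imp [dfn]: "dfn P \<Longrightarrow> dfn Q \<Longrightarrow> dfn (\<lambda>e. P e \<longrightarrow> Q e)"
  unfolding imp_conv_disj by (intro dfn)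

lemma dfn_iff [dfn]: "dfn P \<Longrightarrow> dfn Q \<Longrightarrow> dfn (\<lambda>e. P e \<longleftrightarrow> Q e)"
  unfolding iff_conv_conj_imp by (intro dfn)

lemma dfn_all [dfn]: "dfn (\<lambda>e. Q (\<lambda>n. e (Suc n)) (e 0)) \<Longrightarrow> dfn (\<lambda>e. \<forall>a. Q e a)"
  by (drule dfn_all_case) simp

lemma dfn_ex [dfn]: "dfn (\<lambda>e. Q (\<lambda>n. e (Suc n)) (e 0)) \<Longrightarrow> dfn (\<lambda>e. \<exists>a. Q e a)"
  using dfn_neg[OF dfn_all[of "\<lambda>e a. \<not> Q e a"]] dfn_neg by simp

lemma tdfn_var [dfn]: "tdfn (\<lambda>e. e i)"
  unfolding tdfn_def using dfn_eq_val[of "Inl 0" "Inl (Suc i)"] by simp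

lemma tdfn_const [dfn]: "tdfn (\<lambda>e. c)"
  unfolding tdfn_def using dfn_eq_val[of "Inl 0" "Inr c"] by simp

lemma tdfn_rename: "tdfn t \<Longrightarrow> tdfn (\<lambda>e. t (\<lambda>n. e (r n)))"
  unfolding tdfn_def
  using dfn_rename[of "\<lambda>e. e 0 = t (\<lambda>n. e (Suc n))" "case_nat 0 (\<lambda>n. Suc (r n))"] by simp

text \<open>A term is eliminated by naming its value with an existential quantifier, so
  \<open>Q\<close> has to be definable only with a variable in its place.\<close>

lemma dfn_let:
  assumes "tdfn t" "dfn (\<lambda>e. Q (\<lambda>n. e (Suc n)) (e 0))"
  shows "dfn (\<lambda>e. Q e (t e))"
proof -
  have "dfn (\<lambda>e. \<exists>a. a = t e \<and> Q e a)"
    using assms unfolding tdfn_def by (intro dfn)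
  then show ?thesis by simp
qed

lemma dfn_mem [dfn]: assumes "tdfn s" "tdfn t" shows "dfn (\<lambda>e. s e \<epsilon> t e)"
proof (rule dfn_let[OF assms(1)], rule dfn_let[OF tdfn_rename[OF assms(2)]])
  show "dfn (\<lambda>e. e (Suc 0) \<epsilon> e 0)" using dfn_mem_val[of "Inl (Suc 0)" "Inl 0"] by simp
qed

lemma dfn_eq [dfn]: assumes "tdfn s" "tdfn t" shows "dfn (\<lambda>e. s e = t e)"
proof (rule dfn_let[OF assms(1)], rule dfn_let[OF tdfn_rename[OF assms(2)]])
  show "dfn (\<lambda>e. e (Suc 0) = e 0)" using dfn_eq_val[of "Inl (Suc 0)" "Inl 0"] by simp
qed

lemma dfn_subst: "dfn P \<Longrightarrow> (\<And>n. tdfn (t n)) \<Longrightarrow> dfn (\<lambda>e. P (\<lambda>n. t n e))"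
proof (induction arbitrary: t rule: dfn.induct)
  case (dfn_mem_val u v)
  have "tdfn (\<lambda>e. val u (\<lambda>n. t n e))" for u using dfn_mem_val by (cases u) (auto intro: dfn)
  then show ?case by (intro dfn)
next
  case (dfn_eq_val u v)
  have "tdfn (\<lambda>e. val u (\<lambda>n. t n e))" for u using dfn_eq_val by (cases u) (auto intro: dfn)
  then show ?case by (intro dfn)
next
  case (dfn_all_case P)
  define t' where "t' = case_nat (\<lambda>e. e 0) (\<lambda>n e. t n (\<lambda>k. e (Suc k)))"
  have "tdfn (t' n)" for n
    using tdfn_rename[OF dfn_all_case.prems] by (auto simp: t'_def intro: dfn split: nat.split)
  from dfn_all_case.IH[OF this] have 1: "dfn (\<lambda>e. P (\<lambda>n. t' n e))" .
  have 2: "(\<lambda>n. t' n e) = case_nat (e 0) (\<lambda>n. t n (\<lambda>k. e (Suc k)))" for e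
    by (auto simp: t'_def split: nat.split)
  show ?case using 1 by (intro dfn) (simp add: 2)
qed (auto intro: dfn)

lemma tdfn_subst:
  assumes "tdfn s" "\<And>n. tdfn (t n)"
  shows "tdfn (\<lambda>e. s (\<lambda>n. t n e))"
proof -
  let ?t = "case_nat (\<lambda>e. e 0) (\<lambda>n e. t n (\<lambda>k. e (Suc k)))"
  have "tdfn (?t n)" for n
    using tdfn_rename[OF assms(2)] by (auto intro: dfn split: nat.split)
  then have "dfn (\<lambda>e. ?t 0 e = s (\<lambda>n. ?t (Suc n) e))"
    using assms(1) unfolding tdfn_def[of s] by (rule dfn_subst[rotated])
  then show ?thesis by (simp add: tdfn_def)
qed

text \<open>Indices beyond the list are filled with a variable. The fixed-arity instances below turn
  definability at variables into closure rules for arbitrary arguments.\<close>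

lemma dfn_subst_list:
  "dfn P \<Longrightarrow> \<forall>t\<in>set ts. tdfn t \<Longrightarrow> dfn (\<lambda>e. P (\<lambda>n. (if n < length ts then ts ! n else (\<lambda>e. e 0)) e))"
  by (rule dfn_subst) (auto intro: dfn)

lemma tdfn_subst_list:
  "tdfn s \<Longrightarrow> \<forall>t\<in>set ts. tdfn t \<Longrightarrow> tdfn (\<lambda>e. s (\<lambda>n. (if n < length ts then ts ! n else (\<lambda>e. e 0)) e))"
  by (rule tdfn_subst) (auto intro: dfn)

lemma dfn_subst1:
  "dfn (\<lambda>e. P (e 0)) \<Longrightarrow>
   tdfn t0 \<Longrightarrow>
   dfn (\<lambda>e. P (t0 e))"
  using dfn_subst_list[of "\<lambda>e. P (e 0)" "[t0]"] by simp

lemma dfn_subst2: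
  "dfn (\<lambda>e. P (e 0) (e (Suc 0))) \<Longrightarrow>
   tdfn t0 \<Longrightarrow> tdfn t1 \<Longrightarrow>
   dfn (\<lambda>e. P (t0 e) (t1 e))"
  using dfn_subst_list[of "\<lambda>e. P (e 0) (e (Suc 0))" "[t0, t1]"] by simp

lemma dfn_subst3:
  "dfn (\<lambda>e. P (e 0) (e (Suc 0)) (e (Suc (Suc 0)))) \<Longrightarrow>
   tdfn t0 \<Longrightarrow> tdfn t1 \<Longrightarrow> tdfn t2 \<Longrightarrow>
   dfn (\<lambda>e. P (t0 e) (t1 e) (t2 e))"
  using dfn_subst_list[of "\<lambda>e. P (e 0) (e (Suc 0)) (e (Suc (Suc 0)))" "[t0, t1, t2]"] by simp

lemma dfn_subst4:
  "dfn (\<lambda>e. P (e 0) (e (Suc 0)) (e (Suc (Suc 0))) (e (Suc (Suc (Suc 0))))) \<Longrightarrow>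
   tdfn t0 \<Longrightarrow> tdfn t1 \<Longrightarrow> tdfn t2 \<Longrightarrow> tdfn t3 \<Longrightarrow>
   dfn (\<lambda>e. P (t0 e) (t1 e) (t2 e) (t3 e))"
  using dfn_subst_list[of "\<lambda>e. P (e 0) (e (Suc 0)) (e (Suc (Suc 0))) (e (Suc (Suc (Suc 0))))" "[t0, t1, t2, t3]"] by simp

lemma dfn_subst5:
  "dfn (\<lambda>e. P (e 0) (e (Suc 0)) (e (Suc (Suc 0))) (e (Suc (Suc (Suc 0)))) (e (Suc (Suc (Suc (Suc 0)))))) \<Longrightarrow>
   tdfn t0 \<Longrightarrow> tdfn t1 \<Longrightarrow> tdfn t2 \<Longrightarrow> tdfn t3 \<Longrightarrow> tdfn t4 \<Longrightarrow>
   dfn (\<lambda>e. P (t0 e) (t1 e) (t2 e) (t3 e) (t4 e))"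
  using dfn_subst_list[of "\<lambda>e. P (e 0) (e (Suc 0)) (e (Suc (Suc 0))) (e (Suc (Suc (Suc 0)))) (e (Suc (Suc (Suc (Suc 0)))))" "[t0, t1, t2, t3, t4]"] by simp

lemma dfn_subst6:
  "dfn (\<lambda>e. P (e 0) (e (Suc 0)) (e (Suc (Suc 0))) (e (Suc (Suc (Suc 0)))) (e (Suc (Suc (Suc (Suc 0))))) (e (Suc (Suc (Suc (Suc (Suc 0))))))) \<Longrightarrow>
   tdfn t0 \<Longrightarrow> tdfn t1 \<Longrightarrow> tdfn t2 \<Longrightarrow> tdfn t3 \<Longrightarrow> tdfn t4 \<Longrightarrow> tdfn t5 \<Longrightarrow>
   dfn (\<lambda>e. P (t0 e) (t1 e) (t2 e) (t3 e) (t4 e) (t5 e))"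
  using dfn_subst_list[of "\<lambda>e. P (e 0) (e (Suc 0)) (e (Suc (Suc 0))) (e (Suc (Suc (Suc 0)))) (e (Suc (Suc (Suc (Suc 0))))) (e (Suc (Suc (Suc (Suc (Suc 0))))))" "[t0, t1, t2, t3, t4, t5]"] by simp

lemma tdfn_subst1:
  "tdfn (\<lambda>e. F (e 0)) \<Longrightarrow>
   tdfn t0 \<Longrightarrow>
   tdfn (\<lambda>e. F (t0 e))"
  using tdfn_subst_list[of "\<lambda>e. F (e 0)" "[t0]"] by simp

lemma tdfn_subst2:
  "tdfn (\<lambda>e. F (e 0) (e (Suc 0))) \<Longrightarrow>
   tdfn t0 \<Longrightarrow> tdfn t1 \<Longrightarrow>
   tdfn (\<lambda>e. F (t0 e) (t1 e))"
  using tdfn_subst_list[of "\<lambda>e. F (e 0) (e (Suc 0))" "[t0, t1]"] by simp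

lemma tdfn_subst3:
  "tdfn (\<lambda>e. F (e 0) (e (Suc 0)) (e (Suc (Suc 0)))) \<Longrightarrow>
   tdfn t0 \<Longrightarrow> tdfn t1 \<Longrightarrow> tdfn t2 \<Longrightarrow>
   tdfn (\<lambda>e. F (t0 e) (t1 e) (t2 e))"
  using tdfn_subst_list[of "\<lambda>e. F (e 0) (e (Suc 0)) (e (Suc (Suc 0)))" "[t0, t1, t2]"] by simp

lemma tdfn_subst4:
  "tdfn (\<lambda>e. F (e 0) (e (Suc 0)) (e (Suc (Suc 0))) (e (Suc (Suc (Suc 0))))) \<Longrightarrow>
   tdfn t0 \<Longrightarrow> tdfn t1 \<Longrightarrow> tdfn t2 \<Longrightarrow> tdfn t3 \<Longrightarrow>
   tdfn (\<lambda>e. F (t0 e) (t1 e) (t2 e) (t3 e))"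
  using tdfn_subst_list[of "\<lambda>e. F (e 0) (e (Suc 0)) (e (Suc (Suc 0))) (e (Suc (Suc (Suc 0))))" "[t0, t1, t2, t3]"] by simp

lemma tdfn_subst5:
  "tdfn (\<lambda>e. F (e 0) (e (Suc 0)) (e (Suc (Suc 0))) (e (Suc (Suc (Suc 0)))) (e (Suc (Suc (Suc (Suc 0)))))) \<Longrightarrow>
   tdfn t0 \<Longrightarrow> tdfn t1 \<Longrightarrow> tdfn t2 \<Longrightarrow> tdfn t3 \<Longrightarrow> tdfn t4 \<Longrightarrow>
   tdfn (\<lambda>e. F (t0 e) (t1 e) (t2 e) (t3 e) (t4 e))"
  using tdfn_subst_list[of "\<lambda>e. F (e 0) (e (Suc 0)) (e (Suc (Suc 0))) (e (Suc (Suc (Suc 0)))) (e (Suc (Suc (Suc (Suc 0)))))" "[t0, t1, t2, t3, t4]"] by simp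

lemma tdfn_if [dfn]:
  assumes "dfn P" "tdfn s" "tdfn t"
  shows "tdfn (\<lambda>e. if P e then s e else t e)"
proof -
  have "dfn (\<lambda>e. P (\<lambda>n. e (Suc n)) \<and> e 0 = s (\<lambda>n. e (Suc n)) \<or> \<not> P (\<lambda>n. e (Suc n)) \<and> e 0 = t (\<lambda>n. e (Suc n)))"
    by (intro dfn dfn_rename[OF assms(1), of Suc] tdfn_rename[OF assms(2), of Suc] tdfn_rename[OF assms(3), of Suc])
  then show ?thesis unfolding tdfn_def by (rule back_subst[of dfn]) auto
qed

end

section \<open>Separation and Replacement for definable predicates\<close>

context ZF_model
begin

lemma sep_exists:
  assumes "dfn (\<lambda>e. P (e 0))"
  shows "\<exists>u. \<forall>z. z \<epsilon> u \<longleftrightarrow> z \<epsilon> x \<and> P z"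
proof -
  obtain \<phi> c where 1: "\<And>e. sat mem (interleave e c) \<phi> \<longleftrightarrow> P (e 0)"
    using dfn_formula[OF assms] by blast
  show ?thesis using separation[of x "interleave undefined c" \<phi>] by (simp add: 1)
qed

lemma repl_exists:
  assumes "dfn (\<lambda>e. R (e 0) (e (Suc 0)))"
    and fn: "\<And>a b c. a \<epsilon> x \<Longrightarrow> R a b \<Longrightarrow> R a c \<Longrightarrow> b = c"
  shows "\<exists>u. \<forall>b. b \<epsilon> u \<longleftrightarrow> (\<exists>a. a \<epsilon> x \<and> R a b)"
proof -
  obtain \<phi> c where 1: "\<And>e. sat mem (interleave e c) \<phi> \<longleftrightarrow> R (e 0) (e (Suc 0))"
    using dfn_formula[OF assms(1)] by blast
  \<comment> \<open>The second argument of the Replacement schema is variable \<open>1\<close>, but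
    interleaving puts the second variable at index \<open>2\<close>; the transposition exchanges it
    with the parameter at \<open>1\<close>.\<close>
  let ?r = "(id :: nat \<Rightarrow> nat)(1 := 2, 2 := 1)"
  let ?e = "\<lambda>n. interleave undefined c (?r n)"
  have inj: "inj ?r" by (auto simp: inj_def)
  have "(\<lambda>n. (?e(0 := a, 1 := b)) (?r n)) = interleave (undefined(0 := a, 1 := b)) c" for a b
  proof
    fix n show "(?e(0 := a, 1 := b)) (?r n) = interleave (undefined(0 := a, 1 := b)) c n"
      by (auto simp: interleave_def elim: evenE)
  qed
  then have 2: "sat mem (?e(0 := a, 1 := b)) (rename_fm ?r \<phi>) \<longleftrightarrow> R a b" for a b
    using 1 by (simp only: sat_rename_fm[OF inj]) simp
  have "\<exists>u. \<forall>b. b \<epsilon> u \<longleftrightarrow> (\<exists>a. a \<epsilon> x \<and> sat mem (?e(0 := a, 1 := b)) (rename_fm ?r \<phi>))"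
    by (rule replacement, unfold 2) (use fn in blast)
  then show ?thesis unfolding 2 .
qed

subsection \<open>Sets\<close>

abbreviation sub (infix "\<sqsubseteq>" 50) where "x \<sqsubseteq> y \<equiv> subset_of x y"

lemma subI: "(\<And>z. z \<epsilon> x \<Longrightarrow> z \<epsilon> y) \<Longrightarrow> x \<sqsubseteq> y"
  by (simp add: subset_of_def)

lemma subD: "x \<sqsubseteq> y \<Longrightarrow> z \<epsilon> x \<Longrightarrow> z \<epsilon> y"
  by (simp add: subset_of_def)

lemma sub_refl [simp]: "x \<sqsubseteq> x"
  by (simp add: subset_of_def)

lemma sub_trans: "x \<sqsubseteq> y \<Longrightarrow> y \<sqsubseteq> z \<Longrightarrow> x \<sqsubseteq> z"
  by (simp add: subset_of_def)

lemma set_eqI: "(\<And>z. z \<epsilon> x \<longleftrightarrow> z \<epsilon> y) \<Longrightarrow> x = y"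
  by (rule extensionality) simp

lemma sub_antisym: "x \<sqsubseteq> y \<Longrightarrow> y \<sqsubseteq> x \<Longrightarrow> x = y"
  by (rule set_eqI) (auto dest: subD)

lemma dfn_sub: "dfn (\<lambda>e. e 0 \<sqsubseteq> e (Suc 0))"
  unfolding subset_of_def by (intro dfn)

lemmas [dfn] = dfn_subst2[OF dfn_sub]

text \<open>The junk value for a proper class is the empty set, which keeps \<open>coll\<close> definable.\<close>

definition coll :: "('a \<Rightarrow> bool) \<Rightarrow> 'a" where
  "coll P = (if \<exists>u. \<forall>z. z \<epsilon> u \<longleftrightarrow> P z then (SOME u. \<forall>z. z \<epsilon> u \<longleftrightarrow> P z) else (SOME u. is_empty u))"

lemma ex_empty: "\<exists>u. is_empty u"
  using infinity unfolding is_inductive_def by blast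

text \<open>By extensionality both \<open>SOME\<close> expressions in \<open>coll\<close> denote
  unique sets. Hence the graph of \<open>coll\<close> has a first-order description, and HOL's
  choice operator does not leak into the definable terms.\<close>

lemma coll_eq_iff:
  "u = coll P \<longleftrightarrow> (\<forall>z. z \<epsilon> u \<longleftrightarrow> P z) \<or> \<not> (\<exists>u. \<forall>z. z \<epsilon> u \<longleftrightarrow> P z) \<and> is_empty u"
  (is "?l \<longleftrightarrow> ?a \<or> \<not> ?E \<and> ?b")
proof (cases ?E)
  case True
  then have 1: "\<forall>z. z \<epsilon> coll P \<longleftrightarrow> P z" unfolding coll_def if_P[OF True] by (rule someI_ex)
  have "?l" if "?a" using that 1 by (intro set_eqI) simp
  moreover have "?a" if "?l" unfolding that by (rule 1)
  ultimately show ?thesis using True by argo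
next
  case False
  have 1: "is_empty (coll P)" unfolding coll_def if_not_P[OF False] by (rule someI_ex[OF ex_empty])
  have "?l" if "?b" using that 1 by (intro set_eqI) (simp add: is_empty_def)
  moreover have "?b" if "?l" unfolding that by (rule 1)
  moreover have "\<not> ?a" using False by (rule contrapos_nn) (rule exI)
  ultimately show ?thesis using False by argo
qed

lemma mem_coll: assumes "\<exists>u. \<forall>z. z \<epsilon> u \<longleftrightarrow> P z" shows "z \<epsilon> coll P \<longleftrightarrow> P z"
proof -
  have "\<forall>z. z \<epsilon> coll P \<longleftrightarrow> P z"
    using coll_eq_iff[THEN iffD1, OF refl, of P] assms by (elim disjE) (assumption, elim conjE notE)
  then show ?thesis by (rule spec)
qed

lemma coll_eqI:
  assumes "\<forall>z. z \<epsilon> u \<longleftrightarrow> P z" shows "coll P = u"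
  by (rule set_eqI, subst mem_coll, rule exI, rule assms) (simp add: assms)

lemma mem_coll_sub:
  assumes "dfn (\<lambda>e. P (e 0))" "\<And>z. P z \<Longrightarrow> z \<epsilon> A"
  shows "z \<epsilon> coll P \<longleftrightarrow> P z"
  using sep_exists[OF assms(1), of A] assms(2) by (intro mem_coll) blast

lemma tdfn_coll [dfn]:
  assumes "dfn (\<lambda>e. Q (\<lambda>n. e (Suc n)) (e 0))"
  shows "tdfn (\<lambda>e. coll (\<lambda>z. Q e z))"
proof -
  have 1: "dfn (\<lambda>e. Q (\<lambda>n. e (Suc (Suc n))) (e 0))"
    using dfn_rename[OF assms, of "case_nat 0 (\<lambda>n. Suc (Suc n))"] by simp
  have 2: "dfn (\<lambda>e. Q (\<lambda>n. e (Suc (Suc (Suc n)))) (e 0))"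
    using dfn_rename[OF assms, of "case_nat 0 (\<lambda>n. Suc (Suc (Suc n)))"] by simp
  show ?thesis
    unfolding tdfn_def coll_eq_iff is_empty_def by (intro dfn 1 2)
qed

section \<open>Basic set operations as class terms\<close>

definition emp where "emp = coll (\<lambda>z. False)"
definition upair where "upair x y = coll (\<lambda>z. z = x \<or> z = y)"
definition opair where "opair x y = upair (upair x x) (upair x y)"
definition unions where "unions x = coll (\<lambda>z. \<exists>y. y \<epsilon> x \<and> z \<epsilon> y)"
definition cup where "cup x y = coll (\<lambda>z. z \<epsilon> x \<or> z \<epsilon> y)"
definition dif where "dif x y = coll (\<lambda>z. z \<epsilon> x \<and> \<not> z \<epsilon> y)"
definition cap where "cap x y = coll (\<lambda>z. z \<epsilon> x \<and> z \<epsilon> y)"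
definition pow where "pow x = coll (\<lambda>z. z \<sqsubseteq> x)"
definition cart where "cart x y = coll (\<lambda>z. \<exists>a b. a \<epsilon> x \<and> b \<epsilon> y \<and> z = opair a b)"
definition succ where "succ x = coll (\<lambda>z. z \<epsilon> x \<or> z = x)"
text \<open>Describing the value by its elements makes it empty unless exactly one object satisfies
  \<open>P\<close>; \<open>app\<close> inherits this default.\<close>

definition the1 where "the1 P = coll (\<lambda>z. \<exists>y. P y \<and> (\<forall>y'. P y' \<longrightarrow> y' = y) \<and> z \<epsilon> y)"
definition app where "app h x = the1 (\<lambda>y. opair x y \<epsilon> h)"
definition repl where "repl A F = coll (\<lambda>z. \<exists>x. x \<epsilon> A \<and> z = F x)"
definition lam where "lam A F = repl A (\<lambda>x. opair x (F x))"

lemma tdfn_upair: "tdfn (\<lambda>e. upair (e 0) (e (Suc 0)))" unfolding upair_def by (intro dfn)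
lemmas [dfn] = tdfn_subst2[OF tdfn_upair]
lemma tdfn_opair [dfn]: "tdfn s \<Longrightarrow> tdfn t \<Longrightarrow> tdfn (\<lambda>e. opair (s e) (t e))" unfolding opair_def by (intro dfn)
lemma tdfn_unions: "tdfn (\<lambda>e. unions (e 0))" unfolding unions_def by (intro dfn)
lemmas [dfn] = tdfn_subst1[OF tdfn_unions]
lemma tdfn_cup: "tdfn (\<lambda>e. cup (e 0) (e (Suc 0)))" unfolding cup_def by (intro dfn)
lemmas [dfn] = tdfn_subst2[OF tdfn_cup]
lemma tdfn_dif: "tdfn (\<lambda>e. dif (e 0) (e (Suc 0)))" unfolding dif_def by (intro dfn)
lemmas [dfn] = tdfn_subst2[OF tdfn_dif]
lemma tdfn_cap: "tdfn (\<lambda>e. cap (e 0) (e (Suc 0)))" unfolding cap_def by (intro dfn)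
lemmas [dfn] = tdfn_subst2[OF tdfn_cap]
lemma tdfn_pow: "tdfn (\<lambda>e. pow (e 0))" unfolding pow_def by (intro dfn)
lemmas [dfn] = tdfn_subst1[OF tdfn_pow]
lemma tdfn_cart: "tdfn (\<lambda>e. cart (e 0) (e (Suc 0)))" unfolding cart_def by (intro dfn)
lemmas [dfn] = tdfn_subst2[OF tdfn_cart]
lemma tdfn_succ: "tdfn (\<lambda>e. succ (e 0))" unfolding succ_def by (intro dfn)
lemmas [dfn] = tdfn_subst1[OF tdfn_succ]

lemma tdfn_the1 [dfn]:
  assumes "dfn (\<lambda>e. Q (\<lambda>n. e (Suc n)) (e 0))"
  shows "tdfn (\<lambda>e. the1 (\<lambda>z. Q e z))"
proof -
  have 1: "dfn (\<lambda>e. Q (\<lambda>n. e (Suc (Suc n))) (e 0))"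
    using dfn_rename[OF assms, of "case_nat 0 (\<lambda>n. Suc (Suc n))"] by simp
  have 2: "dfn (\<lambda>e. Q (\<lambda>n. e (Suc (Suc (Suc n)))) (e 0))"
    using dfn_rename[OF assms, of "case_nat 0 (\<lambda>n. Suc (Suc (Suc n)))"] by simp
  show ?thesis unfolding the1_def by (intro dfn 1 2)
qed

lemma tdfn_app: "tdfn (\<lambda>e. app (e 0) (e (Suc 0)))" unfolding app_def by (intro dfn)
lemmas [dfn] = tdfn_subst2[OF tdfn_app]

lemma tdfn_repl [dfn]:
  assumes A: "tdfn A" and F: "tdfn (\<lambda>e. F (\<lambda>n. e (Suc n)) (e 0))"
  shows "tdfn (\<lambda>e. repl (A e) (\<lambda>x. F e x))"
proof -
  have 1: "tdfn (\<lambda>e. A (\<lambda>n. e (Suc (Suc n))))"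
    using tdfn_rename[OF A, of "\<lambda>n. Suc (Suc n)"] by simp
  have 2: "tdfn (\<lambda>e. F (\<lambda>n. e (Suc (Suc n))) (e 0))"
    using tdfn_rename[OF F, of "case_nat 0 (\<lambda>n. Suc (Suc n))"] by simp
  show ?thesis unfolding repl_def by (intro dfn 1 2)
qed

lemma tdfn_lam [dfn]:
  assumes "tdfn A" and "tdfn (\<lambda>e. F (\<lambda>n. e (Suc n)) (e 0))"
  shows "tdfn (\<lambda>e. lam (A e) (\<lambda>x. F e x))"
  unfolding lam_def by (intro dfn assms)

lemma mem_emp [simp]: "\<not> z \<epsilon> emp"
  unfolding emp_def using ex_empty by (subst mem_coll) (auto simp: is_empty_def)

lemma mem_upair [simp]: "z \<epsilon> upair x y \<longleftrightarrow> z = x \<or> z = y"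
  unfolding upair_def using pairing by (intro mem_coll) (simp add: is_upair_def)

lemma mem_unions [simp]: "z \<epsilon> unions x \<longleftrightarrow> (\<exists>y. y \<epsilon> x \<and> z \<epsilon> y)"
  unfolding unions_def using union by (intro mem_coll)

lemma mem_cup [simp]: "z \<epsilon> cup x y \<longleftrightarrow> z \<epsilon> x \<or> z \<epsilon> y"
proof -
  have "\<forall>z. z \<epsilon> unions (upair x y) \<longleftrightarrow> z \<epsilon> x \<or> z \<epsilon> y" by auto
  then show ?thesis unfolding cup_def by (intro mem_coll) blast
qed

lemma mem_dif [simp]: "z \<epsilon> dif x y \<longleftrightarrow> z \<epsilon> x \<and> \<not> z \<epsilon> y"
  unfolding dif_def by (rule mem_coll_sub[of _ x]) (intro dfn, simp)

lemma mem_cap [simp]: "z \<epsilon> cap x y \<longleftrightarrow> z \<epsilon> x \<and> z \<epsilon> y"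
  unfolding cap_def by (rule mem_coll_sub[of _ x]) (intro dfn, simp)

lemma mem_pow [simp]: "z \<epsilon> pow x \<longleftrightarrow> z \<sqsubseteq> x"
  unfolding pow_def using powerset by (intro mem_coll)

lemma mem_succ [simp]: "z \<epsilon> succ x \<longleftrightarrow> z \<epsilon> x \<or> z = x"
proof -
  have "\<forall>z. z \<epsilon> cup x (upair x x) \<longleftrightarrow> z \<epsilon> x \<or> z = x" by auto
  then show ?thesis unfolding succ_def by (intro mem_coll) blast
qed

lemma upair_eq_iff: "upair x y = upair a b \<longleftrightarrow> x = a \<and> y = b \<or> x = b \<and> y = a"
proof
  assume "upair x y = upair a b"
  then have "\<forall>z. z = x \<or> z = y \<longleftrightarrow> z = a \<or> z = b" using mem_upair by metis
  then show "x = a \<and> y = b \<or> x = b \<and> y = a" by metis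
qed (auto intro: set_eqI)

lemma opair_eq_iff [simp]: "opair x y = opair a b \<longleftrightarrow> x = a \<and> y = b"
  unfolding opair_def upair_eq_iff by metis

lemma mem_cart: "z \<epsilon> cart x y \<longleftrightarrow> (\<exists>a b. a \<epsilon> x \<and> b \<epsilon> y \<and> z = opair a b)"
  unfolding cart_def
proof (rule mem_coll_sub[of _ "pow (pow (cup x y))"])
  fix z assume "\<exists>a b. a \<epsilon> x \<and> b \<epsilon> y \<and> z = opair a b"
  then show "z \<epsilon> pow (pow (cup x y))" by (auto simp: opair_def subset_of_def)
qed (intro dfn)

lemma opair_mem_cart [simp]: "opair a b \<epsilon> cart x y \<longleftrightarrow> a \<epsilon> x \<and> b \<epsilon> y"
  by (auto simp: mem_cart)

lemma the1_eqI:
  assumes "\<forall>z. z \<epsilon> u \<longleftrightarrow> (\<exists>y. P y \<and> (\<forall>y'. P y' \<longrightarrow> y' = y) \<and> z \<epsilon> y)"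
  shows "the1 P = u"
  unfolding the1_def by (rule coll_eqI[OF assms])

lemma the1_eq:
  assumes "P y" "\<And>y'. P y' \<Longrightarrow> y' = y"
  shows "the1 P = y"
  by (rule the1_eqI) (use assms in blast)

lemma the1_none:
  assumes "\<And>y. P y \<Longrightarrow> \<exists>y'. P y' \<and> y' \<noteq> y"
  shows "the1 P = emp"
  by (rule the1_eqI) (use assms mem_emp in metis)

lemma mem_repl:
  assumes F: "tdfn (\<lambda>e. F (e 0))"
  shows "z \<epsilon> repl A F \<longleftrightarrow> (\<exists>x. x \<epsilon> A \<and> z = F x)"
proof -
  have "tdfn (\<lambda>e. F (e (Suc 0)))" using tdfn_rename[OF F, of Suc] by simp
  then have "dfn (\<lambda>e. e 0 = F (e (Suc 0)))" by (intro dfn)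
  then have "dfn (\<lambda>e. e (Suc 0) = F (e 0))"
    using dfn_rename[of "\<lambda>e. e 0 = F (e (Suc 0))" "\<lambda>n. if n = 0 then Suc 0 else 0"] by simp
  from repl_exists[OF this, of A] show ?thesis
    unfolding repl_def by (intro mem_coll) blast
qed

lemma mem_lam:
  assumes F: "tdfn (\<lambda>e. F (e 0))"
  shows "z \<epsilon> lam A F \<longleftrightarrow> (\<exists>x. x \<epsilon> A \<and> z = opair x (F x))"
  unfolding lam_def by (rule mem_repl) (intro dfn F)

lemma app_lam:
  assumes F: "tdfn (\<lambda>e. F (e 0))" and "x \<epsilon> A"
  shows "app (lam A F) x = F x"
  unfolding app_def by (rule the1_eq) (use assms in \<open>auto simp: mem_lam\<close>)

lemma no_mem_self [simp]: "\<not> x \<epsilon> x"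
  using foundation[of "upair x x"] by auto

lemma no_mem_cycle: "x \<epsilon> y \<Longrightarrow> \<not> y \<epsilon> x"
  using foundation[of "upair x y"] by auto

subsection \<open>Ordinals\<close>

definition trans_set where "trans_set x \<longleftrightarrow> (\<forall>y. y \<epsilon> x \<longrightarrow> y \<sqsubseteq> x)"
text \<open>By Foundation, membership is well-founded, so transitive sets of transitive sets are the
  von Neumann ordinals.\<close>

definition ord where "ord x \<longleftrightarrow> trans_set x \<and> (\<forall>y. y \<epsilon> x \<longrightarrow> trans_set y)"

lemma dfn_ord: "dfn (\<lambda>e. ord (e 0))"
  unfolding ord_def trans_set_def by (intro dfn)
lemmas [dfn] = dfn_subst1[OF dfn_ord]

lemma ord_mem: "ord x \<Longrightarrow> y \<epsilon> x \<Longrightarrow> ord y"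
  unfolding ord_def trans_set_def subset_of_def by meson

lemma ord_trans: "ord x \<Longrightarrow> y \<epsilon> x \<Longrightarrow> z \<epsilon> y \<Longrightarrow> z \<epsilon> x"
  unfolding ord_def trans_set_def subset_of_def by meson

lemma ord_sub: "ord x \<Longrightarrow> y \<epsilon> x \<Longrightarrow> y \<sqsubseteq> x"
  by (simp add: ord_def trans_set_def)

lemma ord_emp [simp]: "ord emp"
  by (auto simp: ord_def trans_set_def)

lemma ordI: "(\<And>y. y \<epsilon> x \<Longrightarrow> ord y) \<Longrightarrow> (\<And>y z. y \<epsilon> x \<Longrightarrow> z \<epsilon> y \<Longrightarrow> z \<epsilon> x) \<Longrightarrow> ord x"
  unfolding ord_def trans_set_def subset_of_def by blast

lemma ord_succ [simp]: "ord x \<Longrightarrow> ord (succ x)"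
  by (rule ordI) (auto intro: ord_mem ord_trans)

text \<open>Foundation is applied to the part of \<open>x\<close> on which \<open>P\<close> holds;
  if that part is empty, \<open>x\<close> itself is minimal.\<close>

lemma ex_minimal:
  assumes P: "dfn (\<lambda>e. P (e 0))" and x: "ord x" "P x"
  shows "\<exists>y. ord y \<and> P y \<and> (\<forall>z. z \<epsilon> y \<longrightarrow> \<not> P z)"
proof (cases "\<exists>y. y \<epsilon> x \<and> P y")
  case True
  obtain u where u: "\<And>z. z \<epsilon> u \<longleftrightarrow> z \<epsilon> x \<and> P z" using sep_exists[OF P] by blast
  then obtain y where "y \<epsilon> u" "\<And>z. \<not> (z \<epsilon> u \<and> z \<epsilon> y)" using foundation[of u] True by blast
  then show ?thesis using u x(1) by (meson ord_mem ord_trans)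
qed (use x in blast)

lemma ord_induct:
  assumes P: "dfn (\<lambda>e. P (e 0))" and x: "ord x"
    and step: "\<And>y. ord y \<Longrightarrow> (\<And>z. z \<epsilon> y \<Longrightarrow> P z) \<Longrightarrow> P y"
  shows "P x"
proof (rule ccontr)
  assume "\<not> P x"
  then obtain y where "ord y" "\<not> P y" "\<forall>z. z \<epsilon> y \<longrightarrow> \<not> \<not> P z"
    using ex_minimal[OF dfn_neg[OF P] x] by blast
  then show False using step by blast
qed

text \<open>Double induction: if every element of \<open>x\<close> is comparable with
  \<open>y\<close> and every element of \<open>y\<close> with \<open>x\<close>, then incomparable
  \<open>x\<close> and \<open>y\<close> would have the same elements.\<close>

lemma ord_linear: assumes "ord x" "ord y" shows "x \<epsilon> y \<or> x = y \<or> y \<epsilon> x"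
proof -
  have "\<forall>y. ord y \<longrightarrow> x \<epsilon> y \<or> x = y \<or> y \<epsilon> x"
  proof (rule ord_induct[OF _ assms(1)])
    show "dfn (\<lambda>e. \<forall>y. ord y \<longrightarrow> e 0 \<epsilon> y \<or> e 0 = y \<or> y \<epsilon> e 0)" by (intro dfn)
    fix x assume x: "ord x" and IH: "\<And>z. z \<epsilon> x \<Longrightarrow> \<forall>y. ord y \<longrightarrow> z \<epsilon> y \<or> z = y \<or> y \<epsilon> z"
    show "\<forall>y. ord y \<longrightarrow> x \<epsilon> y \<or> x = y \<or> y \<epsilon> x"
    proof (intro allI impI)
      fix y assume "ord y"
      then show "x \<epsilon> y \<or> x = y \<or> y \<epsilon> x"
      proof (rule ord_induct[rotated])
        show "dfn (\<lambda>e. x \<epsilon> e 0 \<or> x = e 0 \<or> e 0 \<epsilon> x)" by (intro dfn)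
        fix y assume y: "ord y" and IH2: "\<And>z. z \<epsilon> y \<Longrightarrow> x \<epsilon> z \<or> x = z \<or> z \<epsilon> x"
        show "x \<epsilon> y \<or> x = y \<or> y \<epsilon> x"
        proof (rule ccontr)
          assume n: "\<not> ?thesis"
          have "z \<epsilon> y" if "z \<epsilon> x" for z using IH[OF that] y x n that by (metis ord_trans)
          moreover have "z \<epsilon> x" if "z \<epsilon> y" for z using IH2[OF that] y x n that by (metis ord_trans)
          ultimately show False using n set_eqI by blast
        qed
      qed
    qed
  qed
  then show ?thesis using assms(2) by blast
qed

lemma ord_sub_iff: assumes "ord x" "ord y" shows "x \<sqsubseteq> y \<longleftrightarrow> x \<epsilon> y \<or> x = y"
  using ord_linear[OF assms] ord_sub[OF assms(2)] by (metis subD no_mem_self sub_refl)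

lemma ord_not_mem: assumes "ord x" "ord y" shows "\<not> x \<epsilon> y \<longleftrightarrow> y \<sqsubseteq> x"
  using ord_linear[OF assms] ord_sub_iff[OF assms(2,1)] no_mem_cycle by (metis no_mem_self)

lemma ord_linear_sub: assumes "ord x" "ord y" shows "x \<sqsubseteq> y \<or> y \<sqsubseteq> x"
  by (metis assms ord_linear ord_sub sub_refl)

lemma ord_sub_mem: "ord x \<Longrightarrow> ord z \<Longrightarrow> x \<sqsubseteq> y \<Longrightarrow> y \<epsilon> z \<Longrightarrow> x \<epsilon> z"
  by (metis ord_sub_iff ord_mem ord_trans)

text \<open>Burali-Forti: otherwise the ordinals in \<open>X\<close> form an ordinal that belongs to
  itself.\<close>

lemma no_universal_ord: "\<exists>x. ord x \<and> \<not> x \<epsilon> X"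
proof (rule ccontr)
  assume n: "\<not> ?thesis"
  obtain u where u: "\<And>z. z \<epsilon> u \<longleftrightarrow> z \<epsilon> X \<and> ord z"
    using sep_exists[OF dfn_ord, of X] by blast
  have "ord u"
  proof (rule ordI)
    show "ord y" if "y \<epsilon> u" for y using u that by simp
    show "z \<epsilon> u" if "y \<epsilon> u" "z \<epsilon> y" for y z using u n that ord_mem[of y z] by simp
  qed
  then show False using u n no_mem_self by blast
qed

text \<open>The value is empty when no ordinal satisfies \<open>P\<close>.\<close>

definition least_ord where
  "least_ord P = coll (\<lambda>z. (\<exists>x. ord x \<and> P x) \<and> (\<forall>x. ord x \<and> P x \<longrightarrow> z \<epsilon> x))"

lemma tdfn_least_ord [dfn]:
  assumes "dfn (\<lambda>e. Q (\<lambda>n. e (Suc n)) (e 0))"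
  shows "tdfn (\<lambda>e. least_ord (\<lambda>z. Q e z))"
proof -
  have 1: "dfn (\<lambda>e. Q (\<lambda>n. e (Suc (Suc n))) (e 0))"
    using dfn_rename[OF assms, of "case_nat 0 (\<lambda>n. Suc (Suc n))"] by simp
  show ?thesis unfolding least_ord_def by (intro dfn 1)
qed

lemma least_ord_props:
  assumes P: "dfn (\<lambda>e. P (e 0))" and x: "ord x" "P x"
  shows "ord (least_ord P)" "P (least_ord P)" "\<And>y. ord y \<Longrightarrow> P y \<Longrightarrow> least_ord P \<sqsubseteq> y"
proof -
  obtain y where y: "ord y" "P y" "\<And>z. z \<epsilon> y \<Longrightarrow> \<not> P z" using ex_minimal[OF assms] by blast
  have le: "y \<sqsubseteq> z" if "ord z" "P z" for z using y that ord_not_mem by metis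
  have "\<forall>z. z \<epsilon> y \<longleftrightarrow> (\<exists>x. ord x \<and> P x) \<and> (\<forall>x. ord x \<and> P x \<longrightarrow> z \<epsilon> x)"
    using y le by (meson subD)
  then have "least_ord P = y" unfolding least_ord_def by (rule coll_eqI)
  then show "ord (least_ord P)" "P (least_ord P)" "\<And>y. ord y \<Longrightarrow> P y \<Longrightarrow> least_ord P \<sqsubseteq> y" using y le by auto
qed

lemma least_ord_not_mem:
  assumes "dfn (\<lambda>e. P (e 0))" "ord x" "P x" "y \<epsilon> least_ord P"
  shows "\<not> P y"
  using least_ord_props[OF assms(1-3)] assms(4) by (meson ord_mem subD no_mem_self)

definition omega where "omega = coll (\<lambda>z. \<forall>v. is_inductive v \<longrightarrow> z \<epsilon> v)"

lemma dfn_is_inductive: "dfn (\<lambda>e. is_inductive (e 0))"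
  unfolding is_inductive_def is_empty_def is_succ_def by (intro dfn)

lemmas [dfn] = dfn_subst1[OF dfn_is_inductive]

lemma mem_omega: "z \<epsilon> omega \<longleftrightarrow> (\<forall>v. is_inductive v \<longrightarrow> z \<epsilon> v)"
proof -
  obtain w where w: "is_inductive w" using infinity by blast
  show ?thesis unfolding omega_def by (rule mem_coll_sub[of _ w]) (intro dfn, use w in blast)
qed

lemma is_inductive_iff: "is_inductive w \<longleftrightarrow> emp \<epsilon> w \<and> (\<forall>x. x \<epsilon> w \<longrightarrow> succ x \<epsilon> w)"
proof -
  have "is_empty z \<longleftrightarrow> z = emp" for z
    by (auto simp: is_empty_def intro: set_eqI)
  moreover have "is_succ x y \<longleftrightarrow> y = succ x" for x y
    by (auto simp: is_succ_def intro: set_eqI)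
  ultimately show ?thesis by (simp add: is_inductive_def)
qed

lemma emp_omega [simp]: "emp \<epsilon> omega" by (auto simp: mem_omega is_inductive_iff)

lemma succ_omega [simp]: "x \<epsilon> omega \<Longrightarrow> succ x \<epsilon> omega" by (auto simp: mem_omega is_inductive_iff)

lemma is_omega_iff: "is_omega w \<longleftrightarrow> w = omega"
proof
  assume "w = omega"
  then show "is_omega w"
    by (auto simp: is_omega_def is_inductive_iff[of omega] subset_of_def) (auto simp: mem_omega)
next
  assume w: "is_omega w"
  moreover have "is_inductive omega" by (simp add: is_inductive_iff)
  ultimately show "w = omega"
    unfolding is_omega_def by (intro sub_antisym subI) (auto simp: mem_omega dest: subD)
qed

lemma omega_induct:
  assumes P: "dfn (\<lambda>e. P (e 0))" and n: "n \<epsilon> omega"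
    and "P emp" "\<And>n. n \<epsilon> omega \<Longrightarrow> P n \<Longrightarrow> P (succ n)"
  shows "P n"
proof -
  obtain u where u: "\<And>z. z \<epsilon> u \<longleftrightarrow> z \<epsilon> omega \<and> P z" using sep_exists[OF P] by blast
  then have "is_inductive u" using assms(3,4) by (simp add: is_inductive_iff)
  then show ?thesis using n u mem_omega by blast
qed

lemma omega_ord: assumes "n \<epsilon> omega" shows "ord n"
  by (rule omega_induct[OF _ assms]) (intro dfn, auto)

lemma omega_sub: assumes "n \<epsilon> omega" shows "n \<sqsubseteq> omega"
  by (rule omega_induct[OF _ assms]) (intro dfn, auto simp: subset_of_def)

lemma ord_omega [simp]: "ord omega"
  by (rule ordI) (auto intro: omega_ord dest: omega_sub subD)

subsection \<open>Recursion on the ordinals\<close>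

definition restriction where "restriction h x = coll (\<lambda>p. p \<epsilon> h \<and> (\<exists>y z. y \<epsilon> x \<and> p = opair y z))"

lemma tdfn_restriction: "tdfn (\<lambda>e. restriction (e 0) (e (Suc 0)))" unfolding restriction_def by (intro dfn)
lemmas [dfn] = tdfn_subst2[OF tdfn_restriction]

lemma mem_restriction: "p \<epsilon> restriction h x \<longleftrightarrow> p \<epsilon> h \<and> (\<exists>y z. y \<epsilon> x \<and> p = opair y z)"
  unfolding restriction_def by (rule mem_coll_sub[of _ h]) (intro dfn, simp)

text \<open>Approximations to the recursion: functions on \<open>a\<close> that obey the recursion
  equation. The parameters \<open>u\<close> and \<open>v\<close> are carried along so that the
  result is definable in them too.\<close>

definition attempt :: "('a \<Rightarrow> 'a \<Rightarrow> 'a \<Rightarrow> 'a \<Rightarrow> 'a) \<Rightarrow> 'a \<Rightarrow> 'a \<Rightarrow> 'a \<Rightarrow> 'a \<Rightarrow> bool" where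
  "attempt G u v a h \<longleftrightarrow> (\<forall>p. p \<epsilon> h \<longrightarrow> (\<exists>x y. x \<epsilon> a \<and> p = opair x y)) \<and>
     (\<forall>x. x \<epsilon> a \<longrightarrow> (\<exists>y. opair x y \<epsilon> h)) \<and> (\<forall>x y. opair x y \<epsilon> h \<longrightarrow> y = G u v x (restriction h x))"

definition ordrec :: "('a \<Rightarrow> 'a \<Rightarrow> 'a \<Rightarrow> 'a \<Rightarrow> 'a) \<Rightarrow> 'a \<Rightarrow> 'a \<Rightarrow> 'a \<Rightarrow> 'a" where
  "ordrec G u v a = G u v a (the1 (attempt G u v a))"

lemma dfn_attempt:
  assumes "tdfn (\<lambda>e. G (e 0) (e (Suc 0)) (e (Suc (Suc 0))) (e (Suc (Suc (Suc 0)))))"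
  shows "dfn (\<lambda>e. attempt G (e 0) (e (Suc 0)) (e (Suc (Suc 0))) (e (Suc (Suc (Suc 0)))))"
  unfolding attempt_def by (intro dfn tdfn_subst4[OF assms])

lemma tdfn_ordrec:
  assumes G: "tdfn (\<lambda>e. G (e 0) (e (Suc 0)) (e (Suc (Suc 0))) (e (Suc (Suc (Suc 0)))))"
  shows "tdfn (\<lambda>e. ordrec G (e 0) (e (Suc 0)) (e (Suc (Suc 0))))"
  unfolding ordrec_def
  by (intro dfn tdfn_subst4[OF G] dfn_subst4[OF dfn_attempt[OF G]])

lemma attempt_restriction:
  assumes "attempt G u v a h" "ord a" "b \<epsilon> a"
  shows "attempt G u v b (restriction h b)"
proof -
  have "restriction (restriction h b) x = restriction h x" if "x \<epsilon> b" for x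
  proof (rule set_eqI)
    have "y \<epsilon> b" if "y \<epsilon> x" for y
      using ord_trans[OF ord_mem[OF assms(2,3)] \<open>x \<epsilon> b\<close> that] .
    then show "p \<epsilon> restriction (restriction h b) x \<longleftrightarrow> p \<epsilon> restriction h x" for p unfolding mem_restriction by metis
  qed
  moreover have "opair x y \<epsilon> restriction h b \<longleftrightarrow> x \<epsilon> b \<and> opair x y \<epsilon> h" for x y by (auto simp: mem_restriction)
  moreover have "x \<epsilon> a" if "x \<epsilon> b" for x using ord_trans[OF assms(2,3) that] .
  moreover have "\<exists>x y. x \<epsilon> b \<and> p = opair x y" if "p \<epsilon> restriction h b" for p using that unfolding mem_restriction by blast
  ultimately show ?thesis using assms(1) unfolding attempt_def by simp
qed

text \<open>Existence and uniqueness of the approximation go by one induction: any approximation on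
  \<open>a\<close> restricts, at each \<open>x\<close> in \<open>a\<close>, to the unique one on
  \<open>x\<close>, which fixes its value at \<open>x\<close>.\<close>

lemma ordrec_unfold_aux:
  assumes G: "tdfn (\<lambda>e. G (e 0) (e (Suc 0)) (e (Suc (Suc 0))) (e (Suc (Suc (Suc 0)))))"
    and "ord a"
  shows "attempt G u v a (lam a (ordrec G u v)) \<and> (\<forall>h. attempt G u v a h \<longrightarrow> h = lam a (ordrec G u v))"
proof (rule ord_induct[OF _ assms(2)])
  have T: "tdfn (\<lambda>e. ordrec G u v (e 0))"
    by (rule tdfn_subst3[OF tdfn_ordrec[OF G]]) (intro dfn)+
  show "dfn (\<lambda>e. attempt G u v (e 0) (lam (e 0) (ordrec G u v)) \<and>
      (\<forall>h. attempt G u v (e 0) h \<longrightarrow> h = lam (e 0) (ordrec G u v)))"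
    by (intro dfn tdfn_subst3[OF tdfn_ordrec[OF G]] dfn_subst4[OF dfn_attempt[OF G]])
  fix a assume a: "ord a" and IH: "\<And>z. z \<epsilon> a \<Longrightarrow>
     attempt G u v z (lam z (ordrec G u v)) \<and> (\<forall>h. attempt G u v z h \<longrightarrow> h = lam z (ordrec G u v))"
  have the: "ordrec G u v z = G u v z (lam z (ordrec G u v))" if "z \<epsilon> a" for z
    unfolding ordrec_def[of _ _ _ z] using the1_eq[of "attempt G u v z" "lam z (ordrec G u v)"] IH[OF that] by simp
  have mem: "opair x y \<epsilon> lam b (ordrec G u v) \<longleftrightarrow> x \<epsilon> b \<and> y = ordrec G u v x" for x y b
    by (auto simp: mem_lam[OF T])
  have restriction: "restriction (lam a (ordrec G u v)) z = lam z (ordrec G u v)" if "z \<epsilon> a" for z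
    by (rule set_eqI) (use ord_trans[OF a that] in \<open>auto simp: mem_restriction mem_lam[OF T]\<close>)
  have 1: "attempt G u v a (lam a (ordrec G u v))"
    unfolding attempt_def mem using the restriction by (auto simp: mem_lam[OF T])
  moreover have "h = lam a (ordrec G u v)" if h: "attempt G u v a h" for h
  proof -
    have eq: "restriction h x = lam x (ordrec G u v)" if "x \<epsilon> a" for x
      using attempt_restriction[OF h a that] IH[OF that] by blast
    have h1: "\<And>p. p \<epsilon> h \<Longrightarrow> \<exists>x y. x \<epsilon> a \<and> p = opair x y" and h2: "\<And>x. x \<epsilon> a \<Longrightarrow> \<exists>y. opair x y \<epsilon> h"
      and h3: "\<And>x y. opair x y \<epsilon> h \<Longrightarrow> y = G u v x (restriction h x)"
      using h unfolding attempt_def by blast+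
    have h4: "opair x y \<epsilon> h \<longleftrightarrow> x \<epsilon> a \<and> y = ordrec G u v x" for x y
    proof
      assume xy: "opair x y \<epsilon> h"
      then have "x \<epsilon> a" using h1[OF xy] by auto
      then show "x \<epsilon> a \<and> y = ordrec G u v x" using h3[OF xy] eq the by simp
    next
      assume x: "x \<epsilon> a \<and> y = ordrec G u v x"
      then obtain y' where y': "opair x y' \<epsilon> h" using h2 by blast
      then have "y' = y" using h3[OF y'] eq the x by simp
      then show "opair x y \<epsilon> h" using y' by simp
    qed
    show ?thesis by (rule set_eqI) (metis h1 h4 mem mem_lam[OF T])
  qed
  ultimately show "attempt G u v a (lam a (ordrec G u v)) \<and> (\<forall>h. attempt G u v a h \<longrightarrow> h = lam a (ordrec G u v))"
    by blast
qed

lemma ordrec_unfold: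
  assumes "tdfn (\<lambda>e. G (e 0) (e (Suc 0)) (e (Suc (Suc 0))) (e (Suc (Suc (Suc 0)))))" and "ord a"
  shows "ordrec G u v a = G u v a (lam a (ordrec G u v))"
  unfolding ordrec_def[of _ _ _ a]
  using the1_eq[of "attempt G u v a" "lam a (ordrec G u v)"] ordrec_unfold_aux[OF assms] by simp

subsection \<open>Finite sets\<close>

text \<open>The comparison of sizes used throughout. The map may be partial on \<open>A\<close> and
  may take values outside \<open>B\<close>, so enlarging \<open>A\<close> or shrinking
  \<open>B\<close> is harmless and no default values are needed.\<close>

definition psurj where
  "psurj A B \<longleftrightarrow> (\<exists>s. (\<forall>a b b'. opair a b \<epsilon> s \<and> opair a b' \<epsilon> s \<longrightarrow> b = b') \<and>
     (\<forall>b. b \<epsilon> B \<longrightarrow> (\<exists>a. a \<epsilon> A \<and> opair a b \<epsilon> s)))"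

lemma dfn_psurj: "dfn (\<lambda>e. psurj (e 0) (e (Suc 0)))" unfolding psurj_def by (intro dfn)
lemmas [dfn] = dfn_subst2[OF dfn_psurj]

text \<open>The relation is cut down to \<open>cart A B\<close> before it becomes a set; this is why
  \<open>R\<close> has to be single-valued only on \<open>A\<close> and with values in
  \<open>B\<close>.\<close>

lemma psurjI:
  assumes R: "dfn (\<lambda>e. R (e 0) (e (Suc 0)))"
    and f: "\<And>a b b'. a \<epsilon> A \<Longrightarrow> b \<epsilon> B \<Longrightarrow> b' \<epsilon> B \<Longrightarrow> R a b \<Longrightarrow> R a b' \<Longrightarrow> b = b'"
    and o: "\<And>b. b \<epsilon> B \<Longrightarrow> \<exists>a. a \<epsilon> A \<and> R a b"
  shows "psurj A B"
proof -
  let ?P = "\<lambda>p. \<exists>a b. a \<epsilon> A \<and> b \<epsilon> B \<and> p = opair a b \<and> R a b"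
  have "p \<epsilon> coll ?P \<longleftrightarrow> ?P p" for p
  proof (rule mem_coll_sub[of _ "cart A B"])
    show "dfn (\<lambda>e. ?P (e 0))" by (intro dfn dfn_subst2[OF R])
  qed auto
  then have "opair a b \<epsilon> coll ?P \<longleftrightarrow> a \<epsilon> A \<and> b \<epsilon> B \<and> R a b" for a b by simp
  then show ?thesis unfolding psurj_def using f o by (intro exI[of _ "coll ?P"]) meson
qed

lemma psurj_fun:
  assumes F: "tdfn (\<lambda>e. F (e 0))" and "\<And>b. b \<epsilon> B \<Longrightarrow> \<exists>a. a \<epsilon> A \<and> b = F a"
  shows "psurj A B"
  by (rule psurjI[of "\<lambda>a b. b = F a"]) (intro dfn tdfn_subst1[OF F], simp, rule assms)

lemma psurj_sub: "psurj A B \<Longrightarrow> A \<sqsubseteq> A' \<Longrightarrow> B' \<sqsubseteq> B \<Longrightarrow> psurj A' B'"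
  unfolding psurj_def subset_of_def by meson

lemma psurj_refl [simp]: "psurj A A"
  by (rule psurj_fun[of "\<lambda>x. x"]) (intro dfn, simp)

lemma psurj_of_sub: "B \<sqsubseteq> A \<Longrightarrow> psurj A B"
  using psurj_sub[OF psurj_refl[of A] sub_refl] .

lemma psurj_trans: assumes "psurj A B" "psurj B C" shows "psurj A C"
proof -
  obtain s where s: "\<And>a b b'. opair a b \<epsilon> s \<Longrightarrow> opair a b' \<epsilon> s \<Longrightarrow> b = b'" "\<And>b. b \<epsilon> B \<Longrightarrow> \<exists>a. a \<epsilon> A \<and> opair a b \<epsilon> s"
    using assms(1) unfolding psurj_def by metis
  obtain t where t: "\<And>a b b'. opair a b \<epsilon> t \<Longrightarrow> opair a b' \<epsilon> t \<Longrightarrow> b = b'" "\<And>b. b \<epsilon> C \<Longrightarrow> \<exists>a. a \<epsilon> B \<and> opair a b \<epsilon> t"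
    using assms(2) unfolding psurj_def by metis
  show ?thesis
  proof (rule psurjI[of "\<lambda>a c. \<exists>b. opair a b \<epsilon> s \<and> opair b c \<epsilon> t"])
    show "c = c'" if "\<exists>b. opair a b \<epsilon> s \<and> opair b c \<epsilon> t" "\<exists>b. opair a b \<epsilon> s \<and> opair b c' \<epsilon> t" for a c c'
      using that s(1) t(1) by metis
    show "\<exists>a. a \<epsilon> A \<and> (\<exists>b. opair a b \<epsilon> s \<and> opair b c \<epsilon> t)" if "c \<epsilon> C" for c
      using t(2)[OF that] s(2) by meson
  qed (intro dfn)
qed

lemma psurj_cart: assumes "psurj A B" "psurj C D" shows "psurj (cart A C) (cart B D)"
proof -
  obtain s where s: "\<And>a b b'. opair a b \<epsilon> s \<Longrightarrow> opair a b' \<epsilon> s \<Longrightarrow> b = b'" "\<And>b. b \<epsilon> B \<Longrightarrow> \<exists>a. a \<epsilon> A \<and> opair a b \<epsilon> s"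
    using assms(1) unfolding psurj_def by metis
  obtain t where t: "\<And>a b b'. opair a b \<epsilon> t \<Longrightarrow> opair a b' \<epsilon> t \<Longrightarrow> b = b'" "\<And>b. b \<epsilon> D \<Longrightarrow> \<exists>a. a \<epsilon> C \<and> opair a b \<epsilon> t"
    using assms(2) unfolding psurj_def by metis
  let ?R = "\<lambda>p q. \<exists>a b c d. p = opair a c \<and> q = opair b d \<and> opair a b \<epsilon> s \<and> opair c d \<epsilon> t"
  show ?thesis
  proof (rule psurjI[of ?R])
    show "q = q'" if "?R p q" "?R p q'" for p q q'
      using that s(1) t(1) opair_eq_iff by metis
    show "\<exists>p. p \<epsilon> cart A C \<and> ?R p q" if q: "q \<epsilon> cart B D" for q
    proof -
      obtain b d where bd: "b \<epsilon> B" "d \<epsilon> D" "q = opair b d" using q unfolding mem_cart by blast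
      obtain a where "a \<epsilon> A" "opair a b \<epsilon> s" using s(2)[OF bd(1)] by blast
      moreover obtain c where "c \<epsilon> C" "opair c d \<epsilon> t" using t(2)[OF bd(2)] by blast
      ultimately have "opair a c \<epsilon> cart A C \<and> ?R (opair a c) q" using bd(3) by auto
      then show ?thesis by blast
    qed
  qed (intro dfn)
qed

text \<open>With finiteness as being an image of part of a natural number, subsets and images of
  finite sets are finite at once. \<open>finite_set_iff_Fin\<close> shows the agreement with
  \<open>finite_set\<close>.\<close>

definition Fin where "Fin E \<longleftrightarrow> (\<exists>n. n \<epsilon> omega \<and> psurj n E)"
definition ins where "ins v E = cup E (upair v v)"

lemma dfn_Fin: "dfn (\<lambda>e. Fin (e 0))" unfolding Fin_def by (intro dfn)
lemmas [dfn] = dfn_subst1[OF dfn_Fin]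
lemma tdfn_ins [dfn]: "tdfn s \<Longrightarrow> tdfn t \<Longrightarrow> tdfn (\<lambda>e. ins (s e) (t e))" unfolding ins_def by (intro dfn)

lemma mem_ins [simp]: "x \<epsilon> ins v E \<longleftrightarrow> x \<epsilon> E \<or> x = v" by (auto simp: ins_def)

lemma Fin_psurj: "Fin A \<Longrightarrow> psurj A B \<Longrightarrow> Fin B"
  unfolding Fin_def using psurj_trans by blast

lemma Fin_sub: "Fin A \<Longrightarrow> B \<sqsubseteq> A \<Longrightarrow> Fin B"
  using Fin_psurj psurj_of_sub by metis

lemma Fin_omega: "n \<epsilon> omega \<Longrightarrow> Fin n"
  unfolding Fin_def using psurj_refl by metis

lemma Fin_emp [simp]: "Fin emp"
  using Fin_omega emp_omega by metis

lemma Fin_ins: assumes "Fin E" shows "Fin (ins v E)"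
proof -
  obtain n where n: "n \<epsilon> omega" "psurj n E" using assms Fin_def by metis
  obtain s where s: "\<And>a b b'. opair a b \<epsilon> s \<Longrightarrow> opair a b' \<epsilon> s \<Longrightarrow> b = b'" "\<And>b. b \<epsilon> E \<Longrightarrow> \<exists>a. a \<epsilon> n \<and> opair a b \<epsilon> s"
    using n(2) unfolding psurj_def by metis
  let ?R = "\<lambda>i b. i \<epsilon> n \<and> opair i b \<epsilon> s \<or> i = n \<and> b = v"
  have "psurj (succ n) (ins v E)"
  proof (rule psurjI[of ?R])
    show "b = b'" if "?R i b" "?R i b'" for i b b' using that s(1) by (metis no_mem_self)
    show "\<exists>i. i \<epsilon> succ n \<and> ?R i b" if "b \<epsilon> ins v E" for b using that s(2) by (metis mem_ins mem_succ)
  qed (intro dfn)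
  then show ?thesis using n(1) unfolding Fin_def by (meson succ_omega)
qed

text \<open>Induction on the number mapped onto the set: the elements reached below \<open>n\<close>
  form a set \<open>E\<close> covered by the hypothesis, and index \<open>n\<close> contributes at
  most one more.\<close>

lemma Fin_induct:
  assumes P: "dfn (\<lambda>e. P (e 0))" and "Fin A" and "P emp"
    and step: "\<And>E v. Fin E \<Longrightarrow> P E \<Longrightarrow> P (ins v E)"
  shows "P A"
proof -
  obtain n where n: "n \<epsilon> omega" "psurj n A" using assms Fin_def by metis
  have "\<forall>A. psurj n A \<longrightarrow> P A"
  proof (rule omega_induct[OF _ n(1)])
    show "dfn (\<lambda>e. \<forall>A. psurj (e 0) A \<longrightarrow> P A)" by (intro dfn dfn_subst1[OF P])
    show "\<forall>A. psurj emp A \<longrightarrow> P A"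
    proof (intro allI impI)
      fix A assume "psurj emp A"
      then have "A = emp" unfolding psurj_def by (metis mem_emp set_eqI)
      then show "P A" using \<open>P emp\<close> by simp
    qed
    fix n assume n: "n \<epsilon> omega" and IH: "\<forall>A. psurj n A \<longrightarrow> P A"
    show "\<forall>A. psurj (succ n) A \<longrightarrow> P A"
    proof (intro allI impI)
      fix A assume "psurj (succ n) A"
      then obtain s where s: "\<And>a b b'. opair a b \<epsilon> s \<Longrightarrow> opair a b' \<epsilon> s \<Longrightarrow> b = b'"
        "\<And>b. b \<epsilon> A \<Longrightarrow> \<exists>a. a \<epsilon> succ n \<and> opair a b \<epsilon> s"
        unfolding psurj_def by metis
      define E where "E = coll (\<lambda>b. b \<epsilon> A \<and> (\<exists>i. i \<epsilon> n \<and> opair i b \<epsilon> s))"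
      have E: "b \<epsilon> E \<longleftrightarrow> b \<epsilon> A \<and> (\<exists>i. i \<epsilon> n \<and> opair i b \<epsilon> s)" for b
        unfolding E_def by (rule mem_coll_sub[of _ A]) (intro dfn, blast)
      have "psurj n E"
      proof (rule psurjI[of "\<lambda>i b. opair i b \<epsilon> s"])
        show "b = b'" if "opair a b \<epsilon> s" "opair a b' \<epsilon> s" for a b b' using s(1) that .
        show "\<exists>a. a \<epsilon> n \<and> opair a b \<epsilon> s" if "b \<epsilon> E" for b using that E by simp
      qed (intro dfn)
      then have PE: "P E" "Fin E" using IH n unfolding Fin_def by blast+
      show "P A"
      proof (cases "\<exists>v. v \<epsilon> A \<and> opair n v \<epsilon> s")
        case True
        then obtain v where v: "v \<epsilon> A" "opair n v \<epsilon> s" by blast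
        have "A = ins v E"
        proof (rule set_eqI)
          show "z \<epsilon> A \<longleftrightarrow> z \<epsilon> ins v E" for z
            using s(1)[OF v(2), of z] s(2)[of z] v(1) unfolding mem_ins E mem_succ by blast
        qed
        then show ?thesis using step[OF PE(2,1), of v] by simp
      next
        case False
        have "A = E"
        proof (rule set_eqI)
          show "z \<epsilon> A \<longleftrightarrow> z \<epsilon> E" for z
            using s(2)[of z] False unfolding E mem_succ by blast
        qed
        then show ?thesis using PE(1) by simp
      qed
    qed
  qed
  then show ?thesis using n(2) by blast
qed

lemma Fin_cup: assumes "Fin A" "Fin B" shows "Fin (cup A B)"
proof (rule Fin_induct[OF _ assms(2)])
  show "dfn (\<lambda>e. Fin (cup A (e 0)))" by (intro dfn)
  have "cup A emp = A" by (rule set_eqI) simp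
  then show "Fin (cup A emp)" using assms(1) by simp
  fix E v assume 1: "Fin (cup A E)"
  have "cup A (ins v E) = ins v (cup A E)" by (rule set_eqI) auto
  then show "Fin (cup A (ins v E))" using Fin_ins[OF 1, of v] by simp
qed

lemma Fin_cart: assumes "Fin A" "Fin B" shows "Fin (cart A B)"
proof (rule Fin_induct[OF _ assms(1)])
  show "dfn (\<lambda>e. Fin (cart (e 0) B))" by (intro dfn)
  have "cart emp B = emp" by (rule set_eqI) (simp add: mem_cart)
  then show "Fin (cart emp B)" by simp
  fix E v assume 1: "Fin (cart E B)"
  have "psurj B (cart (upair v v) B)"
    by (rule psurj_fun[of "\<lambda>b. opair v b"]) (intro dfn, auto simp: mem_cart)
  then have "Fin (cart (upair v v) B)" using Fin_psurj assms(2) by metis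
  then have "Fin (cup (cart E B) (cart (upair v v) B))" using Fin_cup[OF 1] by simp
  then show "Fin (cart (ins v E) B)" by (rule Fin_sub) (auto simp: mem_cart subset_of_def)
qed

lemma Fin_family_bound:
  assumes S: "tdfn (\<lambda>e. S (e 0))" and "Fin A" and "\<And>i. i \<epsilon> A \<Longrightarrow> Fin (S i)"
  shows "\<exists>U. Fin U \<and> (\<forall>i. i \<epsilon> A \<longrightarrow> S i \<sqsubseteq> U)"
proof -
  have "(\<forall>i. i \<epsilon> A \<longrightarrow> Fin (S i)) \<longrightarrow> (\<exists>U. Fin U \<and> (\<forall>i. i \<epsilon> A \<longrightarrow> S i \<sqsubseteq> U))"
  proof (rule Fin_induct[OF _ assms(2)])
    show "dfn (\<lambda>e. (\<forall>i. i \<epsilon> e 0 \<longrightarrow> Fin (S i)) \<longrightarrow> (\<exists>U. Fin U \<and> (\<forall>i. i \<epsilon> e 0 \<longrightarrow> S i \<sqsubseteq> U)))"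
      by (intro dfn tdfn_subst1[OF S])
    fix E v
    assume 1: "(\<forall>i. i \<epsilon> E \<longrightarrow> Fin (S i)) \<longrightarrow> (\<exists>U. Fin U \<and> (\<forall>i. i \<epsilon> E \<longrightarrow> S i \<sqsubseteq> U))"
    show "(\<forall>i. i \<epsilon> ins v E \<longrightarrow> Fin (S i)) \<longrightarrow> (\<exists>U. Fin U \<and> (\<forall>i. i \<epsilon> ins v E \<longrightarrow> S i \<sqsubseteq> U))"
    proof
      assume 2: "\<forall>i. i \<epsilon> ins v E \<longrightarrow> Fin (S i)"
      then obtain U where U: "Fin U" "\<forall>i. i \<epsilon> E \<longrightarrow> S i \<sqsubseteq> U" using 1 by auto
      have "Fin (cup U (S v))" using Fin_cup[OF U(1)] 2 by simp
      moreover have "S i \<sqsubseteq> cup U (S v)" if "i \<epsilon> ins v E" for i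
        using that U(2) by (auto simp: subset_of_def)
      ultimately show "\<exists>U. Fin U \<and> (\<forall>i. i \<epsilon> ins v E \<longrightarrow> S i \<sqsubseteq> U)" by blast
    qed
  next
    show "(\<forall>i. i \<epsilon> emp \<longrightarrow> Fin (S i)) \<longrightarrow> (\<exists>U. Fin U \<and> (\<forall>i. i \<epsilon> emp \<longrightarrow> S i \<sqsubseteq> U))"
      using Fin_emp mem_emp by metis
  qed
  then show ?thesis using assms(3) by blast
qed

lemma omega_max: "m \<epsilon> omega \<Longrightarrow> n \<epsilon> omega \<Longrightarrow> \<exists>k. k \<epsilon> omega \<and> m \<sqsubseteq> k \<and> n \<sqsubseteq> k"
  using ord_linear_sub[OF omega_ord omega_ord] sub_refl by metis

lemma Fin_omega_bound: assumes "Fin E" shows "\<exists>m. m \<epsilon> omega \<and> (\<forall>v. v \<epsilon> E \<and> v \<epsilon> omega \<longrightarrow> v \<epsilon> m)"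
proof (rule Fin_induct[OF _ assms])
  show "dfn (\<lambda>e. \<exists>m. m \<epsilon> omega \<and> (\<forall>v. v \<epsilon> e 0 \<and> v \<epsilon> omega \<longrightarrow> v \<epsilon> m))" by (intro dfn)
  show "\<exists>m. m \<epsilon> omega \<and> (\<forall>v. v \<epsilon> emp \<and> v \<epsilon> omega \<longrightarrow> v \<epsilon> m)" using emp_omega mem_emp by metis
  fix E w assume "\<exists>m. m \<epsilon> omega \<and> (\<forall>v. v \<epsilon> E \<and> v \<epsilon> omega \<longrightarrow> v \<epsilon> m)"
  then obtain m where m: "m \<epsilon> omega" "\<And>v. v \<epsilon> E \<Longrightarrow> v \<epsilon> omega \<Longrightarrow> v \<epsilon> m" by blast
  show "\<exists>m. m \<epsilon> omega \<and> (\<forall>v. v \<epsilon> ins w E \<and> v \<epsilon> omega \<longrightarrow> v \<epsilon> m)"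
  proof (cases "w \<epsilon> omega")
    case True
    then obtain k where "k \<epsilon> omega" "m \<sqsubseteq> k" "succ w \<sqsubseteq> k" using omega_max[OF m(1) succ_omega] by metis
    then show ?thesis using m(2) by (intro exI[of _ k]) (auto simp: subset_of_def)
  next
    case False
    then show ?thesis using m by (intro exI[of _ m]) auto
  qed
qed

lemma not_Fin_omega [simp]: "\<not> Fin omega"
  using Fin_omega_bound[of omega] no_mem_self by blast

section \<open>Agreement with finiteness by bijections\<close>

lemma is_pair_iff: "is_pair x y p \<longleftrightarrow> p = opair x y"
proof -
  have 1: "is_upair x y u \<longleftrightarrow> u = upair x y" for x y u
    by (auto simp: is_upair_def intro: set_eqI)
  show ?thesis unfolding is_pair_def 1 opair_def by blast
qed

lemma maps_to_iff: "maps_to f a b \<longleftrightarrow> opair a b \<epsilon> f"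
  by (simp add: maps_to_def is_pair_iff)

definition enumerates where
  "enumerates f n x \<longleftrightarrow> (\<forall>p. p \<epsilon> f \<longrightarrow> (\<exists>a b. a \<epsilon> n \<and> b \<epsilon> x \<and> p = opair a b)) \<and>
     (\<forall>a. a \<epsilon> n \<longrightarrow> (\<exists>b. opair a b \<epsilon> f)) \<and> (\<forall>a b b'. opair a b \<epsilon> f \<and> opair a b' \<epsilon> f \<longrightarrow> b = b') \<and>
     (\<forall>a a' b. opair a b \<epsilon> f \<and> opair a' b \<epsilon> f \<longrightarrow> a = a') \<and> (\<forall>b. b \<epsilon> x \<longrightarrow> (\<exists>a. opair a b \<epsilon> f))"

lemma finite_set_eq: "finite_set x \<longleftrightarrow> (\<exists>n f. n \<epsilon> omega \<and> enumerates f n x)"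
proof -
  have "is_injection f n x \<and> is_surjection f n x \<longleftrightarrow> enumerates f n x" for n f
  proof
    assume l: "is_injection f n x \<and> is_surjection f n x"
    then have 1: "\<forall>p. p \<epsilon> f \<longrightarrow> (\<exists>a b. a \<epsilon> n \<and> b \<epsilon> x \<and> p = opair a b)" and 2: "\<forall>a. a \<epsilon> n \<longrightarrow> (\<exists>!b. opair a b \<epsilon> f)"
      and 3: "\<forall>a a' b. opair a b \<epsilon> f \<and> opair a' b \<epsilon> f \<longrightarrow> a = a'" "\<forall>b. b \<epsilon> x \<longrightarrow> (\<exists>a. a \<epsilon> n \<and> opair a b \<epsilon> f)"
      unfolding is_injection_def is_surjection_def is_function_def maps_to_iff is_pair_iff by auto
    have "a \<epsilon> n" if "opair a b \<epsilon> f" for a b using 1[THEN spec, THEN mp, OF that] by auto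
    then show "enumerates f n x" unfolding enumerates_def using 1 2 3 by (intro conjI) blast+
  next
    assume r: "enumerates f n x"
    then have "\<forall>p. p \<epsilon> f \<longrightarrow> (\<exists>a b. a \<epsilon> n \<and> b \<epsilon> x \<and> p = opair a b)" unfolding enumerates_def by (elim conjE)
    then have "a \<epsilon> n" if "opair a b \<epsilon> f" for a b using that by fastforce
    then show "is_injection f n x \<and> is_surjection f n x" using r
      unfolding is_injection_def is_surjection_def is_function_def maps_to_iff is_pair_iff enumerates_def
      by (intro conjI) blast+
  qed
  then show ?thesis unfolding finite_set_def is_omega_iff by simp
qed

lemma enumeratesD:
  assumes "enumerates f n x"
  shows "opair a b \<epsilon> f \<Longrightarrow> a \<epsilon> n" "opair a b \<epsilon> f \<Longrightarrow> b \<epsilon> x" "p \<epsilon> f \<Longrightarrow> \<exists>a b. a \<epsilon> n \<and> b \<epsilon> x \<and> p = opair a b"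
    "a \<epsilon> n \<Longrightarrow> \<exists>b. opair a b \<epsilon> f" "opair a b \<epsilon> f \<Longrightarrow> opair a b' \<epsilon> f \<Longrightarrow> b = b'"
    "opair a b \<epsilon> f \<Longrightarrow> opair a' b \<epsilon> f \<Longrightarrow> a = a'" "b \<epsilon> x \<Longrightarrow> \<exists>a. opair a b \<epsilon> f"
proof -
  note f = assms[unfolded enumerates_def]
  note 1 = f[THEN conjunct1] and 2 = f[THEN conjunct2, THEN conjunct1]
    and 3 = f[THEN conjunct2, THEN conjunct2, THEN conjunct1]
    and 4 = f[THEN conjunct2, THEN conjunct2, THEN conjunct2, THEN conjunct1]
    and 5 = f[THEN conjunct2, THEN conjunct2, THEN conjunct2, THEN conjunct2]
  show "p \<epsilon> f \<Longrightarrow> \<exists>a b. a \<epsilon> n \<and> b \<epsilon> x \<and> p = opair a b" for p using 1 by simp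
  from this[of "opair a b"] show "opair a b \<epsilon> f \<Longrightarrow> a \<epsilon> n" "opair a b \<epsilon> f \<Longrightarrow> b \<epsilon> x" by auto
  show "a \<epsilon> n \<Longrightarrow> \<exists>b. opair a b \<epsilon> f" using 2 by simp
  show "opair a b \<epsilon> f \<Longrightarrow> opair a b' \<epsilon> f \<Longrightarrow> b = b'" using 3 by blast
  show "opair a b \<epsilon> f \<Longrightarrow> opair a' b \<epsilon> f \<Longrightarrow> a = a'" using 4 by blast
  show "b \<epsilon> x \<Longrightarrow> \<exists>a. opair a b \<epsilon> f" using 5 by simp
qed

text \<open>Conversely, \<open>Fin_induct\<close> builds a bijection: a new element becomes the
  value at \<open>n\<close>, while an old one changes nothing.\<close>

lemma finite_set_iff_Fin: "finite_set x \<longleftrightarrow> Fin x"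
proof
  assume "finite_set x"
  then obtain n f where n: "n \<epsilon> omega" and f: "enumerates f n x" unfolding finite_set_eq by blast
  have "psurj n x"
  proof (rule psurjI[of "\<lambda>a b. opair a b \<epsilon> f"])
    show "\<exists>a. a \<epsilon> n \<and> opair a b \<epsilon> f" if "b \<epsilon> x" for b
      using enumeratesD(7)[OF f that] enumeratesD(1)[OF f] by metis
  qed (intro dfn, rule enumeratesD(5)[OF f])
  then show "Fin x" unfolding Fin_def using n by blast
next
  assume "Fin x"
  then show "finite_set x"
  proof (rule Fin_induct[rotated])
    show "dfn (\<lambda>e. finite_set (e 0))" unfolding finite_set_eq enumerates_def by (intro dfn)
    have "enumerates emp emp emp" by (simp add: enumerates_def)
    then show "finite_set emp" unfolding finite_set_eq using emp_omega by metis
    fix E v assume E: "finite_set E"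
    show "finite_set (ins v E)"
    proof (cases "v \<epsilon> E")
      case True
      then have "ins v E = E" by (intro set_eqI) auto
      then show ?thesis using E by simp
    next
      case False
      obtain n f where n: "n \<epsilon> omega" and f: "enumerates f n E" using E unfolding finite_set_eq by blast
      note fD = enumeratesD[OF f]
      have ndom: "\<not> opair n b \<epsilon> f" "\<not> opair a v \<epsilon> f" for a b using fD(1,2) False no_mem_self by blast+
      have "enumerates (ins (opair n v) f) (succ n) (ins v E)"
        unfolding enumerates_def
      proof (intro conjI allI impI)
        show "\<exists>a b. a \<epsilon> succ n \<and> b \<epsilon> ins v E \<and> p = opair a b" if "p \<epsilon> ins (opair n v) f" for p
          using that fD(3)[of p] unfolding mem_ins mem_succ by blast
        show "\<exists>b. opair a b \<epsilon> ins (opair n v) f" if "a \<epsilon> succ n" for a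
          using that fD(4)[of a] unfolding mem_ins mem_succ by blast
        show "b = b'" if "opair a b \<epsilon> ins (opair n v) f \<and> opair a b' \<epsilon> ins (opair n v) f" for a b b'
          using that fD(5)[of a b b'] ndom unfolding mem_ins opair_eq_iff by blast
        show "a = a'" if "opair a b \<epsilon> ins (opair n v) f \<and> opair a' b \<epsilon> ins (opair n v) f" for a a' b
          using that fD(6)[of a b a'] ndom unfolding mem_ins opair_eq_iff by blast
        show "\<exists>a. opair a b \<epsilon> ins (opair n v) f" if "b \<epsilon> ins v E" for b
          using that fD(7)[of b] unfolding mem_ins by blast
      qed
      then show ?thesis unfolding finite_set_eq using n succ_omega by blast
    qed
  qed
qed

subsection \<open>Order types\<close>

text \<open>The Mostowski collapse of a set \<open>S\<close> of ordinals, extended to all ordinals: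
  \<open>collapse S x\<close> is the order type of the part of \<open>S\<close> below
  \<open>x\<close>.\<close>

definition collapse where
  "collapse S x = ordrec (\<lambda>u v x h. coll (\<lambda>z. \<exists>y. y \<epsilon> x \<and> y \<epsilon> u \<and> z = app h y)) S emp x"

definition otype where "otype S = repl S (collapse S)"

lemma tdfn_collapse: "tdfn (\<lambda>e. collapse (e 0) (e (Suc 0)))"
  unfolding collapse_def by (rule tdfn_subst3[OF tdfn_ordrec]) (intro dfn)+
lemmas [dfn] = tdfn_subst2[OF tdfn_collapse]

lemma tdfn_otype: "tdfn (\<lambda>e. otype (e 0))" unfolding otype_def by (intro dfn)
lemmas [dfn] = tdfn_subst1[OF tdfn_otype]

lemma mem_collapse: assumes "ord x" shows "z \<epsilon> collapse S x \<longleftrightarrow> (\<exists>y. y \<epsilon> x \<and> y \<epsilon> S \<and> z = collapse S y)"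
proof -
  have T: "tdfn (\<lambda>e. collapse S (e 0))" by (intro dfn)
  let ?G = "\<lambda>u v x h. coll (\<lambda>z. \<exists>y. y \<epsilon> x \<and> y \<epsilon> u \<and> z = app h y)"
  have "collapse S x = ?G S emp x (lam x (collapse S))"
    unfolding collapse_def by (rule ordrec_unfold[OF _ assms]) (intro dfn)
  also have "\<dots> = coll (\<lambda>z. \<exists>y. y \<epsilon> x \<and> y \<epsilon> S \<and> z = collapse S y)"
    using app_lam[OF T] by (metis (no_types, opaque_lifting))
  also have "z \<epsilon> \<dots> \<longleftrightarrow> (\<exists>y. y \<epsilon> x \<and> y \<epsilon> S \<and> z = collapse S y)"
    by (rule mem_coll_sub[of _ "repl x (collapse S)"]) (intro dfn, auto simp: mem_repl[OF T])
  finally show ?thesis .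
qed

lemma mem_otype: "z \<epsilon> otype S \<longleftrightarrow> (\<exists>s. s \<epsilon> S \<and> z = collapse S s)"
  unfolding otype_def by (rule mem_repl) (intro dfn)

lemma collapse_mono: "ord x \<Longrightarrow> y \<epsilon> x \<Longrightarrow> y \<epsilon> S \<Longrightarrow> collapse S y \<epsilon> collapse S x"
  using mem_collapse by metis

lemma ord_collapse: assumes "ord x" shows "ord (collapse S x)"
proof (rule ord_induct[OF _ assms])
  show "dfn (\<lambda>e. ord (collapse S (e 0)))" by (intro dfn)
  fix x assume x: "ord x" and IH: "\<And>z. z \<epsilon> x \<Longrightarrow> ord (collapse S z)"
  show "ord (collapse S x)"
  proof (rule ordI)
    show "ord y" if "y \<epsilon> collapse S x" for y using that IH mem_collapse[OF x] by metis
    show "z \<epsilon> collapse S x" if y: "y \<epsilon> collapse S x" and z: "z \<epsilon> y" for y z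
    proof -
      obtain w where w: "w \<epsilon> x" "y = collapse S w" using y mem_collapse[OF x] by metis
      obtain w' where "w' \<epsilon> w" "w' \<epsilon> S" "z = collapse S w'" using z w mem_collapse[OF ord_mem[OF x w(1)]] by metis
      then show ?thesis using ord_trans[OF x w(1)] mem_collapse[OF x] by metis
    qed
  qed
qed

lemma collapse_inj:
  assumes "x \<epsilon> S" "y \<epsilon> S" "ord x" "ord y" "collapse S x = collapse S y"
  shows "x = y"
  using ord_linear[OF assms(3,4)] collapse_mono assms by (metis no_mem_self)

lemma collapse_sub: assumes "ord x" shows "collapse S x \<sqsubseteq> x"
proof (rule ord_induct[OF _ assms])
  show "dfn (\<lambda>e. collapse S (e 0) \<sqsubseteq> e 0)" by (intro dfn)
  fix x assume x: "ord x" and IH: "\<And>z. z \<epsilon> x \<Longrightarrow> collapse S z \<sqsubseteq> z"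
  show "collapse S x \<sqsubseteq> x"
  proof (rule subI)
    fix z assume "z \<epsilon> collapse S x"
    then obtain y where y: "y \<epsilon> x" "z = collapse S y" using mem_collapse[OF x] by metis
    show "z \<epsilon> x" using ord_sub_mem[OF ord_collapse[OF ord_mem[OF x y(1)]] x IH[OF y(1)] y(1)] y(2) by simp
  qed
qed

lemma ord_otype: assumes "\<And>s. s \<epsilon> S \<Longrightarrow> ord s" shows "ord (otype S)"
proof (rule ordI)
  show "ord y" if "y \<epsilon> otype S" for y using that assms ord_collapse unfolding mem_otype by metis
  show "z \<epsilon> otype S" if "y \<epsilon> otype S" "z \<epsilon> y" for y z
    using that assms mem_collapse unfolding mem_otype by metis
qed

lemma otype_sub: assumes "ord k" "S \<sqsubseteq> k" shows "otype S \<sqsubseteq> k"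
proof (rule subI)
  fix z assume "z \<epsilon> otype S"
  then obtain s where s: "s \<epsilon> S" "z = collapse S s" using mem_otype by blast
  then have "s \<epsilon> k" using assms(2) subD by blast
  then show "z \<epsilon> k" using ord_sub_mem[OF ord_collapse assms(1) collapse_sub] ord_mem[OF assms(1)] s by metis
qed

lemma psurj_otype: assumes "\<And>s. s \<epsilon> S \<Longrightarrow> ord s" shows "psurj (otype S) S"
proof (rule psurjI[of "\<lambda>z s. s \<epsilon> S \<and> z = collapse S s"])
  show "b = b'" if "b \<epsilon> S \<and> a = collapse S b" "b' \<epsilon> S \<and> a = collapse S b'" for a b b'
    using collapse_inj[of b S b'] that assms by simp
  show "\<exists>a. a \<epsilon> otype S \<and> b \<epsilon> S \<and> a = collapse S b" if "b \<epsilon> S" for b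
    using that mem_otype by blast
qed (intro dfn)

lemma psurj_to_otype: "psurj S (otype S)"
  by (rule psurj_fun[of "collapse S"]) (intro dfn, simp add: mem_otype)

subsection \<open>Initial ordinals and their squares\<close>

lemma mem_succ_ord: "ord a \<Longrightarrow> ord d \<Longrightarrow> a \<epsilon> succ d \<longleftrightarrow> a \<sqsubseteq> d"
  using ord_sub_iff by simp

lemma succ_inj: "succ x = succ y \<Longrightarrow> x = y"
  by (metis mem_succ no_mem_cycle)

lemma ord_max: "ord k \<Longrightarrow> a \<epsilon> k \<Longrightarrow> b \<epsilon> k \<Longrightarrow> \<exists>d. d \<epsilon> k \<and> a \<sqsubseteq> d \<and> b \<sqsubseteq> d"
  using ord_linear_sub[OF ord_mem ord_mem] sub_refl by metis

lemma succ_sub: "ord k \<Longrightarrow> d \<epsilon> k \<Longrightarrow> succ d \<sqsubseteq> k"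
  using ord_trans by (intro subI) auto

lemma omega_le_or_mem: "ord d \<Longrightarrow> omega \<sqsubseteq> d \<or> d \<epsilon> omega"
  using ord_not_mem[OF _ ord_omega] by blast

lemma not_Fin_omega_le: "omega \<sqsubseteq> d \<Longrightarrow> \<not> Fin d"
  using Fin_sub not_Fin_omega by metis

text \<open>Hilbert's hotel: \<open>emp\<close> goes to \<open>d\<close>, each positive natural
  number to its predecessor, and everything from \<open>omega\<close> on to itself.\<close>

lemma psurj_succ: assumes "omega \<sqsubseteq> d" shows "psurj d (succ d)"
proof (rule psurjI[of "\<lambda>x y. x = emp \<and> y = d \<or> x \<epsilon> omega \<and> x = succ y \<or> \<not> x \<epsilon> omega \<and> y = x"])
  have ne: "succ y \<noteq> emp" for y using mem_succ mem_emp by metis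
  show "b = b'" if "a = emp \<and> b = d \<or> a \<epsilon> omega \<and> a = succ b \<or> \<not> a \<epsilon> omega \<and> b = a"
    "a = emp \<and> b' = d \<or> a \<epsilon> omega \<and> a = succ b' \<or> \<not> a \<epsilon> omega \<and> b' = a" for a b b'
    using that succ_inj ne emp_omega by metis
  show "\<exists>a. a \<epsilon> d \<and> (a = emp \<and> b = d \<or> a \<epsilon> omega \<and> a = succ b \<or> \<not> a \<epsilon> omega \<and> b = a)" if "b \<epsilon> succ d" for b
    using that subD[OF assms] emp_omega succ_omega[of b] unfolding mem_succ by metis
qed (intro dfn)

text \<open>These are the alephs.\<close>

definition initial where
  "initial k \<longleftrightarrow> ord k \<and> omega \<sqsubseteq> k \<and> (\<forall>d. d \<epsilon> k \<longrightarrow> \<not> psurj d k)"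

lemma initial_succ: assumes "initial k" "d \<epsilon> k" shows "succ d \<epsilon> k"
proof (rule ccontr)
  have k: "ord k" "omega \<sqsubseteq> k" "\<not> psurj d k" using assms unfolding initial_def by blast+
  then have d: "ord d" using assms(2) ord_mem by blast
  assume n: "\<not> succ d \<epsilon> k"
  then have eq: "k = succ d" using succ_sub[OF k(1) assms(2)] ord_sub_iff[OF ord_succ[OF d] k(1)] by blast
  have "omega \<sqsubseteq> d"
  proof (rule ccontr)
    assume "\<not> omega \<sqsubseteq> d"
    then have "succ d \<epsilon> omega" using omega_le_or_mem[OF d] succ_omega by blast
    then show False using n k(2) subD by metis
  qed
  then show False using psurj_succ k(3) eq by metis
qed

text \<open>
  Pairs are selected by their maximum first, so that the pairs listed before \<open>(a, b)\<close> lie in a square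
  smaller than \<open>k \<times> k\<close>.
\<close>

definition goedel_max where "goedel_max Z = least_ord (\<lambda>d. \<exists>a b. a \<epsilon> succ d \<and> b \<epsilon> succ d \<and> opair a b \<epsilon> Z)"
definition goedel_fst where "goedel_fst Z = least_ord (\<lambda>a. \<exists>b. a \<epsilon> succ (goedel_max Z) \<and> b \<epsilon> succ (goedel_max Z) \<and> opair a b \<epsilon> Z)"
definition goedel_snd where "goedel_snd Z = least_ord (\<lambda>b. b \<epsilon> succ (goedel_max Z) \<and> opair (goedel_fst Z) b \<epsilon> Z)"

lemma tdfn_goedel_max: "tdfn (\<lambda>e. goedel_max (e 0))" unfolding goedel_max_def by (intro dfn)
lemmas [dfn] = tdfn_subst1[OF tdfn_goedel_max]
lemma tdfn_goedel_fst: "tdfn (\<lambda>e. goedel_fst (e 0))" unfolding goedel_fst_def by (intro dfn)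
lemmas [dfn] = tdfn_subst1[OF tdfn_goedel_fst]
lemma tdfn_goedel_snd: "tdfn (\<lambda>e. goedel_snd (e 0))" unfolding goedel_snd_def by (intro dfn)
lemmas [dfn] = tdfn_subst1[OF tdfn_goedel_snd]

text \<open>The selected pair has the least possible maximum, so it stays in every square
  \<open>cart (succ d) (succ d)\<close> that meets \<open>Z\<close>.\<close>

lemma gsel:
  assumes Z: "\<And>a b. opair a b \<epsilon> Z \<Longrightarrow> ord a \<and> ord b"
    and ab: "opair a b \<epsilon> Z" "ord d" "a \<epsilon> succ d" "b \<epsilon> succ d"
  shows "opair (goedel_fst Z) (goedel_snd Z) \<epsilon> Z" "goedel_fst Z \<epsilon> succ d" "goedel_snd Z \<epsilon> succ d"
proof -
  have "dfn (\<lambda>e. \<exists>a b. a \<epsilon> succ (e 0) \<and> b \<epsilon> succ (e 0) \<and> opair a b \<epsilon> Z)" by (intro dfn)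
  note m = least_ord_props[OF this ab(2), folded goedel_max_def]
  have m: "ord (goedel_max Z)" "\<exists>a b. a \<epsilon> succ (goedel_max Z) \<and> b \<epsilon> succ (goedel_max Z) \<and> opair a b \<epsilon> Z" "goedel_max Z \<sqsubseteq> d"
    using m ab by blast+
  then obtain a' b' where 1: "a' \<epsilon> succ (goedel_max Z)" "b' \<epsilon> succ (goedel_max Z)" "opair a' b' \<epsilon> Z" by blast
  have "dfn (\<lambda>e. \<exists>b. e 0 \<epsilon> succ (goedel_max Z) \<and> b \<epsilon> succ (goedel_max Z) \<and> opair (e 0) b \<epsilon> Z)" by (intro dfn)
  note a = least_ord_props[OF this, of a', folded goedel_fst_def]
  obtain b'' where 2: "goedel_fst Z \<epsilon> succ (goedel_max Z)" "b'' \<epsilon> succ (goedel_max Z)" "opair (goedel_fst Z) b'' \<epsilon> Z"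
    using a(2) 1 Z by blast
  have "dfn (\<lambda>e. e 0 \<epsilon> succ (goedel_max Z) \<and> opair (goedel_fst Z) (e 0) \<epsilon> Z)" by (intro dfn)
  note b = least_ord_props[OF this, of b'', folded goedel_snd_def]
  have 3: "goedel_snd Z \<epsilon> succ (goedel_max Z)" "opair (goedel_fst Z) (goedel_snd Z) \<epsilon> Z"
    using b(2) 2 Z by blast+
  then show "opair (goedel_fst Z) (goedel_snd Z) \<epsilon> Z" by blast
  then have "ord (goedel_fst Z)" "ord (goedel_snd Z)" using Z by blast+
  then show "goedel_fst Z \<epsilon> succ d" "goedel_snd Z \<epsilon> succ d"
    using 2(1) 3(1) m(1,3) ab(2) mem_succ_ord sub_trans by metis+
qed

definition unlisted where
  "unlisted k x h = coll (\<lambda>p. p \<epsilon> cart k k \<and> \<not> (\<exists>y. y \<epsilon> x \<and> p = app h y))"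

lemma tdfn_unlisted: "tdfn (\<lambda>e. unlisted (e 0) (e (Suc 0)) (e (Suc (Suc 0))))" unfolding unlisted_def by (intro dfn)
lemmas [dfn] = tdfn_subst3[OF tdfn_unlisted]

lemma mem_unlisted: "p \<epsilon> unlisted k x h \<longleftrightarrow> p \<epsilon> cart k k \<and> \<not> (\<exists>y. y \<epsilon> x \<and> p = app h y)"
  unfolding unlisted_def by (rule mem_coll_sub[of _ "cart k k"]) (intro dfn, blast)

definition goedel where
  "goedel k x = ordrec (\<lambda>u v x h. opair (goedel_fst (unlisted u x h)) (goedel_snd (unlisted u x h))) k emp x"

lemma tdfn_goedel: "tdfn (\<lambda>e. goedel (e 0) (e (Suc 0)))"
  unfolding goedel_def by (rule tdfn_subst3[OF tdfn_ordrec]) (intro dfn)+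
lemmas [dfn] = tdfn_subst2[OF tdfn_goedel]

text \<open>If \<open>(a, b)\<close> were never listed, it would remain a candidate at every stage,
  forcing all pairs listed below \<open>k\<close> into the square of \<open>succ d\<close>. They are
  distinct, so this square, and by \<open>IH\<close> already \<open>succ d\<close>, would map onto
  \<open>k\<close>; if \<open>succ d\<close> is finite, \<open>k\<close> would be finite.\<close>

lemma goedel_onto_aux:
  assumes k: "initial k" and IH: "\<And>d. d \<epsilon> k \<Longrightarrow> omega \<sqsubseteq> d \<Longrightarrow> psurj d (cart d d)"
    and ab: "a \<epsilon> k" "b \<epsilon> k"
  shows "\<exists>x. x \<epsilon> k \<and> goedel k x = opair a b"
proof (rule ccontr)
  assume n: "\<not> ?thesis"
  have ordk: "ord k" using k initial_def by blast
  obtain d where d: "d \<epsilon> k" "a \<sqsubseteq> d" "b \<sqsubseteq> d" using ord_max[OF ordk ab] by blast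
  have ordd: "ord d" "ord a" "ord b" using ord_mem[OF ordk] d(1) ab by blast+
  have sd: "succ d \<epsilon> k" using initial_succ[OF k d(1)] .
  have T: "tdfn (\<lambda>e. goedel k (e 0))" by (intro dfn)
  define Z where "Z x = unlisted k x (lam x (goedel k))" for x
  have Z: "p \<epsilon> Z x \<longleftrightarrow> p \<epsilon> cart k k \<and> \<not> (\<exists>y. y \<epsilon> x \<and> p = goedel k y)" for p x
    unfolding Z_def mem_unlisted using app_lam[OF T] by metis
  have goedel: "goedel k x = opair (goedel_fst (Z x)) (goedel_snd (Z x))" if "ord x" for x
    unfolding Z_def goedel_def by (rule ordrec_unfold[OF _ that]) (intro dfn)
  have 1: "goedel k x \<epsilon> Z x \<and> goedel k x \<epsilon> cart (succ d) (succ d)" if x: "x \<epsilon> k" for x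
  proof -
    have "opair a b \<epsilon> Z x" unfolding Z using ab n ord_trans[OF ordk x] by (metis opair_mem_cart)
    moreover have "ord a' \<and> ord b'" if "opair a' b' \<epsilon> Z x" for a' b'
      using that ord_mem[OF ordk] unfolding Z by simp
    moreover have "a \<epsilon> succ d" "b \<epsilon> succ d" using mem_succ_ord ordd d by blast+
    ultimately show ?thesis unfolding goedel[OF ord_mem[OF ordk x]]
      using gsel[of "Z x" a b d] ordd(1) by simp
  qed
  have "psurj (cart (succ d) (succ d)) k"
  proof (rule psurjI[of "\<lambda>p x. x \<epsilon> k \<and> p = goedel k x"])
    show "x = y" if "x \<epsilon> k \<and> p = goedel k x" "y \<epsilon> k \<and> p = goedel k y" for p x y
      using ord_linear[of x y] ord_mem[OF ordk] 1 that unfolding Z by metis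
    show "\<exists>p. p \<epsilon> cart (succ d) (succ d) \<and> x \<epsilon> k \<and> p = goedel k x" if "x \<epsilon> k" for x
      using 1 that by blast
  qed (intro dfn)
  moreover have "omega \<sqsubseteq> succ d"
  proof (rule ccontr)
    assume "\<not> omega \<sqsubseteq> succ d"
    then have "Fin (succ d)" using omega_le_or_mem[of "succ d"] ordd Fin_omega by auto
    then have "Fin k" using \<open>psurj (cart (succ d) (succ d)) k\<close> Fin_cart Fin_psurj by blast
    then show False using k not_Fin_omega_le unfolding initial_def by blast
  qed
  ultimately have "psurj (succ d) k" using IH[OF sd] psurj_trans by blast
  then show False using k sd unfolding initial_def by blast
qed

text \<open>Hessenberg's theorem, by induction. An initial \<open>k\<close> is handled by the
  listing \<open>goedel\<close>; any other \<open>k\<close> is an image of a smaller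
  \<open>c\<close>, and the map is routed through \<open>cart c c\<close>.\<close>

lemma psurj_square: assumes "ord k" "omega \<sqsubseteq> k" shows "psurj k (cart k k)"
proof -
  have "omega \<sqsubseteq> k \<longrightarrow> psurj k (cart k k)"
  proof (rule ord_induct[OF _ assms(1)])
    show "dfn (\<lambda>e. omega \<sqsubseteq> e 0 \<longrightarrow> psurj (e 0) (cart (e 0) (e 0)))" by (intro dfn)
    fix k assume k: "ord k" and IH: "\<And>d. d \<epsilon> k \<Longrightarrow> omega \<sqsubseteq> d \<longrightarrow> psurj d (cart d d)"
    show "omega \<sqsubseteq> k \<longrightarrow> psurj k (cart k k)"
    proof
      assume omk: "omega \<sqsubseteq> k"
      show "psurj k (cart k k)"
      proof (cases "\<exists>c. c \<epsilon> k \<and> psurj c k")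
        case True
        then obtain c where c: "c \<epsilon> k" "psurj c k" by blast
        have "omega \<sqsubseteq> c"
          using omega_le_or_mem[OF ord_mem[OF k c(1)]] Fin_omega Fin_psurj[OF _ c(2)] not_Fin_omega_le[OF omk] by blast
        then have "psurj c (cart c c)" using IH c by blast
        moreover have "psurj k c" using psurj_of_sub ord_sub[OF k c(1)] by blast
        ultimately show ?thesis using psurj_cart[OF c(2) c(2)] psurj_trans by meson
      next
        case False
        then have i: "initial k" using k omk unfolding initial_def by blast
        show ?thesis
        proof (rule psurj_fun[of "goedel k"])
          show "\<exists>a. a \<epsilon> k \<and> b = goedel k a" if "b \<epsilon> cart k k" for b
            using that goedel_onto_aux[OF i] IH unfolding mem_cart by metis
        qed (intro dfn)
      qed
    qed
  qed
  then show ?thesis using assms(2) by blast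
qed

lemma goedel_onto:
  assumes "initial k" "a \<epsilon> k" "b \<epsilon> k" shows "\<exists>x. x \<epsilon> k \<and> goedel k x = opair a b"
proof (rule goedel_onto_aux[OF assms(1) _ assms(2,3)])
  show "psurj d (cart d d)" if "d \<epsilon> k" "omega \<sqsubseteq> d" for d
    using assms(1) that psurj_square ord_mem unfolding initial_def by blast
qed

lemma initial_cart: assumes k: "initial k" and m: "m \<epsilon> k" "n \<epsilon> k" shows "\<not> psurj (cart m n) k"
proof
  assume p: "psurj (cart m n) k"
  have ordk: "ord k" and nF: "\<not> Fin k" using k not_Fin_omega_le unfolding initial_def by blast+
  obtain d where d: "d \<epsilon> k" "m \<sqsubseteq> d" "n \<sqsubseteq> d" using ord_max[OF ordk m] by blast
  have dk: "psurj (cart d d) k"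
    using psurj_trans[OF psurj_cart[OF psurj_of_sub[OF d(2)] psurj_of_sub[OF d(3)]] p] .
  have od: "ord d" using ord_mem[OF ordk d(1)] .
  have "omega \<sqsubseteq> d"
    using omega_le_or_mem[OF od] Fin_omega Fin_cart[of d d] Fin_psurj[OF _ dk] nF by blast
  then have "psurj d k" using psurj_trans[OF psurj_square[OF od] dk] by blast
  then show False using k d(1) unfolding initial_def by blast
qed

text \<open>All three factors lie below a common infinite \<open>c\<close> in \<open>k\<close>,
  whose cube is an image of \<open>c\<close>. For the factor \<open>omega\<close> this requires
  \<open>k\<close> to be uncountable.\<close>

lemma initial_cart3:
  assumes k: "initial k" "omega \<epsilon> k" and m: "m \<epsilon> k" "n \<epsilon> k"
  shows "\<not> psurj (cart omega (cart m n)) k"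
proof
  assume p: "psurj (cart omega (cart m n)) k"
  have ordk: "ord k" using k unfolding initial_def by blast
  obtain d where d: "d \<epsilon> k" "m \<sqsubseteq> d" "n \<sqsubseteq> d" using ord_max[OF ordk m] by blast
  obtain c where c: "c \<epsilon> k" "omega \<sqsubseteq> c" "d \<sqsubseteq> c" using ord_max[OF ordk k(2) d(1)] by blast
  have oc: "ord c" using ord_mem[OF ordk c(1)] .
  have "psurj (cart c (cart c c)) (cart omega (cart m n))"
    by (intro psurj_cart psurj_of_sub c(2) sub_trans[OF d(2) c(3)] sub_trans[OF d(3) c(3)])
  moreover have s: "psurj c (cart c c)" using psurj_square[OF oc c(2)] .
  moreover have "psurj (cart c c) (cart c (cart c c))" using psurj_cart[OF psurj_refl s] .
  ultimately have "psurj c k" using p psurj_trans by meson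
  then show False using k c(1) unfolding initial_def by blast
qed

end

subsection \<open>Mapping \<open>M\<close> onto \<open>\<omega>\<close>\<close>

locale infinite_powerset_surjection = ZF_model mem
  for mem :: "'a \<Rightarrow> 'a \<Rightarrow> bool"  (infix "\<epsilon>" 50) +
  fixes M :: 'a and F :: "'a \<Rightarrow> 'a \<Rightarrow> 'a"
  assumes tdfn_F: "tdfn (\<lambda>e. F (e 0) (e (Suc 0)))"
    and M_infinite: "\<not> Fin M"
    and F_onto: "\<And>B. B \<sqsubseteq> M \<Longrightarrow> \<not> Fin B \<Longrightarrow> \<exists>n x. n \<epsilon> omega \<and> x \<epsilon> M \<and> F n x = B"
begin

lemmas [dfn] = tdfn_subst2[OF tdfn_F]

text \<open>The range of \<open>H\<close> is an unbounded subset of \<open>omega\<close>, hence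
  infinite, so its order type is \<open>omega\<close>; collapsing it finishes the map.\<close>

lemma psurj_omega_of_unbounded:
  assumes H: "tdfn (\<lambda>e. H (e 0))" and "\<And>x. x \<epsilon> X \<Longrightarrow> H x \<epsilon> omega"
    and unb: "\<And>N. N \<epsilon> omega \<Longrightarrow> \<exists>x. x \<epsilon> X \<and> N \<sqsubseteq> H x"
  shows "psurj X omega"
proof -
  define S where "S = repl X H"
  have S: "z \<epsilon> S \<longleftrightarrow> (\<exists>x. x \<epsilon> X \<and> z = H x)" for z unfolding S_def by (rule mem_repl[OF H])
  have Som: "S \<sqsubseteq> omega" using assms(2) S by (auto simp: subset_of_def)
  then have oS: "\<And>s. s \<epsilon> S \<Longrightarrow> ord s" using omega_ord subD by blast
  have "otype S = omega"
  proof (rule ccontr)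
    assume "otype S \<noteq> omega"
    then have "otype S \<epsilon> omega"
      using otype_sub[OF ord_omega Som] ord_sub_iff[OF ord_otype[OF oS] ord_omega] by blast
    then have "Fin S" using psurj_otype[OF oS] Fin_def by blast
    then obtain m where m: "m \<epsilon> omega" "\<And>v. v \<epsilon> S \<Longrightarrow> v \<epsilon> omega \<Longrightarrow> v \<epsilon> m" using Fin_omega_bound by blast
    obtain x where x: "x \<epsilon> X" "m \<sqsubseteq> H x" using unb[OF m(1)] by blast
    then have "H x \<epsilon> m" using m(2) S assms(2) by blast
    then show False using x(2) subD no_mem_self by metis
  qed
  moreover have "psurj X S" by (rule psurj_fun[OF H]) (simp add: S)
  ultimately show ?thesis using psurj_to_otype[of S] psurj_trans by metis
qed

lemma large_Fin_subset: assumes "N \<epsilon> omega" shows "\<exists>E. E \<sqsubseteq> M \<and> Fin E \<and> \<not> psurj N E"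
proof (rule omega_induct[OF _ assms])
  show "dfn (\<lambda>e. \<exists>E. E \<sqsubseteq> M \<and> Fin E \<and> \<not> psurj (e 0) E)" by (intro dfn)
  have ne: "\<exists>x. x \<epsilon> M \<and> \<not> x \<epsilon> E" if "Fin E" for E
    using Fin_sub[OF that, of M] M_infinite unfolding subset_of_def by blast
  obtain x where x: "x \<epsilon> M" using ne[OF Fin_emp] by blast
  have "\<not> psurj emp (upair x x)" unfolding psurj_def by (auto simp: mem_emp)
  moreover have "upair x x = ins x emp" by (rule set_eqI) simp
  ultimately show "\<exists>E. E \<sqsubseteq> M \<and> Fin E \<and> \<not> psurj emp E"
    using Fin_ins[OF Fin_emp, of x] x by (intro exI[of _ "upair x x"]) (auto simp: subset_of_def)
  fix N assume N: "N \<epsilon> omega" "\<exists>E. E \<sqsubseteq> M \<and> Fin E \<and> \<not> psurj N E"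
  then obtain E where E: "E \<sqsubseteq> M" "Fin E" "\<not> psurj N E" by blast
  obtain x where x: "x \<epsilon> M" "\<not> x \<epsilon> E" using ne[OF E(2)] by blast
  have "\<not> psurj (succ N) (ins x E)"
  proof
    assume "psurj (succ N) (ins x E)"
    then obtain s where s: "\<And>a b b'. opair a b \<epsilon> s \<Longrightarrow> opair a b' \<epsilon> s \<Longrightarrow> b = b'"
      "\<And>b. b \<epsilon> ins x E \<Longrightarrow> \<exists>a. a \<epsilon> succ N \<and> opair a b \<epsilon> s"
      unfolding psurj_def by metis
    have "psurj N E"
    \<comment> \<open>Index \<open>N\<close> is removed by letting an index that \<open>s\<close>
      sends to the new point \<open>x\<close> take over the value at \<open>N\<close>.\<close>
    proof (rule psurjI[of "\<lambda>i b. opair i b \<epsilon> s \<or> opair i x \<epsilon> s \<and> opair N b \<epsilon> s"])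
      show "b = b'" if "b \<epsilon> E" "b' \<epsilon> E" "opair i b \<epsilon> s \<or> opair i x \<epsilon> s \<and> opair N b \<epsilon> s"
        "opair i b' \<epsilon> s \<or> opair i x \<epsilon> s \<and> opair N b' \<epsilon> s" for i b b'
        using that s(1) x(2) by metis
      obtain j where j: "j \<epsilon> succ N" "opair j x \<epsilon> s" using s(2)[of x] by auto
      show "\<exists>i. i \<epsilon> N \<and> (opair i b \<epsilon> s \<or> opair i x \<epsilon> s \<and> opair N b \<epsilon> s)" if b: "b \<epsilon> E" for b
      proof -
        obtain i where i: "i \<epsilon> succ N" "opair i b \<epsilon> s" using s(2)[of b] b by auto
        show ?thesis
        proof (cases "i = N")
          case True
          then have "j \<noteq> N" using i(2) j(2) s(1) b x(2) by metis
          then show ?thesis using j i(2) True by auto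
        qed (use i in auto)
      qed
    qed (intro dfn)
    then show False using E(3) by blast
  qed
  then show "\<exists>E. E \<sqsubseteq> M \<and> Fin E \<and> \<not> psurj (succ N) E"
    using Fin_ins[OF E(2), of x] E(1) x(1) by (intro exI[of _ "ins x E"]) (auto simp: subset_of_def)
qed

definition cofin_union where
  "cofin_union x = coll (\<lambda>y. y \<epsilon> M \<and> (\<exists>n. n \<epsilon> omega \<and> \<not> y \<epsilon> F n x \<and> Fin (dif M (F n x))))"

lemma tdfn_cofin_union: "tdfn (\<lambda>e. cofin_union (e 0))" unfolding cofin_union_def by (intro dfn)
lemmas [dfn] = tdfn_subst1[OF tdfn_cofin_union]

lemma mem_cofin_union:
  "y \<epsilon> cofin_union x \<longleftrightarrow> y \<epsilon> M \<and> (\<exists>n. n \<epsilon> omega \<and> \<not> y \<epsilon> F n x \<and> Fin (dif M (F n x)))"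
  unfolding cofin_union_def by (rule mem_coll_sub[of _ M]) (intro dfn, blast)

text \<open>Sending \<open>y\<close> to the first \<open>n\<close> at which a finite complement
  contains it has unbounded values on an infinite union, because finitely many finite complements
  have a finite union. This would map \<open>M\<close> onto \<open>omega\<close>.\<close>

lemma Fin_cofin_union:
  assumes "\<not> psurj M omega" shows "Fin (cofin_union x)"
proof (rule ccontr)
  assume nF: "\<not> Fin (cofin_union x)"
  define H where "H y = least_ord (\<lambda>n. n \<epsilon> omega \<and> \<not> y \<epsilon> F n x \<and> Fin (dif M (F n x)))" for y
  have TH: "tdfn (\<lambda>e. H (e 0))" unfolding H_def by (intro dfn)
  have H: "H y \<epsilon> omega \<and> \<not> y \<epsilon> F (H y) x \<and> Fin (dif M (F (H y) x))" if y: "y \<epsilon> cofin_union x" for y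
  proof -
    obtain n where n: "n \<epsilon> omega" "\<not> y \<epsilon> F n x \<and> Fin (dif M (F n x))" using y mem_cofin_union by blast
    have "dfn (\<lambda>e. e 0 \<epsilon> omega \<and> \<not> y \<epsilon> F (e 0) x \<and> Fin (dif M (F (e 0) x)))" by (intro dfn)
    from least_ord_props(2)[OF this omega_ord[OF n(1)], folded H_def] show ?thesis using n by blast
  qed
  have "psurj (cofin_union x) omega"
  proof (rule psurj_omega_of_unbounded[OF TH])
    show "H y \<epsilon> omega" if "y \<epsilon> cofin_union x" for y using H that by blast
    show "\<exists>y. y \<epsilon> cofin_union x \<and> N \<sqsubseteq> H y" if N: "N \<epsilon> omega" for N
    proof (rule ccontr)
      assume n: "\<not> ?thesis"
      \<comment> \<open>Infinite complements are replaced by \<open>emp\<close> so that every member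
        of the family is finite.\<close>
      define S where "S i = (if Fin (dif M (F i x)) then dif M (F i x) else emp)" for i
      have TS: "tdfn (\<lambda>e. S (e 0))" unfolding S_def by (intro dfn)
      obtain U where U: "Fin U" "\<And>i. i \<epsilon> N \<Longrightarrow> S i \<sqsubseteq> U"
        using Fin_family_bound[OF TS Fin_omega[OF N]] Fin_emp unfolding S_def by (metis (full_types))
      have "cofin_union x \<sqsubseteq> U"
      proof (rule subI)
        fix y assume y: "y \<epsilon> cofin_union x"
        then have "H y \<epsilon> N" using n H omega_ord N ord_not_mem by blast
        moreover have "y \<epsilon> S (H y)" using H[OF y] y mem_cofin_union unfolding S_def by simp
        ultimately show "y \<epsilon> U" using U(2) subD by blast
      qed
      then show False using nF U(1) Fin_sub by blast
    qed
  qed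
  moreover have "cofin_union x \<sqsubseteq> M" using mem_cofin_union by (simp add: subset_of_def)
  ultimately show False using assms psurj_sub sub_refl by metis
qed

text \<open>For finite \<open>E\<close> the set \<open>M - E\<close> is infinite, hence some
  \<open>F n x\<close>, so \<open>E\<close> lies in \<open>cofin_union x\<close>. As
  \<open>M\<close> has arbitrarily large finite subsets, the sizes \<open>sz x\<close> are unbounded
  and map \<open>M\<close> onto \<open>omega\<close> after all.\<close>

lemma psurj_M_omega: "psurj M omega"
proof (rule ccontr)
  assume no: "\<not> psurj M omega"
  define sz where "sz x = least_ord (\<lambda>n. n \<epsilon> omega \<and> psurj n (cofin_union x))" for x
  have T: "tdfn (\<lambda>e. sz (e 0))" unfolding sz_def by (intro dfn)
  have sz: "sz x \<epsilon> omega \<and> psurj (sz x) (cofin_union x)" for x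
  proof -
    obtain n where n: "n \<epsilon> omega" "psurj n (cofin_union x)" using Fin_cofin_union[OF no] Fin_def by blast
    have "dfn (\<lambda>e. e 0 \<epsilon> omega \<and> psurj (e 0) (cofin_union x))" by (intro dfn)
    from least_ord_props(2)[OF this omega_ord[OF n(1)], folded sz_def] show ?thesis using n by blast
  qed
  have "psurj M omega"
  proof (rule psurj_omega_of_unbounded[OF T])
    show "\<exists>x. x \<epsilon> M \<and> N \<sqsubseteq> sz x" if N: "N \<epsilon> omega" for N
    proof -
      obtain E where E: "E \<sqsubseteq> M" "Fin E" "\<not> psurj N E" using large_Fin_subset[OF N] by blast
      have dd: "dif M (dif M E) = E" by (rule set_eqI) (use E(1) in \<open>auto simp: subset_of_def\<close>)
      have "\<not> Fin (dif M E)"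
      proof
        assume "Fin (dif M E)"
        then have "Fin (cup E (dif M E))" using Fin_cup E(2) by blast
        then have "Fin M" by (rule Fin_sub) (auto simp: subset_of_def)
        then show False using M_infinite by blast
      qed
      moreover have "dif M E \<sqsubseteq> M" by (simp add: subset_of_def)
      ultimately obtain n x where nx: "n \<epsilon> omega" "x \<epsilon> M" "F n x = dif M E" using F_onto by blast
      have "E \<sqsubseteq> cofin_union x"
      proof (rule subI)
        fix y assume y: "y \<epsilon> E"
        have "\<not> y \<epsilon> F n x" "Fin (dif M (F n x))" unfolding nx(3) dd using y E(2) by auto
        then show "y \<epsilon> cofin_union x" unfolding mem_cofin_union using nx(1) y E(1) subD by blast
      qed
      then have "\<not> psurj N (cofin_union x)" using E(3) psurj_sub sub_refl by metis
      then have "\<not> sz x \<epsilon> N" using sz psurj_sub sub_refl ord_sub omega_ord N by metis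
      then show ?thesis using nx(2) sz ord_not_mem omega_ord N by blast
    qed
  qed (use sz in blast)
  then show False using no by blast
qed

subsection \<open>Mapping \<open>M\<close> onto an initial ordinal\<close>

text \<open>Only the values of \<open>app g\<close> on \<open>a\<close> matter, so the same
  \<open>g\<close> also serves every smaller ordinal, in particular the cardinal of
  \<open>a\<close>.\<close>

definition inf_seq where
  "inf_seq a g \<longleftrightarrow> (\<forall>x. x \<epsilon> a \<longrightarrow> app g x \<sqsubseteq> M \<and> \<not> Fin (app g x)) \<and>
     (\<forall>x y. x \<epsilon> a \<and> y \<epsilon> a \<and> app g x = app g y \<longrightarrow> x = y)"

text \<open>
  \<open>position k g n\<close> is the map \<open>p\<^sub>n\<close> of \<open>M\<close> to \<open>k\<close>, with value \<open>emp\<close> when \<open>F n x\<close> is not in the range of \<open>g\<close> on \<open>k\<close>.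
  A set \<open>X\<close> is big when \<open>extent k g X = k\<close>, and \<open>chain k g n\<close> is where the first \<open>n\<close> maps take their
  least big values.
\<close>

definition position where "position k g n x = the1 (\<lambda>z. z \<epsilon> k \<and> app g z = F n x)"
definition positions where "positions k g n X = repl X (position k g n)"
definition ptype where "ptype k g n X = otype (positions k g n X)"
definition extent where "extent k g X = unions (repl omega (\<lambda>n. ptype k g n X))"
definition fibre where "fibre k g n a X = coll (\<lambda>x. x \<epsilon> X \<and> position k g n x = a)"
definition least_big where "least_big k g n X = least_ord (\<lambda>a. a \<epsilon> k \<and> extent k g (fibre k g n a X) = k)"
definition chain where
  "chain k g n = ordrec (\<lambda>k g n h. coll (\<lambda>x. x \<epsilon> M \<and> (\<forall>j. j \<epsilon> n \<longrightarrow> position k g j x = least_big k g j (app h j)))) k g n"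
definition chain_value where "chain_value k g n = least_big k g n (chain k g n)"
text \<open>The points that leave the chain exactly at level \<open>n\<close>; these pieces are
  disjoint for different \<open>n\<close>.\<close>

definition off_chain where "off_chain k g n = coll (\<lambda>x. x \<epsilon> chain k g n \<and> position k g n x \<noteq> chain_value k g n)"
definition cumulative where "cumulative k g n = unions (repl (succ n) (\<lambda>i. ptype k g i M))"
definition stuck where
  "stuck k g n \<longleftrightarrow> n \<epsilon> omega \<and> \<not> (\<exists>a. a \<epsilon> k \<and> extent k g (fibre k g n a (chain k g n)) = k)"
definition fibre_family where
  "fibre_family k g n = repl k (\<lambda>a. opair (fibre k g n a (chain k g n)) (extent k g (fibre k g n a (chain k g n))))"
text \<open>A split-off piece may itself be big. Intersecting its extent with
  \<open>cumulative\<close> keeps the label below \<open>k\<close> when no single range has order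
  type \<open>k\<close>.\<close>

definition off_family where
  "off_family k g = repl omega (\<lambda>n. opair (off_chain k g n) (cap (extent k g (off_chain k g n)) (cumulative k g n)))"
text \<open>
  In a disjoint family \<open>A\<close> of pieces \<open>X\<close> labelled by ordinals \<open>t \<le> extent k g X\<close>, the piece \<open>X\<close> is mapped onto
  the supremum of the labels below \<open>t\<close>. That supremum is smaller than \<open>t\<close> for successive labels, hence
  reached by the image of \<open>X\<close> under a single \<open>p\<^sub>m\<close>.
\<close>

definition sup_below where
  "sup_below A t = coll (\<lambda>z. z \<epsilon> t \<and> (\<exists>X t'. opair X t' \<epsilon> A \<and> t' \<epsilon> t \<and> z \<epsilon> t'))"
definition level where "level k g A X t = least_ord (\<lambda>m. m \<epsilon> omega \<and> sup_below A t \<sqsubseteq> ptype k g m X)"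
definition select where
  "select k g A x z \<longleftrightarrow> (\<exists>X t. opair X t \<epsilon> A \<and> x \<epsilon> X \<and>
     z = collapse (positions k g (level k g A X t) X) (position k g (level k g A X t) x))"

lemma dfn_inf_seq: "dfn (\<lambda>e. inf_seq (e 0) (e (Suc 0)))" unfolding inf_seq_def by (intro dfn)
lemmas [dfn] = dfn_subst2[OF dfn_inf_seq]
lemma tdfn_position: "tdfn (\<lambda>e. position (e 0) (e (Suc 0)) (e (Suc (Suc 0))) (e (Suc (Suc (Suc 0)))))"
  unfolding position_def by (intro dfn)
lemmas [dfn] = tdfn_subst4[OF tdfn_position]
lemma tdfn_positions: "tdfn (\<lambda>e. positions (e 0) (e (Suc 0)) (e (Suc (Suc 0))) (e (Suc (Suc (Suc 0)))))"
  unfolding positions_def by (intro dfn)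
lemmas [dfn] = tdfn_subst4[OF tdfn_positions]
lemma tdfn_ptype: "tdfn (\<lambda>e. ptype (e 0) (e (Suc 0)) (e (Suc (Suc 0))) (e (Suc (Suc (Suc 0)))))"
  unfolding ptype_def by (intro dfn)
lemmas [dfn] = tdfn_subst4[OF tdfn_ptype]
lemma tdfn_extent: "tdfn (\<lambda>e. extent (e 0) (e (Suc 0)) (e (Suc (Suc 0))))"
  unfolding extent_def by (intro dfn)
lemmas [dfn] = tdfn_subst3[OF tdfn_extent]
lemma tdfn_fibre: "tdfn (\<lambda>e. fibre (e 0) (e (Suc 0)) (e (Suc (Suc 0))) (e (Suc (Suc (Suc 0)))) (e (Suc (Suc (Suc (Suc 0))))))"
  unfolding fibre_def by (intro dfn)
lemmas [dfn] = tdfn_subst5[OF tdfn_fibre]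
lemma tdfn_least_big: "tdfn (\<lambda>e. least_big (e 0) (e (Suc 0)) (e (Suc (Suc 0))) (e (Suc (Suc (Suc 0)))))"
  unfolding least_big_def by (intro dfn)
lemmas [dfn] = tdfn_subst4[OF tdfn_least_big]
lemma tdfn_chain: "tdfn (\<lambda>e. chain (e 0) (e (Suc 0)) (e (Suc (Suc 0))))"
  unfolding chain_def by (rule tdfn_ordrec) (intro dfn)
lemmas [dfn] = tdfn_subst3[OF tdfn_chain]
lemma tdfn_chain_value: "tdfn (\<lambda>e. chain_value (e 0) (e (Suc 0)) (e (Suc (Suc 0))))"
  unfolding chain_value_def by (intro dfn)
lemmas [dfn] = tdfn_subst3[OF tdfn_chain_value]
lemma tdfn_off_chain: "tdfn (\<lambda>e. off_chain (e 0) (e (Suc 0)) (e (Suc (Suc 0))))"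
  unfolding off_chain_def by (intro dfn)
lemmas [dfn] = tdfn_subst3[OF tdfn_off_chain]
lemma tdfn_cumulative: "tdfn (\<lambda>e. cumulative (e 0) (e (Suc 0)) (e (Suc (Suc 0))))"
  unfolding cumulative_def by (intro dfn)
lemmas [dfn] = tdfn_subst3[OF tdfn_cumulative]
lemma dfn_stuck: "dfn (\<lambda>e. stuck (e 0) (e (Suc 0)) (e (Suc (Suc 0))))"
  unfolding stuck_def by (intro dfn)
lemmas [dfn] = dfn_subst3[OF dfn_stuck]
lemma tdfn_fibre_family: "tdfn (\<lambda>e. fibre_family (e 0) (e (Suc 0)) (e (Suc (Suc 0))))"
  unfolding fibre_family_def by (intro dfn)
lemmas [dfn] = tdfn_subst3[OF tdfn_fibre_family]
lemma tdfn_off_family: "tdfn (\<lambda>e. off_family (e 0) (e (Suc 0)))"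
  unfolding off_family_def by (intro dfn)
lemmas [dfn] = tdfn_subst2[OF tdfn_off_family]
lemma tdfn_sup_below: "tdfn (\<lambda>e. sup_below (e 0) (e (Suc 0)))"
  unfolding sup_below_def by (intro dfn)
lemmas [dfn] = tdfn_subst2[OF tdfn_sup_below]
lemma tdfn_level: "tdfn (\<lambda>e. level (e 0) (e (Suc 0)) (e (Suc (Suc 0))) (e (Suc (Suc (Suc 0)))) (e (Suc (Suc (Suc (Suc 0))))))"
  unfolding level_def by (intro dfn)
lemmas [dfn] = tdfn_subst5[OF tdfn_level]
lemma dfn_select: "dfn (\<lambda>e. select (e 0) (e (Suc 0)) (e (Suc (Suc 0))) (e (Suc (Suc (Suc 0)))) (e (Suc (Suc (Suc (Suc 0))))))"
  unfolding select_def by (intro dfn)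
lemmas [dfn] = dfn_subst5[OF dfn_select]

lemma mem_positions: "z \<epsilon> positions k g n X \<longleftrightarrow> (\<exists>x. x \<epsilon> X \<and> z = position k g n x)"
  unfolding positions_def by (rule mem_repl) (intro dfn)

lemma mem_ptype: "z \<epsilon> ptype k g n X \<longleftrightarrow> (\<exists>x. x \<epsilon> X \<and> z = collapse (positions k g n X) (position k g n x))"
  unfolding ptype_def mem_otype mem_positions by blast

lemma mem_extent: "z \<epsilon> extent k g X \<longleftrightarrow> (\<exists>n. n \<epsilon> omega \<and> z \<epsilon> ptype k g n X)"
proof -
  have "tdfn (\<lambda>e. ptype k g (e 0) X)" by (intro dfn)
  from mem_repl[OF this] show ?thesis unfolding extent_def mem_unions by auto
qed

lemma mem_fibre: "x \<epsilon> fibre k g n a X \<longleftrightarrow> x \<epsilon> X \<and> position k g n x = a"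
  unfolding fibre_def by (rule mem_coll_sub[of _ X]) (intro dfn, blast)

lemma mem_chain:
  assumes "ord n"
  shows "x \<epsilon> chain k g n \<longleftrightarrow> x \<epsilon> M \<and> (\<forall>j. j \<epsilon> n \<longrightarrow> position k g j x = chain_value k g j)"
proof -
  define G where "G k g n h = coll (\<lambda>x. x \<epsilon> M \<and> (\<forall>j. j \<epsilon> n \<longrightarrow> position k g j x = least_big k g j (app h j)))" for k g n h
  have TG: "tdfn (\<lambda>e. G (e 0) (e (Suc 0)) (e (Suc (Suc 0))) (e (Suc (Suc (Suc 0)))))"
    unfolding G_def by (intro dfn)
  have "G = (\<lambda>k g n h. coll (\<lambda>x. x \<epsilon> M \<and> (\<forall>j. j \<epsilon> n \<longrightarrow> position k g j x = least_big k g j (app h j))))"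
    by (intro ext) (rule G_def)
  then have chain: "chain k g = ordrec G k g" by (intro ext) (simp only: chain_def)
  have T: "tdfn (\<lambda>e. ordrec G k g (e 0))"
    by (rule tdfn_subst3[OF tdfn_ordrec[OF TG]]) (intro dfn)+
  have "x \<epsilon> chain k g n \<longleftrightarrow> x \<epsilon> G k g n (lam n (chain k g))"
    unfolding chain using ordrec_unfold[OF TG assms] by simp
  also have "\<dots> \<longleftrightarrow> x \<epsilon> M \<and> (\<forall>j. j \<epsilon> n \<longrightarrow> position k g j x = least_big k g j (app (lam n (chain k g)) j))"
    unfolding G_def by (rule mem_coll_sub[of _ M]) (intro dfn, blast)
  also have "\<dots> \<longleftrightarrow> x \<epsilon> M \<and> (\<forall>j. j \<epsilon> n \<longrightarrow> position k g j x = chain_value k g j)"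
    unfolding chain_value_def chain using app_lam[OF T] by simp
  finally show ?thesis .
qed

lemma mem_off_chain: "x \<epsilon> off_chain k g n \<longleftrightarrow> x \<epsilon> chain k g n \<and> position k g n x \<noteq> chain_value k g n"
  unfolding off_chain_def by (rule mem_coll_sub[of _ "chain k g n"]) (intro dfn, blast)

lemma mem_cumulative: "z \<epsilon> cumulative k g n \<longleftrightarrow> (\<exists>i. i \<epsilon> succ n \<and> z \<epsilon> ptype k g i M)"
proof -
  have "tdfn (\<lambda>e. ptype k g (e 0) M)" by (intro dfn)
  from mem_repl[OF this] show ?thesis unfolding cumulative_def mem_unions by auto
qed

lemma mem_fibre_family:
  "p \<epsilon> fibre_family k g n \<longleftrightarrow> (\<exists>a. a \<epsilon> k \<and> p = opair (fibre k g n a (chain k g n)) (extent k g (fibre k g n a (chain k g n))))"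
  unfolding fibre_family_def by (rule mem_repl) (intro dfn)

lemma mem_off_family:
  "p \<epsilon> off_family k g \<longleftrightarrow> (\<exists>n. n \<epsilon> omega \<and> p = opair (off_chain k g n) (cap (extent k g (off_chain k g n)) (cumulative k g n)))"
  unfolding off_family_def by (rule mem_repl) (intro dfn)

lemma mem_sup_below: "z \<epsilon> sup_below A t \<longleftrightarrow> z \<epsilon> t \<and> (\<exists>X t'. opair X t' \<epsilon> A \<and> t' \<epsilon> t \<and> z \<epsilon> t')"
  unfolding sup_below_def by (rule mem_coll_sub[of _ t]) (intro dfn, blast)

section \<open>Big sets and disjoint families for a fixed initial ordinal\<close>

context
  fixes k g
  assumes k: "initial k" and g: "inf_seq k g"
begin

lemma k_facts: "ord k" "omega \<sqsubseteq> k" "emp \<epsilon> k"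
  using k emp_omega unfolding initial_def subset_of_def by blast+

lemma ord_in_k: "x \<epsilon> k \<Longrightarrow> ord x"
  using ord_mem k_facts by blast

lemma position_eqI: assumes "z \<epsilon> k" "app g z = F n x" shows "position k g n x = z"
proof -
  have "z' = z" if "z' \<epsilon> k \<and> app g z' = F n x" for z'
    using g assms that unfolding inf_seq_def by metis
  then show ?thesis unfolding position_def using assms by (intro the1_eq) blast+
qed

lemma position_mem: "position k g n x \<epsilon> k"
proof (cases "\<exists>z. z \<epsilon> k \<and> app g z = F n x")
  case True
  then show ?thesis using position_eqI by metis
next
  case False
  then have "position k g n x = emp" unfolding position_def by (intro the1_none) blast
  then show ?thesis using k_facts by simp
qed

text \<open>Surjectivity of \<open>F\<close> enters here: each \<open>app g z\<close> is an infinite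
  subset of \<open>M\<close>, so it is some \<open>F n x\<close>.\<close>

lemma position_onto: assumes "z \<epsilon> k" shows "\<exists>n x. n \<epsilon> omega \<and> x \<epsilon> M \<and> position k g n x = z"
proof -
  have "app g z \<sqsubseteq> M" "\<not> Fin (app g z)" using g assms unfolding inf_seq_def by blast+
  from F_onto[OF this] show ?thesis using position_eqI[OF assms] by metis
qed

lemma positions_sub: "positions k g n X \<sqsubseteq> k"
  using position_mem mem_positions by (metis subI)

lemma positions_ord: "z \<epsilon> positions k g n X \<Longrightarrow> ord z"
  using positions_sub subD ord_in_k by blast

lemma ptype_ord: "ord (ptype k g n X)"
  unfolding ptype_def using positions_ord by (rule ord_otype)

lemma ptype_sub: "ptype k g n X \<sqsubseteq> k"
  unfolding ptype_def using k_facts(1) positions_sub by (rule otype_sub)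

lemma extent_ord: "ord (extent k g X)"
proof (rule ordI)
  show "ord y" if "y \<epsilon> extent k g X" for y using that ord_mem[OF ptype_ord] mem_extent by metis
  show "z \<epsilon> extent k g X" if "y \<epsilon> extent k g X" "z \<epsilon> y" for y z using that ord_trans[OF ptype_ord] mem_extent by metis
qed

lemma extent_sub: "extent k g X \<sqsubseteq> k"
  by (rule subI) (metis mem_extent ptype_sub subD)

lemma collapse_positions_inj:
  "x \<epsilon> positions k g n X \<Longrightarrow> y \<epsilon> positions k g n X \<Longrightarrow> collapse (positions k g n X) x = collapse (positions k g n X) y \<Longrightarrow> x = y"
  using collapse_inj positions_ord by metis

text \<open>A counting argument with uniform bounds, valid for singular \<open>k\<close> too. An
  element of the extent of \<open>X\<close> comes from a level \<open>i\<close>, a piece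
  \<open>Y z\<close> and a point in it; the collapsed position \<open>c\<close> within that piece,
  together with \<open>i\<close> and \<open>z\<close>, recovers the position and thus the element.
  So \<open>omega\<close> times \<open>m\<close> times \<open>n\<close> would map onto
  \<open>k\<close>.\<close>

lemma small_union:
  assumes omega: "omega \<epsilon> k" and mn: "m \<epsilon> k" "n \<epsilon> k" and mZ: "psurj m Z"
    and Y: "tdfn (\<lambda>e. Y (e 0))" and cov: "\<And>x. x \<epsilon> X \<Longrightarrow> \<exists>z. z \<epsilon> Z \<and> x \<epsilon> Y z"
    and small: "\<And>z. z \<epsilon> Z \<Longrightarrow> extent k g (Y z) \<sqsubseteq> n"
  shows "extent k g X \<noteq> k"
proof
  assume big: "extent k g X = k"
  let ?R = "\<lambda>p r. \<exists>i z c s. p = opair i (opair z c) \<and> s \<epsilon> positions k g i (Y z) \<and> c = collapse (positions k g i (Y z)) s \<and> r = collapse (positions k g i X) s"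
  have "psurj (cart omega (cart Z n)) k"
  proof (rule psurjI[of ?R])
    show "dfn (\<lambda>e. ?R (e 0) (e (Suc 0)))" by (intro dfn tdfn_subst1[OF Y])
    show "r = r'" if R: "?R p r" "?R p r'" for p r r'
    proof -
      obtain i z c s where 1: "p = opair i (opair z c)" "s \<epsilon> positions k g i (Y z)" "c = collapse (positions k g i (Y z)) s" "r = collapse (positions k g i X) s"
        using R(1) by blast
      obtain i' z' c' s' where 2: "p = opair i' (opair z' c')" "s' \<epsilon> positions k g i' (Y z')" "c' = collapse (positions k g i' (Y z')) s'" "r' = collapse (positions k g i' X) s'"
        using R(2) by blast
      have eq: "i' = i" "z' = z" "c' = c" using 1(1) 2(1) by simp_all
      have "s' \<epsilon> positions k g i (Y z)" using 2(2) unfolding eq .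
      moreover have "collapse (positions k g i (Y z)) s = collapse (positions k g i (Y z)) s'"
        using 1(3) 2(3) unfolding eq by (rule subst)
      ultimately have "s = s'" by (rule collapse_positions_inj[OF 1(2)])
      then show ?thesis unfolding 1(4) 2(4) eq by simp
    qed
    show "\<exists>p. p \<epsilon> cart omega (cart Z n) \<and> ?R p r" if r: "r \<epsilon> k" for r
    proof -
      obtain i x where i: "i \<epsilon> omega" and x: "x \<epsilon> X" "r = collapse (positions k g i X) (position k g i x)"
        using r mem_extent[of r k g X] mem_ptype[of r k g _ X] unfolding big by blast
      obtain z where z: "z \<epsilon> Z" "x \<epsilon> Y z" using cov[OF x(1)] by blast
      let ?s = "position k g i x"
      have s: "?s \<epsilon> positions k g i (Y z)" using z(2) mem_positions by blast
      let ?c = "collapse (positions k g i (Y z)) ?s"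
      have "?c \<epsilon> extent k g (Y z)" using mem_extent i mem_ptype z(2) by blast
      then have "?c \<epsilon> n" using small[OF z(1)] subD by blast
      then have "opair i (opair z ?c) \<epsilon> cart omega (cart Z n)" using i z(1) by simp
      moreover have "?R (opair i (opair z ?c)) r" using s x(2) by blast
      ultimately show ?thesis by blast
    qed
  qed
  moreover have "psurj (cart omega (cart m n)) (cart omega (cart Z n))"
    by (intro psurj_cart mZ psurj_refl)
  ultimately have "psurj (cart omega (cart m n)) k" using psurj_trans by blast
  then show False using initial_cart3[OF k omega mn] by blast
qed

text \<open>Each \<open>r\<close> in \<open>k\<close> is a position at some level \<open>i\<close>
  and is determined by \<open>i\<close> and its collapsed value, which lies in the extent. A smaller
  extent would therefore make \<open>k\<close> an image of
  \<open>cart omega (extent k g M)\<close>.\<close>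

lemma M_big: assumes omega: "omega \<epsilon> k" shows "extent k g M = k"
proof (rule ccontr)
  assume "extent k g M \<noteq> k"
  then have tk: "extent k g M \<epsilon> k" using extent_sub extent_ord k_facts(1) ord_sub_iff by blast
  let ?R = "\<lambda>p r. \<exists>i c. p = opair i c \<and> r \<epsilon> positions k g i M \<and> c = collapse (positions k g i M) r"
  have "psurj (cart omega (extent k g M)) k"
  proof (rule psurjI[of ?R])
    show "dfn (\<lambda>e. ?R (e 0) (e (Suc 0)))" by (intro dfn)
    show "r = r'" if R: "?R p r" "?R p r'" for p r r'
      using R collapse_positions_inj by (metis opair_eq_iff)
    show "\<exists>p. p \<epsilon> cart omega (extent k g M) \<and> ?R p r" if r: "r \<epsilon> k" for r
    proof -
      obtain i x where i: "i \<epsilon> omega" "x \<epsilon> M" "position k g i x = r" using position_onto[OF r] by blast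
      let ?c = "collapse (positions k g i M) r"
      have r: "r \<epsilon> positions k g i M" using mem_positions i by blast
      have "?c \<epsilon> extent k g M" using mem_extent mem_ptype i by blast
      then have "opair i ?c \<epsilon> cart omega (extent k g M)" using i by simp
      then show ?thesis using r by blast
    qed
  qed
  then show False using initial_cart[OF k omega tk] by blast
qed

lemma select_onto:
  assumes A: "\<And>X t. opair X t \<epsilon> A \<Longrightarrow> t \<epsilon> k \<and> t \<sqsubseteq> extent k g X"
    and unb: "\<And>v. v \<epsilon> k \<Longrightarrow> \<exists>X t. opair X t \<epsilon> A \<and> v \<epsilon> t"
    and z: "z \<epsilon> k"
  shows "\<exists>X t x. opair X t \<epsilon> A \<and> x \<epsilon> X \<and> select k g A x z"
proof -
  obtain X1 t1 where 1: "opair X1 t1 \<epsilon> A" "z \<epsilon> t1" using unb[OF z] by blast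
  then have t1: "t1 \<epsilon> k" using A by blast
  \<comment> \<open>The label \<open>t2\<close> is the next one after \<open>t1\<close>, so
    \<open>sup_below A t2\<close> is exactly \<open>t1\<close>; it contains \<open>z\<close> and is
    an element of the extent of \<open>X2\<close>, hence of the order type at one level.\<close>
  define Q where "Q t \<longleftrightarrow> t1 \<epsilon> t \<and> (\<exists>X. opair X t \<epsilon> A)" for t
  have DQ: "dfn (\<lambda>e. Q (e 0))" unfolding Q_def by (intro dfn)
  obtain t where "t \<epsilon> k" "Q t" using unb[OF t1] A Q_def by blast
  then obtain t2 where t2: "ord t2" "Q t2" "\<And>t. t \<epsilon> t2 \<Longrightarrow> \<not> Q t"
    using ex_minimal[OF DQ ord_in_k] by blast
  obtain X2 where X2: "t1 \<epsilon> t2" "opair X2 t2 \<epsilon> A" using t2(2) Q_def by blast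
  have low: "sup_below A t2 = t1"
  proof (rule sub_antisym)
    show "sup_below A t2 \<sqsubseteq> t1"
    proof (rule subI)
      fix z assume "z \<epsilon> sup_below A t2"
      then obtain X t where t: "opair X t \<epsilon> A" "t \<epsilon> t2" "z \<epsilon> t" using mem_sup_below by blast
      then have "\<not> t1 \<epsilon> t" using t2(3) Q_def by blast
      then have "t \<sqsubseteq> t1" using ord_not_mem A t(1) t1 ord_in_k by blast
      then show "z \<epsilon> t1" using t(3) subD by blast
    qed
    show "t1 \<sqsubseteq> sup_below A t2"
      by (rule subI) (use 1 X2 ord_trans[OF t2(1)] mem_sup_below in blast)
  qed
  have "t1 \<epsilon> extent k g X2" using A[OF X2(2)] X2(1) subD by blast
  then obtain m where m: "m \<epsilon> omega" "t1 \<epsilon> ptype k g m X2" using mem_extent by blast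
  have "dfn (\<lambda>e. e 0 \<epsilon> omega \<and> sup_below A t2 \<sqsubseteq> ptype k g (e 0) X2)" by (intro dfn)
  from least_ord_props(2)[OF this omega_ord[OF m(1)], folded level_def]
  have "sup_below A t2 \<sqsubseteq> ptype k g (level k g A X2 t2) X2" using m ord_sub[OF ptype_ord] low by simp
  then have "z \<epsilon> ptype k g (level k g A X2 t2) X2" using 1(2) low subD by simp
  then obtain x where "x \<epsilon> X2" "z = collapse (positions k g (level k g A X2 t2) X2) (position k g (level k g A X2 t2) x)"
    using mem_ptype by blast
  then show ?thesis unfolding select_def using X2(2) by blast
qed

lemma chain_big:
  assumes omega: "omega \<epsilon> k" and n: "n \<epsilon> omega" and ns: "\<And>j. j \<epsilon> n \<Longrightarrow> \<not> stuck k g j"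
  shows "extent k g (chain k g n) = k"
proof -
  have "(\<forall>j. j \<epsilon> n \<longrightarrow> \<not> stuck k g j) \<longrightarrow> extent k g (chain k g n) = k"
  proof (rule omega_induct[OF _ n])
    show "dfn (\<lambda>e. (\<forall>j. j \<epsilon> e 0 \<longrightarrow> \<not> stuck k g j) \<longrightarrow> extent k g (chain k g (e 0)) = k)" by (intro dfn)
    have "chain k g emp = M" by (rule set_eqI) (simp add: mem_chain)
    then show "(\<forall>j. j \<epsilon> emp \<longrightarrow> \<not> stuck k g j) \<longrightarrow> extent k g (chain k g emp) = k" using M_big[OF omega] by simp
    fix n assume n: "n \<epsilon> omega"
    have "extent k g (chain k g (succ n)) = k" if ns: "\<not> stuck k g n"
    proof -
      have eq: "chain k g (succ n) = fibre k g n (chain_value k g n) (chain k g n)"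
        by (rule set_eqI) (auto simp: mem_chain mem_fibre omega_ord[OF n])
      obtain a where a: "a \<epsilon> k" "extent k g (fibre k g n a (chain k g n)) = k" using ns n stuck_def by blast
      have "dfn (\<lambda>e. e 0 \<epsilon> k \<and> extent k g (fibre k g n (e 0) (chain k g n)) = k)" by (intro dfn)
      from least_ord_props(2)[OF this ord_in_k[OF a(1)], folded least_big_def chain_value_def] show ?thesis using a eq by simp
    qed
    then show "(\<forall>j. j \<epsilon> succ n \<longrightarrow> \<not> stuck k g j) \<longrightarrow> extent k g (chain k g (succ n)) = k" by simp
  qed
  then show ?thesis using ns by blast
qed

text \<open>Being stuck puts every fibre extent below \<open>k\<close>. If all were bounded by
  \<open>v\<close>, the chain would be a union of small fibres indexed by a range of order type
  below \<open>k\<close>, against \<open>small_union\<close>.\<close>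

lemma fibre_family_props:
  assumes omega: "omega \<epsilon> k" and n: "stuck k g n" and big: "extent k g (chain k g n) = k" and ttn: "ptype k g n M \<noteq> k"
  shows "opair X t \<epsilon> fibre_family k g n \<Longrightarrow> t \<epsilon> k \<and> t \<sqsubseteq> extent k g X"
    and "v \<epsilon> k \<Longrightarrow> \<exists>X t. opair X t \<epsilon> fibre_family k g n \<and> v \<epsilon> t"
proof -
  assume "opair X t \<epsilon> fibre_family k g n"
  then obtain a where a: "a \<epsilon> k" "X = fibre k g n a (chain k g n)" "t = extent k g X" unfolding mem_fibre_family by auto
  have "extent k g X \<noteq> k" using n a(1) unfolding stuck_def a(2) by blast
  then have "extent k g X \<epsilon> k" using extent_sub[of X] ord_sub_iff[OF extent_ord k_facts(1)] by blast
  then show "t \<epsilon> k \<and> t \<sqsubseteq> extent k g X" unfolding a(3) by simp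
next
  assume v: "v \<epsilon> k"
  show "\<exists>X t. opair X t \<epsilon> fibre_family k g n \<and> v \<epsilon> t"
  proof (rule ccontr)
    assume no: "\<not> ?thesis"
    have small: "extent k g (fibre k g n a (chain k g n)) \<sqsubseteq> v" if "a \<epsilon> k" for a
      using no that ord_not_mem[OF ord_in_k[OF v] extent_ord] unfolding mem_fibre_family by blast
    have no1: "n \<epsilon> omega" using n stuck_def by blast
    have "chain k g n \<sqsubseteq> M" using mem_chain omega_ord[OF no1] by (auto simp: subset_of_def)
    then have sub: "positions k g n (chain k g n) \<sqsubseteq> positions k g n M" unfolding subset_of_def mem_positions by blast
    have mk: "ptype k g n M \<epsilon> k" using ttn ptype_sub ptype_ord k_facts(1) ord_sub_iff by blast
    have "psurj (ptype k g n M) (positions k g n M)" unfolding ptype_def using positions_ord by (rule psurj_otype)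
    then have ps: "psurj (ptype k g n M) (positions k g n (chain k g n))" using sub psurj_sub sub_refl by blast
    have "extent k g (chain k g n) \<noteq> k"
    proof (rule small_union[OF omega mk v ps])
      show "tdfn (\<lambda>e. fibre k g n (e 0) (chain k g n))" by (intro dfn)
      show "\<exists>z. z \<epsilon> positions k g n (chain k g n) \<and> x \<epsilon> fibre k g n z (chain k g n)" if "x \<epsilon> chain k g n" for x
        using that unfolding mem_positions mem_fibre by blast
      show "extent k g (fibre k g n z (chain k g n)) \<sqsubseteq> v" if "z \<epsilon> positions k g n (chain k g n)" for z
        using small[of z] that positions_sub subD by blast
    qed
    then show False using big by blast
  qed
qed

text \<open>A supremum of finitely many ordinals is the largest of them, so it stays below
  \<open>k\<close> whatever the cofinality of \<open>k\<close>.\<close>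

lemma cumulative_mem: assumes ptype: "\<And>i. i \<epsilon> omega \<Longrightarrow> ptype k g i M \<noteq> k" and n: "n \<epsilon> omega" shows "cumulative k g n \<epsilon> k"
proof (rule omega_induct[OF _ n])
  have ttk: "ptype k g i M \<epsilon> k" if "i \<epsilon> omega" for i
    using ptype[OF that] ptype_sub ptype_ord k_facts(1) ord_sub_iff by blast
  show "dfn (\<lambda>e. cumulative k g (e 0) \<epsilon> k)" by (intro dfn)
  have "cumulative k g emp = ptype k g emp M" by (rule set_eqI) (simp add: mem_cumulative)
  then show "cumulative k g emp \<epsilon> k" using ttk by simp
  fix n assume n: "n \<epsilon> omega" and IH: "cumulative k g n \<epsilon> k"
  have eq: "z \<epsilon> cumulative k g (succ n) \<longleftrightarrow> z \<epsilon> cumulative k g n \<or> z \<epsilon> ptype k g (succ n) M" for z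
    unfolding mem_cumulative mem_succ[of _ "succ n"] by blast
  have "cumulative k g n \<sqsubseteq> ptype k g (succ n) M \<or> ptype k g (succ n) M \<sqsubseteq> cumulative k g n"
    using ord_linear_sub[OF ord_in_k[OF IH] ptype_ord] .
  then have "cumulative k g (succ n) = ptype k g (succ n) M \<or> cumulative k g (succ n) = cumulative k g n"
    using eq subD set_eqI by metis
  then show "cumulative k g (succ n) \<epsilon> k" using IH ttk succ_omega[OF n] by metis
qed

text \<open>If no label exceeded \<open>v\<close>, then beyond some level \<open>K\<close> all
  split-off pieces would have extent at most \<open>v\<close>. These pieces and the points that
  never leave cover the chain at \<open>succ K\<close>, which \<open>small_union\<close> would make
  small, against \<open>chain_big\<close>.\<close>

lemma off_family_props:
  assumes omega: "omega \<epsilon> k" and ns: "\<And>j. \<not> stuck k g j" and ptype: "\<And>i. i \<epsilon> omega \<Longrightarrow> ptype k g i M \<noteq> k"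
  shows "opair X t \<epsilon> off_family k g \<Longrightarrow> t \<epsilon> k \<and> t \<sqsubseteq> extent k g X"
    and "v \<epsilon> k \<Longrightarrow> \<exists>X t. opair X t \<epsilon> off_family k g \<and> v \<epsilon> t"
proof -
  assume "opair X t \<epsilon> off_family k g"
  then obtain n where n: "n \<epsilon> omega" "X = off_chain k g n" "t = cap (extent k g X) (cumulative k g n)" unfolding mem_off_family by auto
  have b: "cumulative k g n \<epsilon> k" using cumulative_mem[OF ptype n(1)] .
  have sub: "t \<sqsubseteq> extent k g X" "t \<sqsubseteq> cumulative k g n" unfolding n(3) by (simp_all add: subset_of_def)
  have "ord t" unfolding n(3)
  proof (rule ordI)
    show "ord y" if "y \<epsilon> cap (extent k g X) (cumulative k g n)" for y
      using that ord_mem[OF extent_ord] by auto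
    show "z \<epsilon> cap (extent k g X) (cumulative k g n)"
      if "y \<epsilon> cap (extent k g X) (cumulative k g n)" "z \<epsilon> y" for y z
      using that ord_trans[OF extent_ord[of X], of y z] ord_trans[OF ord_in_k[OF b], of y z] by simp
  qed
  then show "t \<epsilon> k \<and> t \<sqsubseteq> extent k g X" using sub ord_sub_mem[OF _ k_facts(1) sub(2) b] by blast
next
  assume v: "v \<epsilon> k"
  show "\<exists>X t. opair X t \<epsilon> off_family k g \<and> v \<epsilon> t"
  proof (rule ccontr)
    assume no: "\<not> ?thesis"
    \<comment> \<open>Since \<open>M\<close> is big, \<open>v\<close> lies in the order type of some
      range. From \<open>K\<close> on the cap contains \<open>v\<close>, so a label not containing
      \<open>v\<close> bounds the extent itself.\<close>
    obtain K where K: "K \<epsilon> omega" "v \<epsilon> ptype k g K M" using v M_big[OF omega] mem_extent by metis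
    have small: "extent k g (off_chain k g n) \<sqsubseteq> v" if n: "n \<epsilon> omega" "K \<epsilon> n" for n
    proof -
      have "v \<epsilon> cumulative k g n" using K n mem_cumulative by auto
      then have "\<not> v \<epsilon> extent k g (off_chain k g n)" using no n(1) mem_off_family[of _ k g] mem_cap by metis
      then show ?thesis using ord_not_mem[OF ord_in_k[OF v] extent_ord] by blast
    qed
    define E where "E = coll (\<lambda>x. x \<epsilon> M \<and> (\<forall>j. j \<epsilon> omega \<longrightarrow> position k g j x = chain_value k g j))"
    have E: "x \<epsilon> E \<longleftrightarrow> x \<epsilon> M \<and> (\<forall>j. j \<epsilon> omega \<longrightarrow> position k g j x = chain_value k g j)" for x
      unfolding E_def by (rule mem_coll_sub[of _ M]) (intro dfn, blast)
    \<comment> \<open>Every position map is constant on \<open>E\<close>, so each order type is at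
      most one.\<close>
    have smallE: "extent k g E \<sqsubseteq> succ emp"
    proof (rule subI)
      fix z assume "z \<epsilon> extent k g E"
      then obtain n x where x: "n \<epsilon> omega" "x \<epsilon> E" "z = collapse (positions k g n E) (position k g n x)"
        unfolding mem_extent mem_ptype by blast
      have "y = position k g n x" if "y \<epsilon> positions k g n E" for y using that x(1,2) E unfolding mem_positions by metis
      then have "\<not> w \<epsilon> z" for w
        using mem_collapse[OF ord_in_k[OF position_mem[of n x]], of w "positions k g n E"] x(3) no_mem_self by metis
      then have "z = emp" using set_eqI mem_emp by metis
      then show "z \<epsilon> succ emp" by simp
    qed
    have "succ emp \<epsilon> k" using k_facts(2) subD succ_omega emp_omega by metis
    then obtain d where d: "d \<epsilon> k" "v \<sqsubseteq> d" "succ emp \<sqsubseteq> d" using ord_max[OF k_facts(1) v] by blast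
    \<comment> \<open>The family is indexed by all of \<open>omega\<close>; the indices up to
      \<open>K\<close> are free and are assigned the remainder \<open>E\<close>.\<close>
    define Y where "Y n = (if K \<epsilon> n then off_chain k g n else E)" for n
    have "extent k g (chain k g (succ K)) \<noteq> k"
    proof (rule small_union[OF omega omega d(1) psurj_refl])
      show "tdfn (\<lambda>e. Y (e 0))" unfolding Y_def by (intro dfn)
      show "extent k g (Y z) \<sqsubseteq> d" if "z \<epsilon> omega" for z
        using sub_trans[OF small[OF that] d(2)] sub_trans[OF smallE d(3)] unfolding Y_def by simp
      show "\<exists>n. n \<epsilon> omega \<and> x \<epsilon> Y n" if x: "x \<epsilon> chain k g (succ K)" for x
      proof (cases "x \<epsilon> E")
        case True
        then have "x \<epsilon> Y emp" unfolding Y_def by simp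
        then show ?thesis using emp_omega by blast
      next
        case False
        have oK: "ord K" using omega_ord K(1) by blast
        have xM: "x \<epsilon> M" and xK: "\<And>j. j \<epsilon> succ K \<Longrightarrow> position k g j x = chain_value k g j"
          using x mem_chain[OF ord_succ[OF oK]] by blast+
        \<comment> \<open>The first level at which \<open>x\<close> leaves the chain. It exceeds
          \<open>K\<close> because \<open>x\<close> agrees with the chain at all levels up to and
          including \<open>K\<close>.\<close>
        define Q where "Q j \<longleftrightarrow> j \<epsilon> omega \<and> position k g j x \<noteq> chain_value k g j" for j
        have "dfn (\<lambda>e. Q (e 0))" unfolding Q_def by (intro dfn)
        moreover obtain j where "Q j" "ord j" using False E xM omega_ord unfolding Q_def by blast
        ultimately obtain n where n: "ord n" "Q n" "\<And>i. i \<epsilon> n \<Longrightarrow> \<not> Q i" using ex_minimal by metis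
        have nom: "n \<epsilon> omega" using n(2) Q_def by blast
        have "\<not> n \<epsilon> succ K" using xK n(2) Q_def by blast
        then have "K \<epsilon> n" using ord_linear[OF n(1) oK] by auto
        moreover have "position k g i x = chain_value k g i" if "i \<epsilon> n" for i
          using n(3)[OF that] ord_trans[OF ord_omega nom that] Q_def by blast
        then have "x \<epsilon> off_chain k g n" unfolding mem_off_chain mem_chain[OF n(1)] using xM n(2) Q_def by blast
        ultimately have "x \<epsilon> Y n" unfolding Y_def by simp
        then show ?thesis using nom by blast
      qed
    qed
    then show False using chain_big[OF omega succ_omega[OF K(1)]] ns by blast
  qed
qed

lemma fibre_family_disjoint:
  assumes "opair X t \<epsilon> fibre_family k g n" "opair X' t' \<epsilon> fibre_family k g n" "x \<epsilon> X" "x \<epsilon> X'"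
  shows "X = X' \<and> t = t'"
  using assms unfolding mem_fibre_family opair_eq_iff by (metis mem_fibre)

text \<open>A point leaving at a later level still agrees with the chain at every earlier
  one.\<close>

lemma off_family_disjoint:
  assumes "opair X t \<epsilon> off_family k g" "opair X' t' \<epsilon> off_family k g" "x \<epsilon> X" "x \<epsilon> X'"
  shows "X = X' \<and> t = t'"
proof -
  obtain n where n: "n \<epsilon> omega" "X = off_chain k g n" "t = cap (extent k g X) (cumulative k g n)" using assms(1) unfolding mem_off_family by auto
  obtain m where m: "m \<epsilon> omega" "X' = off_chain k g m" "t' = cap (extent k g X') (cumulative k g m)" using assms(2) unfolding mem_off_family by auto
  have o: "ord n" "ord m" using n(1) m(1) omega_ord by blast+
  have "\<not> n \<epsilon> m" "\<not> m \<epsilon> n"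
    using assms(3,4) mem_chain[OF o(1)] mem_chain[OF o(2)] unfolding n(2) m(2) mem_off_chain by blast+
  then have "n = m" using ord_linear[OF o] by blast
  then show ?thesis using n m by simp
qed

lemma select_fun:
  assumes "\<And>X t X' t'. opair X t \<epsilon> A \<Longrightarrow> opair X' t' \<epsilon> A \<Longrightarrow> x \<epsilon> X \<Longrightarrow> x \<epsilon> X' \<Longrightarrow> X = X' \<and> t = t'"
    and "select k g A x z" "select k g A x z'"
  shows "z = z'"
  using assms unfolding select_def by metis

end

text \<open>A map of \<open>M\<close> onto \<open>omega\<close>, fixed once and for all.
  \<open>SOME\<close> merely names one parameter, so definability is unaffected.\<close>

definition omega_map where
  "omega_map = (SOME s. (\<forall>a b b'. opair a b \<epsilon> s \<and> opair a b' \<epsilon> s \<longrightarrow> b = b') \<and>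
     (\<forall>b. b \<epsilon> omega \<longrightarrow> (\<exists>a. a \<epsilon> M \<and> opair a b \<epsilon> s)))"

lemma omega_map: "(\<forall>a b b'. opair a b \<epsilon> omega_map \<and> opair a b' \<epsilon> omega_map \<longrightarrow> b = b') \<and>
     (\<forall>b. b \<epsilon> omega \<longrightarrow> (\<exists>a. a \<epsilon> M \<and> opair a b \<epsilon> omega_map))"
  unfolding omega_map_def using psurj_M_omega unfolding psurj_def by (rule someI_ex)

lemma omega_map_fun: "opair a b \<epsilon> omega_map \<Longrightarrow> opair a b' \<epsilon> omega_map \<Longrightarrow> b = b'"
  using omega_map by blast

lemma omega_map_onto: "b \<epsilon> omega \<Longrightarrow> \<exists>a. a \<epsilon> M \<and> opair a b \<epsilon> omega_map"
  using omega_map by blast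

section \<open>The map of \<open>M\<close> onto \<open>k\<close>, uniformly in \<open>k\<close> and
  \<open>g\<close>\<close>

definition full_level where "full_level k g = least_ord (\<lambda>n. n \<epsilon> omega \<and> ptype k g n M = k)"
definition stuck_level where "stuck_level k g = least_ord (\<lambda>n. stuck k g n)"

text \<open>The cases are joined in one definable relation because every stage of the final
  recursion uses it. The case \<open>k = omega\<close> stands apart: counting over all levels
  requires \<open>omega\<close> to be an element of \<open>k\<close>.\<close>

definition onto_rel where
  "onto_rel k g x z \<longleftrightarrow>
     k = omega \<and> opair x z \<epsilon> omega_map \<or>
     k \<noteq> omega \<and> (\<exists>n. n \<epsilon> omega \<and> ptype k g n M = k) \<and>
       z = collapse (positions k g (full_level k g) M) (position k g (full_level k g) x) \<or>
     k \<noteq> omega \<and> \<not> (\<exists>n. n \<epsilon> omega \<and> ptype k g n M = k) \<and> (\<exists>n. stuck k g n) \<and>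
       select k g (fibre_family k g (stuck_level k g)) x z \<or>
     k \<noteq> omega \<and> \<not> (\<exists>n. n \<epsilon> omega \<and> ptype k g n M = k) \<and> \<not> (\<exists>n. stuck k g n) \<and>
       select k g (off_family k g) x z"

lemma tdfn_full_level: "tdfn (\<lambda>e. full_level (e 0) (e (Suc 0)))" unfolding full_level_def by (intro dfn)
lemmas [dfn] = tdfn_subst2[OF tdfn_full_level]
lemma tdfn_stuck_level: "tdfn (\<lambda>e. stuck_level (e 0) (e (Suc 0)))" unfolding stuck_level_def by (intro dfn)
lemmas [dfn] = tdfn_subst2[OF tdfn_stuck_level]
lemma dfn_onto_rel: "dfn (\<lambda>e. onto_rel (e 0) (e (Suc 0)) (e (Suc (Suc 0))) (e (Suc (Suc (Suc 0)))))"
  unfolding onto_rel_def by (intro dfn)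
lemmas [dfn] = dfn_subst4[OF dfn_onto_rel]

lemma stuck_level: assumes "stuck k g n"
  shows "stuck k g (stuck_level k g)" "j \<epsilon> stuck_level k g \<Longrightarrow> \<not> stuck k g j"
proof -
  have D: "dfn (\<lambda>e. stuck k g (e 0))" by (intro dfn)
  have n: "ord n" using assms omega_ord unfolding stuck_def by blast
  show "stuck k g (stuck_level k g)" unfolding stuck_level_def by (rule least_ord_props(2)[OF D n assms])
  show "j \<epsilon> stuck_level k g \<Longrightarrow> \<not> stuck k g j"
    unfolding stuck_level_def by (rule least_ord_not_mem[OF D n assms])
qed

lemma onto_rel_fun:
  assumes k: "initial k" "inf_seq k g" and "onto_rel k g x z" "onto_rel k g x z'"
  shows "z = z'"
proof (cases "k = omega")
  case True
  then show ?thesis using assms(3,4) omega_map_fun unfolding onto_rel_def by blast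
next
  case False
  show ?thesis
  proof (cases "\<exists>n. n \<epsilon> omega \<and> ptype k g n M = k")
    case True
    with False show ?thesis using assms(3,4) unfolding onto_rel_def by simp
  next
    case n: False
    show ?thesis
    proof (cases "\<exists>n. stuck k g n")
      case True
      then have s: "select k g (fibre_family k g (stuck_level k g)) x z"
        "select k g (fibre_family k g (stuck_level k g)) x z'"
        using assms(3,4) False n unfolding onto_rel_def by blast+
      show ?thesis by (rule select_fun[OF k fibre_family_disjoint[OF k] s])
    next
      case ns: False
      then have s: "select k g (off_family k g) x z" "select k g (off_family k g) x z'"
        using assms(3,4) False n unfolding onto_rel_def by blast+
      show ?thesis by (rule select_fun[OF k off_family_disjoint[OF k] s])
    qed
  qed
qed

lemma onto_rel_onto:
  assumes k: "initial k" "inf_seq k g" and z: "z \<epsilon> k"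
  shows "\<exists>x. x \<epsilon> M \<and> onto_rel k g x z"
proof (cases "k = omega")
  case True
  then show ?thesis using omega_map_onto z unfolding onto_rel_def by blast
next
  case kom: False
  have omega: "omega \<epsilon> k" using k(1) kom ord_sub_iff[OF ord_omega] unfolding initial_def by metis
  show ?thesis
  proof (cases "\<exists>n. n \<epsilon> omega \<and> ptype k g n M = k")
    case True
    then obtain n where n: "n \<epsilon> omega" "ptype k g n M = k" by blast
    have "dfn (\<lambda>e. e 0 \<epsilon> omega \<and> ptype k g (e 0) M = k)" by (intro dfn)
    from least_ord_props(2)[OF this omega_ord[OF n(1)], folded full_level_def]
    have "z \<epsilon> ptype k g (full_level k g) M" using n z by simp
    then show ?thesis using True kom unfolding onto_rel_def mem_ptype by blast
  next
    case nf: False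
    show ?thesis
    proof (cases "\<exists>n. stuck k g n")
      case True
      then obtain n where "stuck k g n" by blast
      note n = stuck_level[OF this]
      have nom: "stuck_level k g \<epsilon> omega" using n(1) stuck_def by blast
      have big: "extent k g (chain k g (stuck_level k g)) = k"
        by (rule chain_big[OF k omega nom n(2)])
      have pt: "ptype k g (stuck_level k g) M \<noteq> k" using nf nom by blast
      obtain X t x where x: "opair X t \<epsilon> fibre_family k g (stuck_level k g)" "x \<epsilon> X"
        "select k g (fibre_family k g (stuck_level k g)) x z"
        using select_onto[OF k fibre_family_props[OF k omega n(1) big pt] z] by blast
      have "x \<epsilon> M" using x(1,2) mem_chain[OF omega_ord[OF nom]] unfolding mem_fibre_family opair_eq_iff by (auto simp: mem_fibre)
      then show ?thesis using True kom nf x(3) unfolding onto_rel_def by blast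
    next
      case ns: False
      then have ns': "\<not> stuck k g j" for j by blast
      have nf': "ptype k g i M \<noteq> k" if "i \<epsilon> omega" for i using nf that by blast
      obtain X t x where x: "opair X t \<epsilon> off_family k g" "x \<epsilon> X" "select k g (off_family k g) x z"
        using select_onto[OF k off_family_props[OF k omega ns' nf'] z] by blast
      have "x \<epsilon> M" using x(1,2) mem_chain[OF omega_ord] unfolding mem_off_family opair_eq_iff by (auto simp: mem_off_chain)
      then show ?thesis using ns kom nf x(3) unfolding onto_rel_def by blast
    qed
  qed
qed

subsection \<open>Coding by infinite subsets of \<open>M\<close>\<close>

text \<open>A point of \<open>M\<close> codes a triple over \<open>k\<close>: its image under the
  map onto \<open>k\<close> is unpacked twice by \<open>goedel k\<close>. A subset of
  \<open>M\<close> thereby codes a ternary relation.\<close>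

definition triple where
  "triple k g x i j l \<longleftrightarrow> (\<exists>a b. onto_rel k g x a \<and> goedel k a = opair i b \<and> goedel k b = opair j l)"

lemma dfn_triple: "dfn (\<lambda>e. triple (e 0) (e (Suc 0)) (e (Suc (Suc 0))) (e (Suc (Suc (Suc 0))))
    (e (Suc (Suc (Suc (Suc 0))))) (e (Suc (Suc (Suc (Suc (Suc 0)))))))"
  unfolding triple_def by (intro dfn)
lemmas [dfn] = dfn_subst6[OF dfn_triple]

lemma triple_fun:
  assumes k: "initial k" "inf_seq k g" and "triple k g x i j l" "triple k g x i' j' l'"
  shows "i = i' \<and> j = j' \<and> l = l'"
proof -
  obtain a b where 1: "onto_rel k g x a" "goedel k a = opair i b" "goedel k b = opair j l"
    using assms(3) triple_def by blast
  obtain a' b' where 2: "onto_rel k g x a'" "goedel k a' = opair i' b'" "goedel k b' = opair j' l'"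
    using assms(4) triple_def by blast
  have "a = a'" using onto_rel_fun[OF k 1(1) 2(1)] .
  then have "opair i b = opair i' b'" using 1(2) 2(2) by simp
  then have "i = i'" "b = b'" by simp_all
  then have "opair j l = opair j' l'" using 1(3) 2(3) by simp
  then show ?thesis using \<open>i = i'\<close> by simp
qed

lemma triple_onto:
  assumes k: "initial k" "inf_seq k g" and "i \<epsilon> k" "j \<epsilon> k" "l \<epsilon> k"
  shows "\<exists>x. x \<epsilon> M \<and> triple k g x i j l"
proof -
  obtain b where b: "b \<epsilon> k" "goedel k b = opair j l" using goedel_onto[OF k(1) assms(4,5)] by blast
  obtain a where a: "a \<epsilon> k" "goedel k a = opair i b" using goedel_onto[OF k(1) assms(3) b(1)] by blast
  obtain x where "x \<epsilon> M" "onto_rel k g x a" using onto_rel_onto[OF k a(1)] by blast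
  then show ?thesis using a b triple_def by blast
qed

definition decode where
  "decode k g D i j l \<longleftrightarrow> (\<exists>x. x \<epsilon> D \<and> triple k g x i j l)"

lemma dfn_decode: "dfn (\<lambda>e. decode (e 0) (e (Suc 0)) (e (Suc (Suc 0))) (e (Suc (Suc (Suc 0))))
    (e (Suc (Suc (Suc (Suc 0))))) (e (Suc (Suc (Suc (Suc (Suc 0)))))))"
  unfolding decode_def by (intro dfn)
lemmas [dfn] = dfn_subst6[OF dfn_decode]

section \<open>Enumerations of an ordinal along its cardinal\<close>

definition enum where
  "enum k a e \<longleftrightarrow> (\<forall>j. j \<epsilon> k \<longrightarrow> app e j \<epsilon> a) \<and> (\<forall>x. x \<epsilon> a \<longrightarrow> (\<exists>j. j \<epsilon> k \<and> app e j = x))"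

lemma dfn_enum: "dfn (\<lambda>e. enum (e 0) (e (Suc 0)) (e (Suc (Suc 0))))"
  unfolding enum_def by (intro dfn)
lemmas [dfn] = dfn_subst3[OF dfn_enum]

text \<open>The values fill the ordinal \<open>a\<close>, so \<open>app e j\<close> is the set of
  the values \<open>app e i\<close> below it. The order pattern tells which \<open>i\<close> these
  are, and induction on the value identifies the two enumerations.\<close>

lemma enum_unique:
  assumes a: "ord a" and e: "enum k a e" "enum k a e'"
    and eq: "\<And>i l. i \<epsilon> k \<Longrightarrow> l \<epsilon> k \<Longrightarrow> app e i \<sqsubseteq> app e l \<longleftrightarrow> app e' i \<sqsubseteq> app e' l"
    and j: "j \<epsilon> k"
  shows "app e j = app e' j"
proof -
  have mem: "app e i \<epsilon> a" "app e' i \<epsilon> a" if "i \<epsilon> k" for i using e that unfolding enum_def by blast+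
  have onto: "\<exists>i. i \<epsilon> k \<and> app e i = x" "\<exists>i. i \<epsilon> k \<and> app e' i = x" if "x \<epsilon> a" for x
    using e that unfolding enum_def by blast+
  have less: "app e i \<epsilon> app e l \<longleftrightarrow> app e' i \<epsilon> app e' l" if "i \<epsilon> k" "l \<epsilon> k" for i l
    using eq[OF that(2,1)] ord_not_mem ord_mem[OF a] mem that by meson
  define P where "P x \<longleftrightarrow> (\<forall>j. j \<epsilon> k \<and> app e j = x \<longrightarrow> app e' j = x)" for x
  have "P (app e j)"
  proof (rule ord_induct[OF _ ord_mem[OF a mem(1)[OF j]]])
    show "dfn (\<lambda>e. P (e 0))" unfolding P_def by (intro dfn)
    fix x assume IH: "\<And>z. z \<epsilon> x \<Longrightarrow> P z"
    have "app e' j = app e j" if j: "j \<epsilon> k" and x: "app e j = x" for j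
    proof (rule set_eqI)
      fix z show "z \<epsilon> app e' j \<longleftrightarrow> z \<epsilon> app e j"
      proof
        assume z: "z \<epsilon> app e' j"
        obtain i where i: "i \<epsilon> k" "app e' i = z" using onto(2) ord_trans[OF a mem(2)[OF j] z] by blast
        then have "app e i \<epsilon> app e j" using less[OF i(1) j] z by simp
        then show "z \<epsilon> app e j" using IH[of "app e i"] i x unfolding P_def by auto
      next
        assume z: "z \<epsilon> app e j"
        obtain i where i: "i \<epsilon> k" "app e i = z" using onto(1) ord_trans[OF a mem(1)[OF j] z] by blast
        then have "app e' i \<epsilon> app e' j" using less[OF i(1) j] z by simp
        then show "z \<epsilon> app e' j" using IH[of z] z i x unfolding P_def by auto
      qed
    qed
    then show "P x" unfolding P_def by blast
  qed
  then show ?thesis using j P_def by simp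
qed

definition card_of where "card_of a = least_ord (\<lambda>k. psurj k a)"

lemma tdfn_card_of: "tdfn (\<lambda>e. card_of (e 0))" unfolding card_of_def by (intro dfn)
lemmas [dfn] = tdfn_subst1[OF tdfn_card_of]

lemma card_of:
  assumes "ord a" "omega \<sqsubseteq> a"
  shows "initial (card_of a)" "card_of a \<sqsubseteq> a" "psurj (card_of a) a"
proof -
  have D: "dfn (\<lambda>e. psurj (e 0) a)" by (intro dfn)
  note l = least_ord_props[OF D assms(1) psurj_refl, folded card_of_def]
  show "psurj (card_of a) a" by (rule l(2))
  show le: "card_of a \<sqsubseteq> a" by (rule l(3)[OF assms(1) psurj_refl])
  have "omega \<sqsubseteq> card_of a"
    using omega_le_or_mem[OF l(1)] Fin_omega Fin_psurj[OF _ l(2)] not_Fin_omega_le[OF assms(2)] by blast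
  moreover have "\<not> psurj d (card_of a)" if d: "d \<epsilon> card_of a" for d
  proof
    assume "psurj d (card_of a)"
    then have "psurj d a" using psurj_trans[OF _ l(2)] by blast
    then have "card_of a \<sqsubseteq> d" using l(3) ord_mem[OF l(1) d] by blast
    then show False using d subD no_mem_self by blast
  qed
  ultimately show "initial (card_of a)" unfolding initial_def using l(1) by blast
qed

abbreviation one where "one \<equiv> succ emp"
abbreviation two where "two \<equiv> succ one"

lemma one_two: "one \<noteq> emp" "two \<noteq> emp" "one \<noteq> two"
  by (metis mem_succ mem_emp no_mem_self)+

text \<open>
  The code of \<open>x\<close> contains \<open>(emp, i, l)\<close> if and only if \<open>e i \<le> e l\<close>, which determines the enumeration \<open>e\<close>, and
  for the given \<open>n\<close> exactly one triple \<open>(b, n, j)\<close> with \<open>b\<close> in \<open>{one, two}\<close>; then \<open>x\<close> is sent to \<open>e j\<close> in copy \<open>b\<close> of \<open>a\<close>.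
\<close>

definition hit where
  "hit a g n x b z \<longleftrightarrow> x \<epsilon> M \<and> (b = one \<or> b = two) \<and> (\<exists>e j. enum (card_of a) a e \<and>
     (\<forall>i l. i \<epsilon> card_of a \<and> l \<epsilon> card_of a \<longrightarrow>
        (decode (card_of a) g (F n x) emp i l \<longleftrightarrow> app e i \<sqsubseteq> app e l)) \<and>
     j \<epsilon> card_of a \<and> app e j = z \<and>
     (\<forall>b' j'. (b' = one \<or> b' = two) \<and> j' \<epsilon> card_of a \<longrightarrow>
        (decode (card_of a) g (F n x) b' n j' \<longleftrightarrow> b' = b \<and> j' = j)))"

lemma dfn_hit: "dfn (\<lambda>e. hit (e 0) (e (Suc 0)) (e (Suc (Suc 0))) (e (Suc (Suc (Suc 0))))
    (e (Suc (Suc (Suc (Suc 0))))) (e (Suc (Suc (Suc (Suc (Suc 0)))))))"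
  unfolding hit_def by (intro dfn)
lemmas [dfn] = dfn_subst6[OF dfn_hit]

text \<open>The triples tagged \<open>emp\<close> fix the enumeration by \<open>enum_unique\<close>;
  uniqueness of the other tagged triple fixes the copy and the index.\<close>

lemma hit_fun:
  assumes a: "ord a" and h: "hit a g n x b z" "hit a g n x b' z'"
  shows "b = b' \<and> z = z'"
proof -
  let ?k = "card_of a"
  obtain e j where 1: "b = one \<or> b = two" "enum ?k a e"
    "\<And>i l. i \<epsilon> ?k \<Longrightarrow> l \<epsilon> ?k \<Longrightarrow> decode ?k g (F n x) emp i l \<longleftrightarrow> app e i \<sqsubseteq> app e l"
    "j \<epsilon> ?k" "app e j = z"
    "\<And>b' j'. b' = one \<or> b' = two \<Longrightarrow> j' \<epsilon> ?k \<Longrightarrow> decode ?k g (F n x) b' n j' \<longleftrightarrow> b' = b \<and> j' = j"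
    using h(1) unfolding hit_def by blast
  obtain e' j' where 2: "b' = one \<or> b' = two" "enum ?k a e'"
    "\<And>i l. i \<epsilon> ?k \<Longrightarrow> l \<epsilon> ?k \<Longrightarrow> decode ?k g (F n x) emp i l \<longleftrightarrow> app e' i \<sqsubseteq> app e' l"
    "j' \<epsilon> ?k" "app e' j' = z'"
    "\<And>c i. c = one \<or> c = two \<Longrightarrow> i \<epsilon> ?k \<Longrightarrow> decode ?k g (F n x) c n i \<longleftrightarrow> c = b' \<and> i = j'"
    using h(2) unfolding hit_def by blast
  have bj: "b' = b \<and> j' = j" using 1(6)[OF 2(1) 2(4)] 2(6)[OF 2(1) 2(4)] by blast
  have "app e j = app e' j"
    by (rule enum_unique[OF a 1(2) 2(2) _ 1(4)]) (use 1(3) 2(3) in blast)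
  then show ?thesis using bj 1(5) 2(5) by simp
qed

lemma psurj_enum:
  assumes "psurj k a" "emp \<epsilon> a" shows "\<exists>e. enum k a e"
proof -
  obtain s where s: "\<And>a b b'. opair a b \<epsilon> s \<Longrightarrow> opair a b' \<epsilon> s \<Longrightarrow> b = b'"
    "\<And>b. b \<epsilon> a \<Longrightarrow> \<exists>j. j \<epsilon> k \<and> opair j b \<epsilon> s"
    using assms(1) unfolding psurj_def by metis
  \<comment> \<open>The partial map is made total on \<open>k\<close> by sending undefined or stray
    indices to \<open>emp\<close>.\<close>
  define E where "E j = (if app s j \<epsilon> a then app s j else emp)" for j
  have TE: "tdfn (\<lambda>e. E (e 0))" unfolding E_def by (intro dfn)
  have "\<exists>j. j \<epsilon> k \<and> E j = x" if x: "x \<epsilon> a" for x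
  proof -
    obtain j where j: "j \<epsilon> k" "opair j x \<epsilon> s" using s(2)[OF x] by blast
    then have "app s j = x" unfolding app_def using s(1) by (intro the1_eq) blast+
    then show ?thesis using j(1) x E_def by auto
  qed
  moreover have "E j \<epsilon> a" for j using assms(2) E_def by simp
  ultimately have "enum k a (lam k E)" unfolding enum_def using app_lam[OF TE] by metis
  then show ?thesis by blast
qed

text \<open>
  A Koenig-type diagonal argument: a single infinite subset of \<open>M\<close> codes an enumeration \<open>e\<close> of
  \<open>a\<close> together with, for every \<open>n\<close>, a value missed by the \<open>n\<close>-th decoding map. Only the existence of
  some \<open>e\<close> is used, so that no choice of an enumeration is needed.
\<close>

lemma hit_onto:
  assumes a: "ord a" "omega \<sqsubseteq> a" and g: "inf_seq a g"
  shows "\<exists>n. n \<epsilon> omega \<and> (\<forall>b z. (b = one \<or> b = two) \<and> z \<epsilon> a \<longrightarrow> (\<exists>x. hit a g n x b z))"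
proof (rule ccontr)
  assume no: "\<not> ?thesis"
  define k where "k = card_of a"
  note ka = card_of[OF a, folded k_def]
  have k: "initial k" "inf_seq k g" using ka(1,2) g unfolding inf_seq_def subset_of_def by blast+
  have omk: "omega \<sqsubseteq> k" and emk: "emp \<epsilon> k" and ema: "emp \<epsilon> a" and nF: "\<not> Fin k"
    using k(1) not_Fin_omega_le a(2) subD[OF _ emp_omega] unfolding initial_def by blast+
  have tags: "one \<epsilon> k" "two \<epsilon> k" using subD[OF omk] emp_omega succ_omega by blast+
  \<comment> \<open>\<open>B n\<close> is a copy that the \<open>n\<close>-th map fails to cover,
    with preference for \<open>one\<close>, and \<open>X n\<close> is the least element missed
    there. Both are class terms, so no choice is made over \<open>n\<close>.\<close>
  define B where "B n = (if \<exists>z. z \<epsilon> a \<and> \<not> (\<exists>x. hit a g n x one z) then one else two)" for n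
  define X where "X n = least_ord (\<lambda>z. z \<epsilon> a \<and> \<not> (\<exists>x. hit a g n x (B n) z))" for n
  have TB: "tdfn (\<lambda>e. B (e 0))" unfolding B_def by (intro dfn)
  have B12: "B n = one \<or> B n = two" for n unfolding B_def by simp
  have TX: "tdfn (\<lambda>e. X (e 0))" unfolding X_def by (intro dfn tdfn_subst1[OF TB])
  have X: "X n \<epsilon> a \<and> \<not> (\<exists>x. hit a g n x (B n) (X n))" if n: "n \<epsilon> omega" for n
  proof -
    obtain b z where bz: "b = one \<or> b = two" "z \<epsilon> a" "\<not> (\<exists>x. hit a g n x b z)" using no n by blast
    obtain z where z: "z \<epsilon> a \<and> \<not> (\<exists>x. hit a g n x (B n) z)"
    proof (cases "\<exists>z. z \<epsilon> a \<and> \<not> (\<exists>x. hit a g n x one z)")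
      case True
      then show ?thesis using that unfolding B_def by auto
    next
      case False
      then have "B n = two" "b = two" using bz unfolding B_def by auto
      then show ?thesis using bz by (intro that[of z]) simp
    qed
    have "dfn (\<lambda>e. e 0 \<epsilon> a \<and> \<not> (\<exists>x. hit a g n x (B n) (e 0)))" by (intro dfn)
    from least_ord_props(2)[OF this _ z, folded X_def] show ?thesis using z ord_mem[OF a(1)] by blast
  qed
  obtain e where e: "enum k a e" using psurj_enum[OF ka(3) ema] by blast
  define Y where "Y n = least_ord (\<lambda>j. j \<epsilon> k \<and> app e j = X n)" for n
  have TY: "tdfn (\<lambda>e. Y (e 0))" unfolding Y_def by (intro dfn tdfn_subst1[OF TX])
  have Y: "Y n \<epsilon> k \<and> app e (Y n) = X n" if n: "n \<epsilon> omega" for n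
  proof -
    obtain j where j: "j \<epsilon> k \<and> app e j = X n" using e X[OF n] unfolding enum_def by blast
    have "ord j" using j k(1) ord_mem unfolding initial_def by blast
    have "dfn (\<lambda>u. u 0 \<epsilon> k \<and> app e (u 0) = X n)" by (intro dfn)
    from least_ord_props(2)[OF this \<open>ord j\<close> j, folded Y_def] show ?thesis .
  qed
  \<comment> \<open>The relation to be coded: the order of \<open>e\<close> under tag
    \<open>emp\<close>, and one triple for each natural number \<open>j\<close> giving the missed
    copy and an index of the missed element.\<close>
  define C where "C i j l \<longleftrightarrow> i = emp \<and> app e j \<sqsubseteq> app e l \<or> j \<epsilon> omega \<and> i = B j \<and> l = Y j" for i j l
  define D where "D = coll (\<lambda>x. x \<epsilon> M \<and> (\<exists>i j l. triple k g x i j l \<and> C i j l))"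
  have D: "x \<epsilon> D \<longleftrightarrow> x \<epsilon> M \<and> (\<exists>i j l. triple k g x i j l \<and> C i j l)" for x
    unfolding D_def
  proof (rule mem_coll_sub[of _ M])
    show "dfn (\<lambda>u. u 0 \<epsilon> M \<and> (\<exists>i j l. triple k g (u 0) i j l \<and> C i j l))"
      unfolding C_def by (intro dfn tdfn_subst1[OF TB] tdfn_subst1[OF TY])
  qed blast
  have dec: "decode k g D i j l \<longleftrightarrow> C i j l" if "i \<epsilon> k" "j \<epsilon> k" "l \<epsilon> k" for i j l
  proof
    assume "decode k g D i j l"
    then obtain x where "x \<epsilon> D" "triple k g x i j l" using decode_def by blast
    then show "C i j l" using D triple_fun[OF k] by metis
  next
    assume "C i j l"
    then show "decode k g D i j l" using triple_onto[OF k that] D unfolding decode_def by blast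
  qed
  \<comment> \<open>\<open>D\<close> is infinite because reflexivity of the order puts all triples
    \<open>(emp, j, j)\<close> into the code.\<close>
  have "psurj D k"
  proof (rule psurjI[of "\<lambda>x j. triple k g x emp j j"])
    show "dfn (\<lambda>u. triple k g (u 0) emp (u (Suc 0)) (u (Suc 0)))" by (intro dfn)
    show "j = j'" if "triple k g x emp j j" "triple k g x emp j' j'" for x j j'
      using triple_fun[OF k that] by blast
    show "\<exists>x. x \<epsilon> D \<and> triple k g x emp j j" if "j \<epsilon> k" for j
      using dec[OF emk that that] C_def sub_refl unfolding decode_def by blast
  qed
  then have "\<not> Fin D" using Fin_psurj nF by blast
  moreover have "D \<sqsubseteq> M" using D by (auto simp: subset_of_def)
  ultimately obtain n x where nx: "n \<epsilon> omega" "x \<epsilon> M" "F n x = D" using F_onto by blast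
  have nk: "n \<epsilon> k" using subD[OF omk nx(1)] .
  have Bn: "B j \<noteq> emp" for j using B12[of j] one_two by auto
  have c1: "decode k g D emp i l \<longleftrightarrow> app e i \<sqsubseteq> app e l" if "i \<epsilon> k" "l \<epsilon> k" for i l
    using dec[OF emk that] Bn unfolding C_def by metis
  have c2: "decode k g D b' n j' \<longleftrightarrow> b' = B n \<and> j' = Y n" if "b' = one \<or> b' = two" "j' \<epsilon> k" for b' j'
  proof -
    have "b' \<epsilon> k" using that(1) tags by blast
    moreover have "b' \<noteq> emp" using that(1) one_two by metis
    ultimately show ?thesis using dec[of b' n j'] nk that(2) nx(1) unfolding C_def by blast
  qed
  \<comment> \<open>The code of \<open>x\<close> at its own level \<open>n\<close> decodes to the
    very pair that the \<open>n\<close>-th map was said to miss.\<close>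
  have "hit a g n x (B n) (X n)"
    unfolding hit_def k_def[symmetric] nx(3)
    using nx(2) B12 e c1 c2 Y[OF nx(1)] by blast
  then show False using X[OF nx(1)] by blast
qed

section \<open>A new infinite subset by Cantor's diagonal\<close>

definition hit_level where
  "hit_level a g = least_ord (\<lambda>n. n \<epsilon> omega \<and> (\<forall>b z. (b = one \<or> b = two) \<and> z \<epsilon> a \<longrightarrow> (\<exists>x. hit a g n x b z)))"

text \<open>The diagonal set is formed over copy \<open>one\<close> of \<open>a\<close>; all points
  sent to copy \<open>two\<close> are added to make it infinite.\<close>

definition fresh where
  "fresh a g = coll (\<lambda>x. x \<epsilon> M \<and> (\<exists>b z. hit a g (hit_level a g) x b z \<and> (b = two \<or> \<not> x \<epsilon> app g z)))"

lemma tdfn_hit_level: "tdfn (\<lambda>e. hit_level (e 0) (e (Suc 0)))" unfolding hit_level_def by (intro dfn)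
lemmas [dfn] = tdfn_subst2[OF tdfn_hit_level]
lemma tdfn_fresh: "tdfn (\<lambda>e. fresh (e 0) (e (Suc 0)))" unfolding fresh_def by (intro dfn)
lemmas [dfn] = tdfn_subst2[OF tdfn_fresh]

text \<open>Copy \<open>two\<close> already maps the set onto the infinite \<open>a\<close>. A point
  sent to \<open>z\<close> in copy \<open>one\<close> is in the set exactly if it is not in
  \<open>app g z\<close>, so the two sets differ.\<close>

lemma fresh:
  assumes a: "ord a" "omega \<sqsubseteq> a" and g: "inf_seq a g"
  shows "fresh a g \<sqsubseteq> M" "\<not> Fin (fresh a g)" "z \<epsilon> a \<Longrightarrow> app g z \<noteq> fresh a g"
proof -
  let ?n = "hit_level a g"
  have mem: "x \<epsilon> fresh a g \<longleftrightarrow> x \<epsilon> M \<and> (\<exists>b z. hit a g ?n x b z \<and> (b = two \<or> \<not> x \<epsilon> app g z))" for x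
    unfolding fresh_def by (rule mem_coll_sub[of _ M]) (intro dfn, blast)
  obtain n where n: "n \<epsilon> omega \<and> (\<forall>b z. (b = one \<or> b = two) \<and> z \<epsilon> a \<longrightarrow> (\<exists>x. hit a g n x b z))"
    using hit_onto[OF assms] by blast
  define R where "R n \<longleftrightarrow> n \<epsilon> omega \<and> (\<forall>b z. (b = one \<or> b = two) \<and> z \<epsilon> a \<longrightarrow> (\<exists>x. hit a g n x b z))" for n
  have DR: "dfn (\<lambda>e. R (e 0))" unfolding R_def by (intro dfn)
  have n': "ord n" "R n" using n omega_ord unfolding R_def by blast+
  have "?n = least_ord R" unfolding hit_level_def R_def ..
  then have "R ?n" using least_ord_props(2)[OF DR n'] by simp
  then have onto: "\<exists>x. hit a g ?n x b z" if "b = one \<or> b = two" "z \<epsilon> a" for b z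
    using that unfolding R_def by blast
  have hM: "x \<epsilon> M" if "hit a g ?n x b z" for x b z using that unfolding hit_def by blast
  show "fresh a g \<sqsubseteq> M" using mem by (auto simp: subset_of_def)
  show "\<not> Fin (fresh a g)"
  proof
    assume "Fin (fresh a g)"
    moreover have "psurj (fresh a g) a"
    proof (rule psurjI[of "\<lambda>x z. hit a g ?n x two z"])
      show "z = z'" if "hit a g ?n x two z" "hit a g ?n x two z'" for x z z'
        using hit_fun[OF a(1) that] by blast
      show "\<exists>x. x \<epsilon> fresh a g \<and> hit a g ?n x two z" if "z \<epsilon> a" for z
        using onto[OF _ that, of two] mem hM by blast
    qed (intro dfn)
    ultimately show False using Fin_psurj not_Fin_omega_le[OF a(2)] by blast
  qed
  show "app g z \<noteq> fresh a g" if za: "z \<epsilon> a"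
  proof
    assume eq: "app g z = fresh a g"
    obtain x where x: "hit a g ?n x one z" using onto[OF _ za, of one] by blast
    have "b = one \<and> z' = z" if "hit a g ?n x b z'" for b z' using hit_fun[OF a(1) x that] by blast
    then have "x \<epsilon> fresh a g \<longleftrightarrow> \<not> x \<epsilon> app g z" using mem x hM[OF x] one_two(3) by metis
    then show False using eq by simp
  qed
qed

subsection \<open>The transfinite sequence\<close>

definition tail_set where
  "tail_set n = coll (\<lambda>x. x \<epsilon> M \<and> (\<exists>m. m \<epsilon> omega \<and> opair x m \<epsilon> omega_map \<and> n \<sqsubseteq> m))"

text \<open>As \<open>fresh\<close> needs an infinite ordinal, the first \<open>omega\<close> terms
  are the tails of \<open>omega_map\<close>; afterwards \<open>h\<close> holds the sequence so
  far.\<close>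

definition sequence where
  "sequence a = ordrec (\<lambda>u v a h. if a \<epsilon> omega then tail_set a else fresh a h) emp emp a"

lemma tdfn_tail_set: "tdfn (\<lambda>e. tail_set (e 0))" unfolding tail_set_def by (intro dfn)
lemmas [dfn] = tdfn_subst1[OF tdfn_tail_set]
lemma tdfn_sequence: "tdfn (\<lambda>e. sequence (e 0))"
  unfolding sequence_def by (rule tdfn_subst3[OF tdfn_ordrec]) (intro dfn)+
lemmas [dfn] = tdfn_subst1[OF tdfn_sequence]

lemma mem_tail_set: "x \<epsilon> tail_set n \<longleftrightarrow> x \<epsilon> M \<and> (\<exists>m. m \<epsilon> omega \<and> opair x m \<epsilon> omega_map \<and> n \<sqsubseteq> m)"
  unfolding tail_set_def by (rule mem_coll_sub[of _ M]) (intro dfn, blast)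

lemma not_Fin_tail_set: assumes n: "n \<epsilon> omega" shows "\<not> Fin (tail_set n)"
proof
  assume F: "Fin (tail_set n)"
  have "psurj (tail_set n) (dif omega n)"
  proof (rule psurjI[of "\<lambda>x m. opair x m \<epsilon> omega_map"])
    show "b = b'" if "opair x b \<epsilon> omega_map" "opair x b' \<epsilon> omega_map" for x b b' using omega_map_fun that .
    show "\<exists>x. x \<epsilon> tail_set n \<and> opair x m \<epsilon> omega_map" if "m \<epsilon> dif omega n" for m
      using omega_map_onto[of m] that ord_not_mem[OF omega_ord omega_ord[OF n]] unfolding mem_tail_set mem_dif by blast
  qed (intro dfn)
  then have "Fin (cup n (dif omega n))" using F Fin_psurj Fin_cup Fin_omega[OF n] by blast
  then have "Fin omega" by (rule Fin_sub) (auto simp: subset_of_def)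
  then show False by simp
qed

lemma sequence_unfold:
  assumes "ord a"
  shows "sequence a = (if a \<epsilon> omega then tail_set a else fresh a (lam a sequence))"
proof -
  define G where "G = (\<lambda>(u::'a) (v::'a) a h. if a \<epsilon> omega then tail_set a else fresh a h)"
  have "tdfn (\<lambda>e. G (e 0) (e (Suc 0)) (e (Suc (Suc 0))) (e (Suc (Suc (Suc 0)))))"
    unfolding G_def by (intro dfn)
  from ordrec_unfold[OF this assms, of emp emp]
  have "ordrec G emp emp a = G emp emp a (lam a (ordrec G emp emp))" .
  moreover have "sequence = ordrec G emp emp" by (rule ext) (simp only: sequence_def G_def)
  ultimately show ?thesis by (simp add: G_def)
qed

lemma sequence_props:
  assumes "ord a"
  shows "sequence a \<sqsubseteq> M \<and> \<not> Fin (sequence a) \<and> (\<forall>b. b \<epsilon> a \<longrightarrow> sequence b \<noteq> sequence a)"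
proof (rule ord_induct[OF _ assms])
  show "dfn (\<lambda>e. sequence (e 0) \<sqsubseteq> M \<and> \<not> Fin (sequence (e 0)) \<and> (\<forall>b. b \<epsilon> e 0 \<longrightarrow> sequence b \<noteq> sequence (e 0)))"
    by (intro dfn)
  fix a assume a: "ord a" and IH: "\<And>z. z \<epsilon> a \<Longrightarrow> sequence z \<sqsubseteq> M \<and> \<not> Fin (sequence z) \<and>
    (\<forall>b. b \<epsilon> z \<longrightarrow> sequence b \<noteq> sequence z)"
  show "sequence a \<sqsubseteq> M \<and> \<not> Fin (sequence a) \<and> (\<forall>b. b \<epsilon> a \<longrightarrow> sequence b \<noteq> sequence a)"
  proof (cases "a \<epsilon> omega")
    case True
    have eq: "sequence a = tail_set a" using sequence_unfold[OF a] True by simp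
    have "sequence b \<noteq> sequence a" if b: "b \<epsilon> a" for b
    proof -
      have bom: "b \<epsilon> omega" using ord_trans[OF ord_omega True b] .
      then have eqb: "sequence b = tail_set b" using sequence_unfold[OF omega_ord] by simp
      \<comment> \<open>A point mapped to \<open>b\<close> lies in the tail from \<open>b\<close>
        but not in the tail from the larger \<open>a\<close>.\<close>
      obtain x where x: "x \<epsilon> M" "opair x b \<epsilon> omega_map" using omega_map_onto[OF bom] by blast
      have "x \<epsilon> tail_set b" using x bom mem_tail_set sub_refl by blast
      moreover have "\<not> a \<sqsubseteq> b" using b subD no_mem_self by blast
      then have "\<not> x \<epsilon> tail_set a" using x(2) omega_map_fun mem_tail_set by metis
      ultimately show ?thesis unfolding eq eqb by metis
    qed
    moreover have "tail_set a \<sqsubseteq> M" using mem_tail_set by (simp add: subset_of_def)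
    ultimately show ?thesis using not_Fin_tail_set[OF True] unfolding eq by blast
  next
    case False
    have omega: "omega \<sqsubseteq> a" using omega_le_or_mem[OF a] False by blast
    have eq: "sequence a = fresh a (lam a sequence)" using sequence_unfold[OF a] False by simp
    have app: "app (lam a sequence) x = sequence x" if "x \<epsilon> a" for x
      by (rule app_lam[OF tdfn_sequence that])
    have "x = y" if "x \<epsilon> a" "y \<epsilon> a" "sequence x = sequence y" for x y
      using ord_linear[OF ord_mem[OF a that(1)] ord_mem[OF a that(2)]] IH that by metis
    then have g: "inf_seq a (lam a sequence)" unfolding inf_seq_def using app IH by metis
    have "sequence b \<noteq> sequence a" if "b \<epsilon> a" for b
      using fresh(3)[OF a omega g that] app[OF that] eq by simp
    then show ?thesis using fresh(1,2)[OF a omega g] eq by simp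
  qed
qed

text \<open>Since \<open>sequence\<close> is injective on the ordinals with values in
  \<open>pow M\<close>, Replacement for its inverse collects all ordinals into a set.\<close>

lemma contradiction: False
proof -
  have "dfn (\<lambda>e. ord (e (Suc 0)) \<and> e 0 = sequence (e (Suc 0)))" by (intro dfn)
  moreover have "a = b" if "ord a \<and> B = sequence a" "ord b \<and> B = sequence b" for B a b
    using ord_linear[of a b] sequence_props[of a] sequence_props[of b] that by metis
  ultimately have "\<exists>u. \<forall>a. a \<epsilon> u \<longleftrightarrow> (\<exists>B. B \<epsilon> pow M \<and> ord a \<and> B = sequence a)"
    using repl_exists[of "\<lambda>B a. ord a \<and> B = sequence a" "pow M"] by blast
  then obtain u where u: "\<And>a. a \<epsilon> u \<longleftrightarrow> (\<exists>B. B \<epsilon> pow M \<and> ord a \<and> B = sequence a)" by blast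
  then have "a \<epsilon> u" if "ord a" for a using sequence_props[OF that] that by simp
  then show False using no_universal_ord[of u] by blast
qed

end

section \<open>From a surjection inside the model to a definable term \<open>F\<close>\<close>

theorem theorem4p4:
  fixes mem :: "'a \<Rightarrow> 'a \<Rightarrow> bool" and M \<omega> P Q :: 'a
  assumes "ZF_model mem"
    and "set_structure.infinite_set mem M"
    and "set_structure.is_omega mem \<omega>"
    and "set_structure.is_product mem \<omega> M P"
    and "set_structure.is_infinite_powerset mem M Q"
  shows "\<not> (\<exists>f. set_structure.is_surjection mem f P Q)"
proof
  assume "\<exists>f. set_structure.is_surjection mem f P Q"
  then obtain f where f: "set_structure.is_surjection mem f P Q" by blast
  interpret ZF_model mem by (rule assms(1))
  have P: "mem p P \<longleftrightarrow> (\<exists>n x. mem n omega \<and> mem x M \<and> p = opair n x)" for p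
    using assms(3,4) unfolding is_omega_iff is_product_def is_pair_iff by blast
  have Q: "mem B Q \<longleftrightarrow> subset_of B M \<and> \<not> Fin B" for B
    using assms(5) unfolding is_infinite_powerset_def infinite_set_def finite_set_iff_Fin by blast
  have fn: "\<exists>!b. mem (opair a b) f" if "mem a P" for a
    using f that unfolding is_surjection_def is_function_def maps_to_iff by blast
  have onto: "\<exists>a. mem a P \<and> mem (opair a b) f" if "mem b Q" for b
    using f that unfolding is_surjection_def maps_to_iff by blast
  \<comment> \<open>Applying \<open>f\<close> to the pair of \<open>n\<close> and \<open>x\<close>
    is a class term with parameter \<open>f\<close>.\<close>
  interpret infinite_powerset_surjection mem M "\<lambda>n x. app f (opair n x)"
  proof
    show "tdfn (\<lambda>e. app f (opair (e 0) (e (Suc 0))))" by (intro dfn)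
    show "\<not> Fin M" using assms(2) unfolding infinite_set_def finite_set_iff_Fin .
    fix B assume "subset_of B M" "\<not> Fin B"
    then obtain a where a: "mem a P" "mem (opair a B) f" using onto Q by blast
    then obtain n x where nx: "mem n omega" "mem x M" "a = opair n x" using P by blast
    have "app f a = B" unfolding app_def using fn[OF a(1)] a(2) by (intro the1_eq) blast+
    then show "\<exists>n x. mem n omega \<and> mem x M \<and> app f (opair n x) = B" using nx by blast
  qed
  show False by (rule contradiction)
qed

end
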